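(* Let $F:(M^m,g)\to(B^n,g')$ be a Clairaut conformal submersion between Riemannian manifolds with connected fibers, dilation $\lambda$ and $r=e^f$, where $f:M\to\mathbb{R}$ is smooth. Then $F:(M,e^{-2f}g)\to(B,g')$ is a Clairaut conformal submersion with totally geodesic fibers and $r=1$.
   Context: All manifolds, maps and functions are smooth; $\dim M=m$, $\dim B=n$. For a submersion $F:(M,g)\to(B,g')$, the vertical distribution is $\ker F_\ast$ and the horizontal distribution is its $g$-orthogonal complement. $F$ is a conformal submersion with dilation $\lambda:M\to\mathbb{R}^+$ if $g'(F_\ast X,F_\ast Y)=\lambda^2 g(X,Y)$ for all horizontal $X,Y$. A conformal submersion $F$ is a Clairaut conformal submersion with function $r:M\to\mathbb{R}^+$ if for every geodesic $\alpha$ of the metric on $M$ the function $t\mapsto r(\alpha(t))\sin\omega(t)$ is constant, where $\omega(t)\in[0,\pi/2]$ is the angle between $\dot\alpha(t)$ and the horizontal space at $\alpha(t)$. *)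

theory Defs
  imports "HOL-Analysis.Analysis"
begin

section \<open>Smooth maps between open subsets of Euclidean spaces\<close>

text \<open>All sets to which these notions are applied are open.\<close>

fun C_k_on :: "nat \<Rightarrow> ('d::euclidean_space \<Rightarrow> 'e::euclidean_space) \<Rightarrow> 'd set \<Rightarrow> bool" where
  "C_k_on 0 f S \<longleftrightarrow> continuous_on S f"
| "C_k_on (Suc k) f S \<longleftrightarrow>
     (\<forall>x\<in>S. f differentiable (at x)) \<and>
     (\<forall>v. C_k_on k (\<lambda>x. frechet_derivative f (at x) v) S)"

definition smooth_on :: "'d set \<Rightarrow> ('d::euclidean_space \<Rightarrow> 'e::euclidean_space) \<Rightarrow> bool" where
  "smooth_on S f \<longleftrightarrow> (\<forall>k. C_k_on k f S)"


section \<open>Smooth manifolds\<close>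

text \<open>
  A chart is a pair of its domain and its coordinate map. The values of the coordinate map
  outside of the domain are irrelevant. The manifold is the whole type \<open>'a\<close>; its dimension is
  \<open>DIM('e)\<close>. The Hausdorff property and second countability are imposed as sort constraints.
\<close>

type_synonym ('a, 'e) chart = "'a set \<times> ('a \<Rightarrow> 'e)"
type_synonym ('a, 'e) atlas = "('a, 'e) chart set"

abbreviation chart_inv :: "('a, 'e) chart \<Rightarrow> 'e \<Rightarrow> 'a" where
  "chart_inv c \<equiv> inv_into (fst c) (snd c)"

definition smooth_manifold ::
  "('a::{t2_space, second_countable_topology}, 'e::euclidean_space) atlas \<Rightarrow> bool" where
  "smooth_manifold A \<longleftrightarrow>
     (\<Union>c\<in>A. fst c) = UNIV \<and>
     (\<forall>c\<in>A. open (fst c) \<and> open (snd c ` fst c) \<and>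
             homeomorphism (fst c) (snd c ` fst c) (snd c) (chart_inv c)) \<and>
     (\<forall>c\<in>A. \<forall>d\<in>A. smooth_on (snd c ` (fst c \<inter> fst d)) (snd d \<circ> chart_inv c))"

definition euclidean_atlas :: "('e::euclidean_space, 'e) atlas" where
  "euclidean_atlas = {(UNIV, \<lambda>x. x)}"

text \<open>
  \<open>smooth_map A B W F\<close>: the map \<open>F\<close> is defined and smooth on the open set \<open>W\<close>. Real functions
  and curves are covered by taking \<^term>\<open>euclidean_atlas\<close> on the real line.
\<close>

definition smooth_map ::
  "('a::topological_space, 'd::euclidean_space) atlas \<Rightarrow>
   ('b::topological_space, 'e::euclidean_space) atlas \<Rightarrow> 'a set \<Rightarrow> ('a \<Rightarrow> 'b) \<Rightarrow> bool" where
  "smooth_map A B W F \<longleftrightarrow>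
     open W \<and> continuous_on W F \<and>
     (\<forall>c\<in>A. \<forall>d\<in>B. smooth_on (snd c ` (fst c \<inter> W \<inter> F -` fst d)) (snd d \<circ> F \<circ> chart_inv c))"

definition smooth_near ::
  "('a::topological_space, 'e::euclidean_space) atlas \<Rightarrow> 'a \<Rightarrow> ('a \<Rightarrow> real) \<Rightarrow> bool" where
  "smooth_near A p h \<longleftrightarrow> (\<exists>W. p \<in> W \<and> smooth_map A (euclidean_atlas :: (real, real) atlas) W h)"


section \<open>Tangent vectors\<close>

text \<open>
  Tangent vectors at \<open>p\<close> are directional derivative operators on the functions that are smooth
  near \<open>p\<close>; they are set to 0 on all other functions, so that equality of operators is equality
  of tangent vectors. \<open>coord_vec A p c e\<close> is the derivative at \<open>p\<close> in the direction \<open>e\<close> of the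
  coordinates \<open>c\<close>.
\<close>

type_synonym 'a tvec = "('a \<Rightarrow> real) \<Rightarrow> real"

definition coord_vec ::
  "('a::topological_space, 'e::euclidean_space) atlas \<Rightarrow> 'a \<Rightarrow> ('a, 'e) chart \<Rightarrow> 'e \<Rightarrow> 'a tvec" where
  "coord_vec A p c e =
     (\<lambda>h. if smooth_near A p h
          then frechet_derivative (h \<circ> chart_inv c) (at (snd c p)) e else 0)"

definition tangent_space ::
  "('a::topological_space, 'e::euclidean_space) atlas \<Rightarrow> 'a \<Rightarrow> 'a tvec set" where
  "tangent_space A p = {coord_vec A p c e | c e. c \<in> A \<and> p \<in> fst c}"

text \<open>The inverse of \<open>coord_vec A p c\<close>:\<close>

definition components :: "('a, 'e::euclidean_space) chart \<Rightarrow> 'a tvec \<Rightarrow> 'e" where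
  "components c v = (\<Sum>b\<in>Basis. v (\<lambda>q. snd c q \<bullet> b) *\<^sub>R b)"

definition differential ::
  "('b::topological_space, 'e::euclidean_space) atlas \<Rightarrow> ('a \<Rightarrow> 'b) \<Rightarrow> 'a \<Rightarrow> 'a tvec \<Rightarrow> 'b tvec" where
  "differential B F p v = (\<lambda>h. if smooth_near B (F p) h then v (h \<circ> F) else 0)"

definition velocity ::
  "('a::topological_space, 'e::euclidean_space) atlas \<Rightarrow> (real \<Rightarrow> 'a) \<Rightarrow> real \<Rightarrow> 'a tvec" where
  "velocity A \<alpha> t = (\<lambda>h. if smooth_near A (\<alpha> t) h then deriv (h \<circ> \<alpha>) t else 0)"

definition smooth_vector_field ::
  "('a::topological_space, 'e::euclidean_space) atlas \<Rightarrow> 'a set \<Rightarrow> ('a \<Rightarrow> 'a tvec) \<Rightarrow> bool" where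
  "smooth_vector_field A W X \<longleftrightarrow>
     open W \<and> (\<forall>p\<in>W. X p \<in> tangent_space A p) \<and>
     (\<forall>c\<in>A. smooth_on (snd c ` (fst c \<inter> W)) (\<lambda>x. components c (X (chart_inv c x))))"


section \<open>Riemannian metrics, Levi-Civita connection and geodesics\<close>

type_synonym 'a metric = "'a \<Rightarrow> 'a tvec \<Rightarrow> 'a tvec \<Rightarrow> real"

definition metric_coeff ::
  "('a::topological_space, 'e::euclidean_space) atlas \<Rightarrow> 'a metric \<Rightarrow> ('a, 'e) chart \<Rightarrow>
   'e \<Rightarrow> 'e \<Rightarrow> 'e \<Rightarrow> real" where
  "metric_coeff A g c x u v =
     g (chart_inv c x) (coord_vec A (chart_inv c x) c u) (coord_vec A (chart_inv c x) c v)"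

definition riemannian_manifold ::
  "('a::{t2_space, second_countable_topology}, 'e::euclidean_space) atlas \<Rightarrow> 'a metric \<Rightarrow> bool" where
  "riemannian_manifold A g \<longleftrightarrow>
     smooth_manifold A \<and>
     (\<forall>p. \<forall>u\<in>tangent_space A p. \<forall>v\<in>tangent_space A p.
        g p u v = g p v u \<and>
        (u \<noteq> (\<lambda>_. 0) \<longrightarrow> g p u u > 0) \<and>
        (\<forall>w\<in>tangent_space A p. \<forall>a b.
           g p (\<lambda>h. a * u h + b * v h) w = a * g p u w + b * g p v w)) \<and>
     (\<forall>c\<in>A. \<forall>u v. smooth_on (snd c ` fst c) (\<lambda>x. metric_coeff A g c x u v))"

text \<open>
  Coordinate-free form of the Christoffel symbols of the chart \<open>c\<close>:
  \<open>christoffel A g c x u v\<close> has the components \<open>\<Sum>i j. \<Gamma>\<^sup>k\<^sub>i\<^sub>j u\<^sub>i v\<^sub>j\<close>. It is obtained from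
  the Koszul formula for constant coordinate fields.
\<close>

definition christoffel ::
  "('a::topological_space, 'e::euclidean_space) atlas \<Rightarrow> 'a metric \<Rightarrow> ('a, 'e) chart \<Rightarrow>
   'e \<Rightarrow> 'e \<Rightarrow> 'e \<Rightarrow> 'e" where
  "christoffel A g c x u v =
     (THE z. \<forall>w. 2 * metric_coeff A g c x z w =
        frechet_derivative (\<lambda>y. metric_coeff A g c y v w) (at x) u +
        frechet_derivative (\<lambda>y. metric_coeff A g c y u w) (at x) v -
        frechet_derivative (\<lambda>y. metric_coeff A g c y u v) (at x) w)"

text \<open>
  The Levi-Civita covariant derivative of \<open>Y\<close> in the direction \<open>X\<close> at \<open>p\<close>, computed in a chart
  \<open>c\<close> around \<open>p\<close>. The result does not depend on the chart.
\<close>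

definition cov_deriv ::
  "('a::topological_space, 'e::euclidean_space) atlas \<Rightarrow> 'a metric \<Rightarrow> ('a, 'e) chart \<Rightarrow>
   ('a \<Rightarrow> 'a tvec) \<Rightarrow> ('a \<Rightarrow> 'a tvec) \<Rightarrow> 'a \<Rightarrow> 'a tvec" where
  "cov_deriv A g c X Y p = coord_vec A p c
     (frechet_derivative (\<lambda>x. components c (Y (chart_inv c x))) (at (snd c p)) (components c (X p))
      + christoffel A g c (snd c p) (components c (X p)) (components c (Y p)))"

text \<open>
  The geodesic equation \<open>x'' + \<Gamma>(x', x') = 0\<close> is invariant under changes of charts, so it is
  immaterial which chart around the point \<open>\<alpha> t\<close> is used.
\<close>

definition geodesic_on ::
  "('a::topological_space, 'e::euclidean_space) atlas \<Rightarrow> 'a metric \<Rightarrow> real set \<Rightarrow>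
   (real \<Rightarrow> 'a) \<Rightarrow> bool" where
  "geodesic_on A g I \<alpha> \<longleftrightarrow>
     open I \<and> is_interval I \<and>
     smooth_map (euclidean_atlas :: (real, real) atlas) A I \<alpha> \<and>
     (\<forall>t\<in>I. \<exists>c\<in>A. \<alpha> t \<in> fst c \<and>
        (let x = snd c \<circ> \<alpha>; x' = (\<lambda>s. vector_derivative x (at s)) in
           vector_derivative x' (at t) + christoffel A g c (x t) (x' t) (x' t) = 0))"


section \<open>Clairaut conformal submersions\<close>

definition submersion ::
  "('a::topological_space, 'd::euclidean_space) atlas \<Rightarrow>
   ('b::topological_space, 'e::euclidean_space) atlas \<Rightarrow> ('a \<Rightarrow> 'b) \<Rightarrow> bool" where
  "submersion A B F \<longleftrightarrow>
     smooth_map A B UNIV F \<and>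
     (\<forall>p. differential B F p ` tangent_space A p = tangent_space B (F p))"

definition vertical_space ::
  "('a::topological_space, 'd::euclidean_space) atlas \<Rightarrow>
   ('b::topological_space, 'e::euclidean_space) atlas \<Rightarrow> ('a \<Rightarrow> 'b) \<Rightarrow> 'a \<Rightarrow> 'a tvec set" where
  "vertical_space A B F p = {v \<in> tangent_space A p. differential B F p v = (\<lambda>_. 0)}"

definition horizontal_space ::
  "('a::topological_space, 'd::euclidean_space) atlas \<Rightarrow> 'a metric \<Rightarrow>
   ('b::topological_space, 'e::euclidean_space) atlas \<Rightarrow> ('a \<Rightarrow> 'b) \<Rightarrow> 'a \<Rightarrow> 'a tvec set" where
  "horizontal_space A g B F p =
     {v \<in> tangent_space A p. \<forall>u\<in>vertical_space A B F p. g p u v = 0}"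

definition conformal_submersion ::
  "('a::{t2_space, second_countable_topology}, 'd::euclidean_space) atlas \<Rightarrow> 'a metric \<Rightarrow>
   ('b::{t2_space, second_countable_topology}, 'e::euclidean_space) atlas \<Rightarrow> 'b metric \<Rightarrow>
   ('a \<Rightarrow> 'b) \<Rightarrow> ('a \<Rightarrow> real) \<Rightarrow> bool" where
  "conformal_submersion A g B g' F l \<longleftrightarrow>
     riemannian_manifold A g \<and> riemannian_manifold B g' \<and> submersion A B F \<and>
     smooth_map A (euclidean_atlas :: (real, real) atlas) UNIV l \<and> (\<forall>p. l p > 0) \<and>
     (\<forall>p. \<forall>X\<in>horizontal_space A g B F p. \<forall>Y\<in>horizontal_space A g B F p.
        g' (F p) (differential B F p X) (differential B F p Y) = (l p)\<^sup>2 * g p X Y)"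

definition horizontal_part ::
  "('a::topological_space, 'd::euclidean_space) atlas \<Rightarrow> 'a metric \<Rightarrow>
   ('b::topological_space, 'e::euclidean_space) atlas \<Rightarrow> ('a \<Rightarrow> 'b) \<Rightarrow> 'a \<Rightarrow> 'a tvec \<Rightarrow> 'a tvec" where
  "horizontal_part A g B F p v =
     (THE w. w \<in> horizontal_space A g B F p \<and> (\<lambda>h. v h - w h) \<in> vertical_space A B F p)"

text \<open>
  The angle in \<open>[0, \<pi>/2]\<close> between a vector \<open>v \<noteq> 0\<close> and the horizontal space, i.e. the angle
  between \<open>v\<close> and its orthogonal projection (\<open>\<pi>/2\<close> if the projection vanishes).
\<close>

definition horizontal_angle ::
  "('a::topological_space, 'd::euclidean_space) atlas \<Rightarrow> 'a metric \<Rightarrow>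
   ('b::topological_space, 'e::euclidean_space) atlas \<Rightarrow> ('a \<Rightarrow> 'b) \<Rightarrow> 'a \<Rightarrow> 'a tvec \<Rightarrow> real" where
  "horizontal_angle A g B F p v =
     (let w = horizontal_part A g B F p v in arccos (sqrt (g p w w) / sqrt (g p v v)))"

text \<open>Geodesics of speed 0 are left out because their angle is not defined.\<close>

definition clairaut_conformal_submersion ::
  "('a::{t2_space, second_countable_topology}, 'd::euclidean_space) atlas \<Rightarrow> 'a metric \<Rightarrow>
   ('b::{t2_space, second_countable_topology}, 'e::euclidean_space) atlas \<Rightarrow> 'b metric \<Rightarrow>
   ('a \<Rightarrow> 'b) \<Rightarrow> ('a \<Rightarrow> real) \<Rightarrow> ('a \<Rightarrow> real) \<Rightarrow> bool" where
  "clairaut_conformal_submersion A g B g' F l r \<longleftrightarrow>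
     conformal_submersion A g B g' F l \<and>
     smooth_map A (euclidean_atlas :: (real, real) atlas) UNIV r \<and> (\<forall>p. r p > 0) \<and>
     (\<forall>I \<alpha>. geodesic_on A g I \<alpha> \<and> (\<forall>t\<in>I. velocity A \<alpha> t \<noteq> (\<lambda>_. 0)) \<longrightarrow>
        (\<exists>k. \<forall>t\<in>I. r (\<alpha> t) * sin (horizontal_angle A g B F (\<alpha> t) (velocity A \<alpha> t)) = k))"

text \<open>
  The fibers are totally geodesic if their second fundamental form, the horizontal part of the
  covariant derivative of vertical fields along each other, vanishes.
\<close>

definition totally_geodesic_fibers ::
  "('a::topological_space, 'd::euclidean_space) atlas \<Rightarrow> 'a metric \<Rightarrow>
   ('b::topological_space, 'e::euclidean_space) atlas \<Rightarrow> ('a \<Rightarrow> 'b) \<Rightarrow> bool" where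
  "totally_geodesic_fibers A g B F \<longleftrightarrow>
     (\<forall>W U V. smooth_vector_field A W U \<and> (\<forall>p\<in>W. U p \<in> vertical_space A B F p) \<and>
              smooth_vector_field A W V \<and> (\<forall>p\<in>W. V p \<in> vertical_space A B F p) \<longrightarrow>
        (\<forall>p\<in>W. \<forall>c\<in>A. p \<in> fst c \<longrightarrow> cov_deriv A g c U V p \<in> vertical_space A B F p))"

end

theory Submission
  imports Defs
begin

text \<open>
  Along a geodesic the squared length of the velocity is constant, so the Clairaut condition says
  that the quadratic form \<open>e\<^sup>2\<^sup>f (g - Q)\<close> is a first integral of the geodesic flow, where
  \<open>Q = l\<^sup>-\<^sup>2 F\<^sup>* g'\<close> is the horizontal part of \<open>g\<close>. Since there is a geodesic in every direction,
  this is a pointwise identity between cubic forms. On vertical vectors it gives that \<open>f\<close> is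
  constant along the fibers, and then the Koszul formula shows that \<open>e\<^sup>-\<^sup>2\<^sup>f Q\<close> is a first integral of the
  geodesic flow of \<open>e\<^sup>-\<^sup>2\<^sup>f g\<close>, which is the Clairaut condition with \<open>r = 1\<close>. The polarization of
  that first integral on two vertical and one arbitrary argument, combined with the
  integrability of the vertical distribution, says that the second fundamental form of the
  fibers vanishes.
\<close>

section \<open>Calculus of smooth maps\<close>

text \<open>With D the Levi-Civita derivative of \<open>g\<close>, the cubic identity reads
  \<open>(D_v Q)(v,v) = 2 df(v) (g - Q)(v,v)\<close>. For the conformal metric, the Koszul formula
  is paired with the horizontal part \<open>h\<close> of \<open>v\<close> and so differentiates the
  factor \<open>e^(-2f)\<close> along \<open>h\<close> as well as along \<open>v\<close>. Since
  \<open>df\<close> vanishes on vertical vectors, \<open>df(h) = df(v)\<close>, and the extra terms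
  match the right-hand side above exactly. \<open>Q\<close> is preferred to the vertical part of
  \<open>g\<close> because it is pulled back from the base: its smoothness, its kernel and the
  integrability of that kernel can all be read off from the coordinate expression of
  \<open>F\<close>, the last one from the symmetry of second derivatives. The computation thus takes
  place with fields of bilinear forms on open sets of Euclidean space. The remaining obstacle is
  analytic: a geodesic is needed in every direction, but the Christoffel term is given only through
  its pairings with a varying metric, so its smooth dependence on the point must be established
  before the geodesic equation is a smooth ODE.\<close>

lemma C_k_on_cong:
  assumes "open S" "\<And>x. x \<in> S \<Longrightarrow> f x = g x" "C_k_on k f S"
  shows "C_k_on k g S"
  using assms(2,3)
proof (induction k arbitrary: f g)
  case 0
  then show ?case by (auto cong: continuous_on_cong)
next
  case (Suc k)
  have 1: "(g has_derivative frechet_derivative f (at x)) (at x)" if "x \<in> S" for x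
    by (rule has_derivative_transform_within_open[of f _ x UNIV S])
       (use assms(1) that Suc.prems in \<open>auto simp: frechet_derivative_works[symmetric]\<close>)
  have 2: "frechet_derivative f (at x) v = frechet_derivative g (at x) v" if "x \<in> S" for x v
    using frechet_derivative_at[OF 1[OF that]] by simp
  have "C_k_on k (\<lambda>x. frechet_derivative g (at x) v) S" for v
    by (rule Suc.IH[OF 2]) (use Suc.prems in auto)
  then show ?case using 1 by (auto simp: differentiable_def)
qed

text \<open>Lets an explicit derivative stand in for the chosen \<open>frechet_derivative\<close>;
  most closure properties below are proved through it.\<close>

lemma C_k_on_SucI:
  assumes "open S" "\<And>x. x \<in> S \<Longrightarrow> (f has_derivative f' x) (at x)" "\<And>v. C_k_on k (\<lambda>x. f' x v) S"
  shows "C_k_on (Suc k) f S"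
proof -
  have "f' x = frechet_derivative f (at x)" if "x \<in> S" for x
    using assms(2)[OF that] by (rule frechet_derivative_at)
  then have "C_k_on k (\<lambda>x. frechet_derivative f (at x) v) S" for v
    using C_k_on_cong[OF assms(1) _ assms(3)[of v], of "\<lambda>x. frechet_derivative f (at x) v"] by simp
  then show ?thesis using assms(2) by (auto simp: differentiable_def)
qed

lemma C_k_on_has_derivative:
  "C_k_on (Suc k) f S \<Longrightarrow> x \<in> S \<Longrightarrow> (f has_derivative frechet_derivative f (at x)) (at x)"
  by (simp add: frechet_derivative_works[symmetric])

lemma C_k_on_imp_continuous_on: "C_k_on k f S \<Longrightarrow> continuous_on S f"
  by (cases k)
     (auto intro!: differentiable_imp_continuous_on simp: differentiable_on_def differentiable_at_withinI)

lemma C_k_on_SucD: "C_k_on (Suc k) f S \<Longrightarrow> C_k_on k f S"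
proof (induction k arbitrary: f)
  case 0
  then show ?case using C_k_on_imp_continuous_on[OF 0] by simp
next
  case (Suc k)
  then show ?case by (metis C_k_on.simps(2))
qed

lemma C_k_on_subset: "C_k_on k f S \<Longrightarrow> T \<subseteq> S \<Longrightarrow> C_k_on k f T"
  by (induction k arbitrary: f) (auto intro: continuous_on_subset)

lemma C_k_on_local:
  assumes "\<And>x. x \<in> S \<Longrightarrow> \<exists>T. open T \<and> x \<in> T \<and> C_k_on k f T"
  shows "C_k_on k f S"
  using assms
proof (induction k arbitrary: f)
  case 0
  then show ?case
    by (metis C_k_on.simps(1) continuous_at_imp_continuous_on continuous_on_eq_continuous_at)
next
  case (Suc k)
  then show ?case
    by (simp only: C_k_on.simps) meson
qed

lemma C_k_on_const: "C_k_on k (\<lambda>x. c) S"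
  by (induction k arbitrary: c) auto

lemma C_k_on_bounded_linear:
  assumes "bounded_linear f" "open S" shows "C_k_on k f S"
proof (cases k)
  case 0
  then show ?thesis using assms by (simp add: linear_continuous_on)
next
  case (Suc k)
  show ?thesis unfolding Suc
    by (rule C_k_on_SucI[OF assms(2), where f' = "\<lambda>_. f"])
       (use assms in \<open>auto intro: bounded_linear_imp_has_derivative C_k_on_const\<close>)
qed

lemma C_k_on_add:
  assumes "open S" "C_k_on k f S" "C_k_on k g S"
  shows "C_k_on k (\<lambda>x. f x + g x) S"
  using assms(2,3)
proof (induction k arbitrary: f g)
  case 0
  then show ?case by (auto intro: continuous_on_add)
next
  case (Suc k)
  show ?case
    by (rule C_k_on_SucI[OF assms(1) has_derivative_add[OF C_k_on_has_derivative[OF Suc.prems(1)]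
            C_k_on_has_derivative[OF Suc.prems(2)]]])
       (use Suc in auto)
qed

lemma C_k_on_sum:
  assumes "open S" "\<And>i. i \<in> I \<Longrightarrow> C_k_on k (f i) S"
  shows "C_k_on k (\<lambda>x. \<Sum>i\<in>I. f i x) S"
  using assms(2)
  by (induction I rule: infinite_finite_induct) (auto intro!: C_k_on_const C_k_on_add assms(1))

text \<open>One product rule for multiplication, scaling and inner products. Each summand of the
  derivative pairs one factor with the derivative of the other, and a factor of class
  \<open>Suc k\<close> is also of class \<open>k\<close>, so the induction closes.\<close>

lemma C_k_on_bilinear:
  fixes prod :: "'b::euclidean_space \<Rightarrow> 'c::euclidean_space \<Rightarrow> 'd::euclidean_space"
    and f :: "'a::euclidean_space \<Rightarrow> 'b"
  assumes bil: "bounded_bilinear prod" and "open S" "C_k_on k f S" "C_k_on k g S"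
  shows "C_k_on k (\<lambda>x. prod (f x) (g x)) S"
  using assms(3,4)
proof (induction k arbitrary: f g)
  case 0
  then show ?case by (auto intro: bounded_bilinear.continuous_on[OF bil])
next
  case (Suc k)
  show ?case
    by (rule C_k_on_SucI[OF assms(2) bounded_bilinear.FDERIV[OF bil
            C_k_on_has_derivative[OF Suc.prems(1)] C_k_on_has_derivative[OF Suc.prems(2)]]])
       (use Suc C_k_on_SucD[OF Suc.prems(1)] C_k_on_SucD[OF Suc.prems(2)] in
         \<open>auto intro!: C_k_on_add assms(2)\<close>)
qed

lemma linear_eq_basis_sum:
  fixes L :: "'a::euclidean_space \<Rightarrow> 'b::real_vector"
  assumes "linear L" shows "L v = (\<Sum>b\<in>Basis. (v \<bullet> b) *\<^sub>R L b)"
proof -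
  have "L v = L (\<Sum>b\<in>Basis. (v \<bullet> b) *\<^sub>R b)" by (simp add: euclidean_representation)
  also have "\<dots> = (\<Sum>b\<in>Basis. (v \<bullet> b) *\<^sub>R L b)"
    by (simp add: linear_sum[OF assms] linear_scale[OF assms] del: euclidean_representation)
  finally show ?thesis .
qed

lemma C_k_on_compose:
  assumes "open S" "open T" "g ` S \<subseteq> T" "C_k_on k f T" "C_k_on k g S"
  shows "C_k_on k (\<lambda>x. f (g x)) S"
  using assms(4,5)
proof (induction k arbitrary: f)
  case 0
  then show ?case using continuous_on_compose2 assms(3) by (auto)
next
  case (Suc k)
  let ?D = "\<lambda>f x. frechet_derivative f (at x)"
  \<comment> \<open>\<open>C_k_on\<close> controls derivatives in fixed directions only, while here
    the direction varies with \<open>x\<close>. The basis expansion leaves fixed directions with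
    varying coefficients.\<close>
  have eq: "?D f (g x) (?D g x v) = (\<Sum>b\<in>Basis. (?D g x v \<bullet> b) *\<^sub>R ?D f (g x) b)" if "x \<in> S" for x v
    by (rule linear_eq_basis_sum)
       (use Suc.prems(1) assms(3) that in \<open>auto intro!: linear_frechet_derivative\<close>)
  show ?case
  proof (rule C_k_on_SucI[OF assms(1)])
    show "((\<lambda>x. f (g x)) has_derivative (\<lambda>v. ?D f (g x) (?D g x v))) (at x)" if "x \<in> S" for x
      by (rule has_derivative_compose[OF C_k_on_has_derivative C_k_on_has_derivative])
         (use Suc.prems assms(3) that in auto)
    fix v
    have "C_k_on k (\<lambda>x. \<Sum>b\<in>Basis. (?D g x v \<bullet> b) *\<^sub>R ?D f (g x) b) S"
      by (intro C_k_on_sum C_k_on_bilinear[OF bounded_bilinear_scaleR] Suc.IH assms(1)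
            C_k_on_bilinear[OF bounded_bilinear_inner] C_k_on_const)
         (use Suc.prems C_k_on_SucD[OF Suc.prems(2)] in auto)
    then show "C_k_on k (\<lambda>x. ?D f (g x) (?D g x v)) S"
      by (rule C_k_on_cong[OF assms(1), rotated]) (simp add: eq)
  qed
qed

lemma C_k_on_exp: "C_k_on k (exp :: real \<Rightarrow> real) UNIV"
proof (induction k)
  case 0
  then show ?case by (simp add: continuous_on_exp)
next
  case (Suc k)
  show ?case
    by (rule C_k_on_SucI[where f' = "\<lambda>x v. v * exp x"])
       (auto intro!: derivative_eq_intros C_k_on_bilinear[OF bounded_bilinear_mult] C_k_on_const Suc)
qed

lemma C_k_on_inverse: "C_k_on k (inverse :: real \<Rightarrow> real) (- {0})"
proof (induction k)
  case 0
  then show ?case by (auto intro!: continuous_intros)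
next
  case (Suc k)
  have "C_k_on k (\<lambda>x::real. (- v) * (inverse x * inverse x)) (- {0})" for v
    by (intro C_k_on_bilinear[OF bounded_bilinear_mult] C_k_on_const Suc) auto
  then show ?case
    by (intro C_k_on_SucI[where f' = "\<lambda>x v. - v * (inverse x * inverse x)"])
       (auto intro!: derivative_eq_intros)
qed

lemma smooth_on_imp_C_k: "smooth_on S f \<Longrightarrow> C_k_on k f S"
  by (simp add: smooth_on_def)

lemma smooth_on_has_derivative:
  "smooth_on S f \<Longrightarrow> x \<in> S \<Longrightarrow> (f has_derivative frechet_derivative f (at x)) (at x)"
  using C_k_on_has_derivative smooth_on_imp_C_k by blast

lemma smooth_on_differentiable: "smooth_on S f \<Longrightarrow> x \<in> S \<Longrightarrow> f differentiable (at x)"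
  using smooth_on_has_derivative by (auto simp: differentiable_def)

lemma smooth_on_imp_continuous_on: "smooth_on S f \<Longrightarrow> continuous_on S f"
  using C_k_on_imp_continuous_on smooth_on_imp_C_k by blast

lemma smooth_on_frechet_derivative:
  "smooth_on S f \<Longrightarrow> smooth_on S (\<lambda>x. frechet_derivative f (at x) v)"
  unfolding smooth_on_def by (metis C_k_on.simps(2))

lemma smooth_on_cong:
  "open S \<Longrightarrow> (\<And>x. x \<in> S \<Longrightarrow> f x = g x) \<Longrightarrow> smooth_on S f \<Longrightarrow> smooth_on S g"
  unfolding smooth_on_def using C_k_on_cong by blast

lemma smooth_on_subset: "smooth_on S f \<Longrightarrow> T \<subseteq> S \<Longrightarrow> smooth_on T f"
  unfolding smooth_on_def using C_k_on_subset by blast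

lemma smooth_on_local:
  assumes "\<And>x. x \<in> S \<Longrightarrow> \<exists>T. open T \<and> x \<in> T \<and> smooth_on T f"
  shows "smooth_on S f"
  using assms unfolding smooth_on_def by (meson C_k_on_local)

lemma smooth_on_const: "smooth_on S (\<lambda>x. c)"
  by (simp add: smooth_on_def C_k_on_const)

lemma smooth_on_bounded_linear: "bounded_linear f \<Longrightarrow> open S \<Longrightarrow> smooth_on S f"
  by (simp add: smooth_on_def C_k_on_bounded_linear)

lemma smooth_on_add:
  "open S \<Longrightarrow> smooth_on S f \<Longrightarrow> smooth_on S g \<Longrightarrow> smooth_on S (\<lambda>x. f x + g x)"
  by (simp add: smooth_on_def C_k_on_add)

lemma smooth_on_sum:
  "open S \<Longrightarrow> (\<And>i. i \<in> I \<Longrightarrow> smooth_on S (f i)) \<Longrightarrow> smooth_on S (\<lambda>x. \<Sum>i\<in>I. f i x)"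
  by (simp add: smooth_on_def C_k_on_sum)

lemma smooth_on_bilinear:
  fixes prod :: "'b::euclidean_space \<Rightarrow> 'c::euclidean_space \<Rightarrow> 'd::euclidean_space"
    and f :: "'a::euclidean_space \<Rightarrow> 'b"
  shows
  "bounded_bilinear prod \<Longrightarrow> open S \<Longrightarrow> smooth_on S f \<Longrightarrow> smooth_on S g \<Longrightarrow>
   smooth_on S (\<lambda>x. prod (f x) (g x))"
  by (simp add: smooth_on_def C_k_on_bilinear)

lemmas smooth_on_mult = smooth_on_bilinear[OF bounded_bilinear_mult]
  and smooth_on_scaleR = smooth_on_bilinear[OF bounded_bilinear_scaleR]
  and smooth_on_inner = smooth_on_bilinear[OF bounded_bilinear_inner]

lemma smooth_on_compose:
  assumes "open S" "open T" "g ` S \<subseteq> T" "smooth_on T f" "smooth_on S g"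
  shows "smooth_on S (\<lambda>x. f (g x))"
  using assms by (simp add: smooth_on_def C_k_on_compose)

lemma smooth_on_linear_compose:
  assumes "bounded_linear L" "open S" "smooth_on S f"
  shows "smooth_on S (\<lambda>x. L (f x))"
  using assms smooth_on_bounded_linear smooth_on_compose by (metis open_UNIV subset_UNIV)

lemma smooth_on_exp: "open S \<Longrightarrow> smooth_on S f \<Longrightarrow> smooth_on S (\<lambda>x. exp (f x :: real))"
  by (rule smooth_on_compose[where T = UNIV]) (auto simp: smooth_on_def C_k_on_exp)

lemma smooth_on_inverse:
  "open S \<Longrightarrow> smooth_on S f \<Longrightarrow> (\<And>x. x \<in> S \<Longrightarrow> f x \<noteq> 0) \<Longrightarrow> smooth_on S (\<lambda>x. inverse (f x :: real))"
  by (rule smooth_on_compose[where T = "- {0}"]) (auto simp: smooth_on_def C_k_on_inverse)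

lemma smooth_on_Pair:
  assumes "open S" "smooth_on S f" "smooth_on S g"
  shows "smooth_on S (\<lambda>x. (f x, g x))"
proof -
  have "bounded_linear (\<lambda>u. (u, 0))" "bounded_linear (\<lambda>u. (0, u))"
    by (auto intro: bounded_linear_Pair bounded_linear_ident bounded_linear_zero)
  then have "smooth_on S (\<lambda>x. (f x, 0) + (0, g x))"
    using assms by (intro smooth_on_add smooth_on_linear_compose[where L = "\<lambda>u. (u, 0)"]
        smooth_on_linear_compose[where L = "\<lambda>u. (0, u)"])
  then show ?thesis by simp
qed

section \<open>Symmetry of second derivatives\<close>

lemma frechet_derivative_inner:
  assumes "f differentiable (at x)"
  shows "frechet_derivative (\<lambda>y. f y \<bullet> b) (at x) v = frechet_derivative f (at x) v \<bullet> b"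
proof -
  have "((\<lambda>y. f y \<bullet> b) has_derivative (\<lambda>v. frechet_derivative f (at x) v \<bullet> b)) (at x)"
    using assms by (intro has_derivative_inner_left) (simp add: frechet_derivative_works)
  then show ?thesis by (metis frechet_derivative_at)
qed

text \<open>The second difference of \<open>f\<close> over a small parallelogram with sides
  \<open>s u\<close> and \<open>s v\<close> is symmetric in \<open>u\<close> and \<open>v\<close>.
  Two applications of the mean value theorem express it as \<open>s^2\<close> times either mixed
  derivative at a nearby point, and continuity at \<open>x\<close> makes the two agree.\<close>

lemma frechet_derivative_symmetric_real:
  fixes f :: "'a::euclidean_space \<Rightarrow> real"
  assumes "open S" "smooth_on S f" "x \<in> S"
  shows "frechet_derivative (\<lambda>y. frechet_derivative f (at y) u) (at x) v =
         frechet_derivative (\<lambda>y. frechet_derivative f (at y) v) (at x) u"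
proof -
  let ?D = "\<lambda>f x. frechet_derivative f (at x)"
  have square: "\<exists>\<xi> \<eta>. 0 < \<xi> \<and> \<xi> < s \<and> 0 < \<eta> \<and> \<eta> < s \<and>
      f (x + s *\<^sub>R u + s *\<^sub>R v) - f (x + s *\<^sub>R u) - (f (x + s *\<^sub>R v) - f x)
        = s * (s * ?D (\<lambda>y. ?D f y u) (x + \<xi> *\<^sub>R u + \<eta> *\<^sub>R v) v)"
    if s: "s > 0" and sub: "\<And>a b. 0 \<le> a \<Longrightarrow> a \<le> s \<Longrightarrow> 0 \<le> b \<Longrightarrow> b \<le> s \<Longrightarrow> x + a *\<^sub>R u + b *\<^sub>R v \<in> S"
    for u v s
  proof -
    have df: "((\<lambda>a. h (x + a *\<^sub>R u + b *\<^sub>R v)) has_derivative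
         (\<lambda>t. t * ?D h (x + a *\<^sub>R u + b *\<^sub>R v) u)) (at a)"
      and dg: "((\<lambda>b. h (x + a *\<^sub>R u + b *\<^sub>R v)) has_derivative
         (\<lambda>t. t * ?D h (x + a *\<^sub>R u + b *\<^sub>R v) v)) (at b)"
      if "0 \<le> a" "a \<le> s" "0 \<le> b" "b \<le> s" "smooth_on S h" for a b h
    proof -
      have D: "(h has_derivative ?D h (x + a *\<^sub>R u + b *\<^sub>R v)) (at (x + a *\<^sub>R u + b *\<^sub>R v))"
        using smooth_on_has_derivative sub that by blast
      note lin = linear_scale[OF has_derivative_linear[OF D]]
      show "((\<lambda>a. h (x + a *\<^sub>R u + b *\<^sub>R v)) has_derivative
         (\<lambda>t. t * ?D h (x + a *\<^sub>R u + b *\<^sub>R v) u)) (at a)"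
        by (rule has_derivative_eq_rhs[OF has_derivative_compose
              [where f = "\<lambda>a. x + a *\<^sub>R u + b *\<^sub>R v" and g = h, OF _ D]])
           (auto intro!: derivative_eq_intros simp: lin)
      show "((\<lambda>b. h (x + a *\<^sub>R u + b *\<^sub>R v)) has_derivative
         (\<lambda>t. t * ?D h (x + a *\<^sub>R u + b *\<^sub>R v) v)) (at b)"
        by (rule has_derivative_eq_rhs[OF has_derivative_compose
              [where f = "\<lambda>b. x + a *\<^sub>R u + b *\<^sub>R v" and g = h, OF _ D]])
           (auto intro!: derivative_eq_intros simp: lin)
    qed
    \<comment> \<open>The first mean value step moves along \<open>u\<close> and is applied to the
      difference of \<open>f\<close> across the parallelogram in the direction \<open>v\<close>; the
      second one then moves along \<open>v\<close>.\<close>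
    have "\<exists>\<xi>\<in>{0<..<s}. (f (x + s *\<^sub>R u + s *\<^sub>R v) - f (x + s *\<^sub>R u + 0 *\<^sub>R v)) -
        (f (x + 0 *\<^sub>R u + s *\<^sub>R v) - f (x + 0 *\<^sub>R u + 0 *\<^sub>R v)) =
        (s - 0) * ?D f (x + \<xi> *\<^sub>R u + s *\<^sub>R v) u - (s - 0) * ?D f (x + \<xi> *\<^sub>R u + 0 *\<^sub>R v) u"
      by (rule mvt_simple[OF s, of "\<lambda>a. f (x + a *\<^sub>R u + s *\<^sub>R v) - f (x + a *\<^sub>R u + 0 *\<^sub>R v)"])
         (use s assms(2) in \<open>auto intro!: has_derivative_diff[OF df df, THEN has_derivative_at_withinI]
           simp: left_diff_distrib right_diff_distrib simp del: scaleR_zero_left\<close>)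
    then obtain \<xi> where \<xi>: "0 < \<xi>" "\<xi> < s" "f (x + s *\<^sub>R u + s *\<^sub>R v) - f (x + s *\<^sub>R u) - (f (x + s *\<^sub>R v) - f x)
        = s * (?D f (x + \<xi> *\<^sub>R u + s *\<^sub>R v) u - ?D f (x + \<xi> *\<^sub>R u + 0 *\<^sub>R v) u)"
      by (auto simp: algebra_simps)
    have "\<exists>\<eta>\<in>{0<..<s}. ?D f (x + \<xi> *\<^sub>R u + s *\<^sub>R v) u - ?D f (x + \<xi> *\<^sub>R u + 0 *\<^sub>R v) u =
        (s - 0) * ?D (\<lambda>y. ?D f y u) (x + \<xi> *\<^sub>R u + \<eta> *\<^sub>R v) v"
      by (rule mvt_simple[OF s, of "\<lambda>b. ?D f (x + \<xi> *\<^sub>R u + b *\<^sub>R v) u"])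
         (use s \<xi> smooth_on_frechet_derivative[OF assms(2)] in
           \<open>auto intro!: dg[THEN has_derivative_at_withinI]\<close>)
    then obtain \<eta> where "0 < \<eta>" "\<eta> < s" "?D f (x + \<xi> *\<^sub>R u + s *\<^sub>R v) u - ?D f (x + \<xi> *\<^sub>R u + 0 *\<^sub>R v) u =
        s * ?D (\<lambda>y. ?D f y u) (x + \<xi> *\<^sub>R u + \<eta> *\<^sub>R v) v" by auto
    with \<xi> show ?thesis by (intro exI[of _ \<xi>] exI[of _ \<eta>]) simp
  qed
  have cont: "isCont (\<lambda>y. ?D (\<lambda>y. ?D f y u) y v) x" for u v
  proof -
    have "continuous_on S (\<lambda>y. ?D (\<lambda>y. ?D f y u) y v)"
      by (intro smooth_on_imp_continuous_on smooth_on_frechet_derivative assms)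
    then show ?thesis using assms(1,3) by (simp add: continuous_on_eq_continuous_at)
  qed
  show ?thesis
  proof (rule ccontr)
    assume neq: "\<not> ?thesis"
    \<comment> \<open>Half of the supposed gap: equal numbers cannot both lie strictly within
      \<open>e\<close> of values that are \<open>2 e\<close> apart.\<close>
    define e where "e = \<bar>?D (\<lambda>y. ?D f y u) x v - ?D (\<lambda>y. ?D f y v) x u\<bar> / 2"
    have e: "e > 0" using neq by (simp add: e_def)
    have "eventually (\<lambda>y. y \<in> S) (nhds x)" using assms eventually_nhds by blast
    moreover have "eventually (\<lambda>y. dist (?D (\<lambda>y. ?D f y u) y v) (?D (\<lambda>y. ?D f y u) x v) < e) (nhds x)" for u v
      by (rule tendstoD[OF iffD1[OF tendsto_at_iff_tendsto_nhds cont[of u v, unfolded isCont_def]] e])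
    ultimately have "eventually (\<lambda>y. y \<in> S \<and> dist (?D (\<lambda>y. ?D f y u) y v) (?D (\<lambda>y. ?D f y u) x v) < e \<and>
       dist (?D (\<lambda>y. ?D f y v) y u) (?D (\<lambda>y. ?D f y v) x u) < e) (nhds x)"
      by (intro eventually_conj) auto
    then obtain d where d: "d > 0" "\<And>y. dist y x < d \<Longrightarrow> y \<in> S \<and> 
       dist (?D (\<lambda>y. ?D f y u) y v) (?D (\<lambda>y. ?D f y u) x v) < e \<and>
       dist (?D (\<lambda>y. ?D f y v) y u) (?D (\<lambda>y. ?D f y v) x u) < e"
      unfolding eventually_nhds_metric by blast
    \<comment> \<open>Keeps the whole parallelogram within \<open>d / 2\<close> of \<open>x\<close>;
      the summand 1 excludes a zero denominator.\<close>
    define s where "s = d / (2 * (norm u + norm v + 1))"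
    have pos: "norm u + norm v + 1 > 0" by (smt (verit) norm_ge_zero)
    have s: "s > 0" using d(1) pos by (simp add: s_def)
    have near: "dist (x + a *\<^sub>R u + b *\<^sub>R v) x < d" "dist (x + b *\<^sub>R v + a *\<^sub>R u) x < d"
      if "0 \<le> a" "a \<le> s" "0 \<le> b" "b \<le> s" for a b
    proof -
      have eq: "x + b *\<^sub>R v + a *\<^sub>R u = x + a *\<^sub>R u + b *\<^sub>R v" by simp
      have "norm (a *\<^sub>R u + b *\<^sub>R v) \<le> norm (a *\<^sub>R u) + norm (b *\<^sub>R v)" by (rule norm_triangle_ineq)
      also have "\<dots> \<le> s * norm u + s * norm v" using that by (auto intro!: add_mono mult_right_mono)
      also have "\<dots> \<le> s * (norm u + norm v + 1)" using s by (simp add: algebra_simps)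
      also have "\<dots> = d / 2" using pos by (simp add: s_def del: distrib_left_numeral)
      also have "\<dots> < d" using d(1) by simp
      finally show "dist (x + a *\<^sub>R u + b *\<^sub>R v) x < d" by (simp add: dist_norm add.assoc)
      then show "dist (x + b *\<^sub>R v + a *\<^sub>R u) x < d" unfolding eq .
    qed
    obtain \<xi> \<eta> where 1: "0 < \<xi>" "\<xi> < s" "0 < \<eta>" "\<eta> < s"
      "f (x + s *\<^sub>R u + s *\<^sub>R v) - f (x + s *\<^sub>R u) - (f (x + s *\<^sub>R v) - f x)
        = s * (s * ?D (\<lambda>y. ?D f y u) (x + \<xi> *\<^sub>R u + \<eta> *\<^sub>R v) v)"
      using square[OF s, of u v] near d(2) by blast
    obtain \<xi>' \<eta>' where 2: "0 < \<xi>'" "\<xi>' < s" "0 < \<eta>'" "\<eta>' < s"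
      "f (x + s *\<^sub>R v + s *\<^sub>R u) - f (x + s *\<^sub>R v) - (f (x + s *\<^sub>R u) - f x)
        = s * (s * ?D (\<lambda>y. ?D f y v) (x + \<xi>' *\<^sub>R v + \<eta>' *\<^sub>R u) u)"
      using square[OF s, of v u] near d(2) by blast
    have "s * (s * ?D (\<lambda>y. ?D f y u) (x + \<xi> *\<^sub>R u + \<eta> *\<^sub>R v) v) =
          s * (s * ?D (\<lambda>y. ?D f y v) (x + \<xi>' *\<^sub>R v + \<eta>' *\<^sub>R u) u)"
      unfolding 1(5)[symmetric] 2(5)[symmetric] by (simp add: add_ac)
    then have "?D (\<lambda>y. ?D f y u) (x + \<xi> *\<^sub>R u + \<eta> *\<^sub>R v) v = ?D (\<lambda>y. ?D f y v) (x + \<xi>' *\<^sub>R v + \<eta>' *\<^sub>R u) u"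
      using s by simp
    moreover have "dist (?D (\<lambda>y. ?D f y u) (x + \<xi> *\<^sub>R u + \<eta> *\<^sub>R v) v) (?D (\<lambda>y. ?D f y u) x v) < e"
      using d(2) near 1 by (simp add: less_imp_le)
    moreover have "dist (?D (\<lambda>y. ?D f y v) (x + \<xi>' *\<^sub>R v + \<eta>' *\<^sub>R u) u) (?D (\<lambda>y. ?D f y v) x u) < e"
      using d(2) near 2 by (simp add: less_imp_le)
    moreover have "\<bar>a - b\<bar> < 2 * c" if "p = q" "dist p a < c" "dist q b < c" for p q a b c :: real
      using that unfolding dist_real_def by linarith
    ultimately have "\<bar>?D (\<lambda>y. ?D f y u) x v - ?D (\<lambda>y. ?D f y v) x u\<bar> < 2 * e" by blast
    then show False by (simp add: e_def)
  qed
qed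

lemma frechet_derivative_symmetric:
  fixes f :: "'a::euclidean_space \<Rightarrow> 'b::euclidean_space"
  assumes "open S" "smooth_on S f" "x \<in> S"
  shows "frechet_derivative (\<lambda>y. frechet_derivative f (at y) u) (at x) v =
         frechet_derivative (\<lambda>y. frechet_derivative f (at y) v) (at x) u"
proof (rule euclidean_eqI)
  fix b :: 'b assume "b \<in> Basis"
  let ?D = "\<lambda>f x. frechet_derivative f (at x)"
  have 1: "?D (\<lambda>y. ?D f y u) x v \<bullet> b = ?D (\<lambda>y. ?D (\<lambda>y. f y \<bullet> b) y u) x v" for u v
  proof -
    have dd: "(\<lambda>y. ?D f y u) differentiable at x"
      using assms smooth_on_frechet_derivative smooth_on_differentiable by blast
    have "?D (\<lambda>y. ?D f y u) x v \<bullet> b = ?D (\<lambda>y. ?D f y u \<bullet> b) x v"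
      by (rule frechet_derivative_inner[symmetric]) (rule dd)
    also have "?D (\<lambda>y. ?D f y u \<bullet> b) x = ?D (\<lambda>y. ?D (\<lambda>y. f y \<bullet> b) y u) x"
      by (rule frechet_derivative_transform_within_open[OF _ assms(1,3)])
         (use dd assms in \<open>auto simp: frechet_derivative_inner smooth_on_differentiable\<close>)
    finally show ?thesis .
  qed
  have "smooth_on S (\<lambda>y. f y \<bullet> b)"
    by (intro smooth_on_inner assms smooth_on_const)
  from frechet_derivative_symmetric_real[OF assms(1) this assms(3)]
  show "?D (\<lambda>y. ?D f y u) x v \<bullet> b = ?D (\<lambda>y. ?D f y v) x u \<bullet> b"
    unfolding 1 .
qed

section \<open>Ordinary differential equations\<close>

text \<open>Picard iteration. Clamping the time to \<open>[-e, e]\<close> lets the integral operator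
  act on bounded continuous functions on the whole line, a complete space to which Banach's fixed
  point theorem applies.\<close>

lemma ode_lipschitz_local_solution:
  fixes \<Psi> :: "'z::euclidean_space \<Rightarrow> 'z"
  assumes lip: "\<And>x y. norm (\<Psi> x - \<Psi> y) \<le> L * norm (x - y)"
  obtains e z where "e > 0" "z 0 = z0"
    "\<And>t. t \<in> {-e<..<e} \<Longrightarrow> (z has_vector_derivative \<Psi> (z t)) (at t)"
proof -
  define K where "K = \<bar>L\<bar> + 1"
  have K: "K > 0" "norm (\<Psi> x - \<Psi> y) \<le> K * norm (x - y)" for x y
    by (simp add: K_def, rule order_trans[OF lip mult_right_mono]) (auto simp: K_def)
  \<comment> \<open>The integrals up to \<open>s\<close> and up to 0 both start at
    \<open>-e\<close>, so their lengths add up to at most \<open>3 e\<close>, and the contraction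
    factor is \<open>3 e K = 1/2\<close>.\<close>
  define e where "e = 1 / (6 * K)"
  have e: "e > 0" using K by (simp add: e_def)
  have cont_\<Psi>: "continuous_on UNIV \<Psi>"
    by (rule lipschitz_on_continuous_on[of K]) (use K in \<open>auto simp: lipschitz_on_def dist_norm\<close>)
  \<comment> \<open>Starting at \<open>-e\<close> avoids oriented integrals for negative times;
    subtracting the value at 0 in \<open>h\<close> restores the initial condition.\<close>
  let ?I = "\<lambda>(y :: real \<Rightarrow>\<^sub>C 'z) t. integral {-e..t} (\<lambda>s. \<Psi> (y s))"
  define h where "h y t = z0 + ?I y t - ?I y 0" for y t
  have cont: "continuous_on S (\<lambda>s. \<Psi> (apply_bcontfun y s))" for y :: "real \<Rightarrow>\<^sub>C 'z" and S
    by (rule continuous_on_compose2[OF cont_\<Psi>]) auto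
  have "continuous_on (cbox (-e) e) (h y)" for y
    unfolding h_def cbox_interval
    by (intro continuous_intros indefinite_integral_continuous_1 integrable_continuous_real cont)
  then have "\<exists>g::real \<Rightarrow>\<^sub>C 'z. \<forall>x. apply_bcontfun g x = h y (clamp (-e) e x)" for y
    by (metis continuous_on_cbox_bcontfunE)
  then obtain T :: "(real \<Rightarrow>\<^sub>C 'z) \<Rightarrow> real \<Rightarrow>\<^sub>C 'z"
    where T: "\<And>y x. apply_bcontfun (T y) x = h y (clamp (-e) e x)" by metis
  have "dist (T y) (T w) \<le> 1/2 * dist y w" for y w
  proof (rule dist_bound)
    fix x
    define s where "s = clamp (-e) e x"
    have s: "s \<in> {-e..e}" using clamp_in_interval[of "-e" e x] e by (simp add: s_def)
    have I: "norm (?I y r - ?I w r) \<le> (K * dist y w) * (r - (-e))" if "r \<in> {-e..e}" for r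
    proof -
      have "norm (\<Psi> (y t) - \<Psi> (w t)) \<le> K * dist y w" for t
        using K(2)[of "y t" "w t"] dist_bounded[of y t w] K(1)
        by (smt (verit) dist_norm mult_left_mono)
      then have "norm (integral {-e..r} (\<lambda>s. \<Psi> (y s) - \<Psi> (w s))) \<le> (K * dist y w) * (r - (-e))"
        using that by (intro integral_bound continuous_on_diff cont) auto
      then show ?thesis
        by (subst (asm) integral_diff) (auto intro!: integrable_continuous_real cont)
    qed
    have "dist (T y x) (T w x) = norm ((?I y s - ?I w s) - (?I y 0 - ?I w 0))"
      by (simp add: T h_def dist_norm s_def algebra_simps)
    also have "\<dots> \<le> norm (?I y s - ?I w s) + norm (?I y 0 - ?I w 0)" by (rule norm_triangle_ineq4)
    also have "\<dots> \<le> (K * dist y w) * (s - (-e)) + (K * dist y w) * (0 - (-e))"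
      using I[OF s] I[of 0] e by (intro add_mono) auto
    also have "\<dots> = (K * dist y w) * (s + 2 * e)" by (simp add: algebra_simps)
    also have "\<dots> \<le> (K * dist y w) * (3 * e)"
      using s K by (intro mult_left_mono) auto
    also have "\<dots> = 1/2 * dist y w" using K by (simp add: e_def)
    finally show "dist (T y x) (T w x) \<le> 1/2 * dist y w" .
  qed
  then obtain y where y: "T y = y" using banach_fix_type[of "1/2" T] by auto
  have y_eq: "y t = h y t" if "t \<in> {-e..e}" for t
    using T[of y t] that clamp_cancel_cbox[of t "-e" e] by (simp add: y)
  show thesis
  proof (rule that[OF e])
    show "y 0 = z0" using y_eq[of 0] e by (simp add: h_def)
    fix t assume t: "t \<in> {-e<..<e}"
    have "(?I y has_vector_derivative \<Psi> (y t)) (at t within {-e..e})"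
      using t by (intro integral_has_vector_derivative cont) auto
    then have "(?I y has_vector_derivative \<Psi> (y t)) (at t)"
      using t by (simp add: at_within_Icc_at)
    then have "(h y has_vector_derivative \<Psi> (y t)) (at t)"
      unfolding h_def by (auto intro!: derivative_eq_intros)
    then show "(y has_vector_derivative \<Psi> (y t)) (at t)"
      by (rule has_vector_derivative_transform_within_open[OF _ _ t]) (auto simp: y_eq)
  qed
qed

text \<open>The operator norm of the derivative is at most the sum of the norms of the partial
  derivatives, which is continuous and hence bounded on the compact ball; the ball is
  convex.\<close>

lemma smooth_on_imp_locally_lipschitz:
  fixes \<Phi> :: "'z::euclidean_space \<Rightarrow> 'y::euclidean_space"
  assumes "open \<Omega>" "smooth_on \<Omega> \<Phi>" "cball z0 \<rho> \<subseteq> \<Omega>"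
  obtains M where "\<And>x y. x \<in> cball z0 \<rho> \<Longrightarrow> y \<in> cball z0 \<rho> \<Longrightarrow> norm (\<Phi> x - \<Phi> y) \<le> M * norm (x - y)"
proof -
  let ?D = "\<lambda>x. frechet_derivative \<Phi> (at x)"
  let ?N = "\<lambda>x. \<Sum>b\<in>Basis. norm (?D x b)"
  have "continuous_on (cball z0 \<rho>) ?N"
    using assms smooth_on_frechet_derivative
    by (intro continuous_intros smooth_on_imp_continuous_on) (blast intro: smooth_on_subset)
  then have "bounded (?N ` cball z0 \<rho>)"
    by (intro compact_imp_bounded compact_continuous_image) auto
  then obtain M where M: "\<And>x. x \<in> cball z0 \<rho> \<Longrightarrow> ?N x \<le> M"
    unfolding bounded_iff by (metis abs_le_D1 image_eqI real_norm_def)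
  show thesis
  proof (rule that, rule differentiable_bound[OF convex_cball])
    fix x assume x: "x \<in> cball z0 \<rho>"
    have D: "(\<Phi> has_derivative ?D x) (at x)" using assms x smooth_on_has_derivative by blast
    then show "(\<Phi> has_derivative ?D x) (at x within cball z0 \<rho>)" by (rule has_derivative_at_withinI)
    show "onorm (?D x) \<le> M"
    proof (rule onorm_le)
      fix v
      have "norm (?D x v) = norm (\<Sum>b\<in>Basis. (v \<bullet> b) *\<^sub>R ?D x b)"
        using linear_eq_basis_sum[OF has_derivative_linear[OF D], of v] by simp
      also have "\<dots> \<le> (\<Sum>b\<in>Basis. norm v * norm (?D x b))"
        by (rule sum_norm_le) (auto intro!: mult_right_mono Basis_le_norm)
      also have "\<dots> = ?N x * norm v" by (simp add: sum_distrib_left mult.commute[of _ "norm v"])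
      also have "\<dots> \<le> M * norm v" by (intro mult_right_mono M x) auto
      finally show "norm (?D x v) \<le> M * norm v" .
    qed
  qed
qed

text \<open>Bootstrapping: if \<open>z\<close> is of class \<open>k\<close>, then so is
  \<open>\<Phi> (z t)\<close>, which is its derivative.\<close>

lemma ode_solution_smooth:
  fixes z :: "real \<Rightarrow> 'z::euclidean_space"
  assumes "open I" "open \<Omega>" "smooth_on \<Omega> \<Phi>" "z ` I \<subseteq> \<Omega>"
    "\<And>t. t \<in> I \<Longrightarrow> (z has_vector_derivative \<Phi> (z t)) (at t)"
  shows "smooth_on I z"
  unfolding smooth_on_def
proof
  fix k show "C_k_on k z I"
  proof (induction k)
    case 0
    have "continuous (at t) z" if "t \<in> I" for t
      using assms(5)[OF that] has_vector_derivative_continuous by blast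
    then show ?case by (simp add: continuous_at_imp_continuous_on)
  next
    case (Suc k)
    have "C_k_on k (\<lambda>t. v *\<^sub>R \<Phi> (z t)) I" for v :: real
      by (intro C_k_on_bilinear[OF bounded_bilinear_scaleR] C_k_on_const smooth_on_imp_C_k
            C_k_on_compose[OF assms(1,2,4) _ Suc.IH] assms(1,3))
    then show ?case
      using assms(5) by (intro C_k_on_SucI[OF assms(1), of z "\<lambda>t v. v *\<^sub>R \<Phi> (z t)"])
        (simp_all add: has_vector_derivative_def)
  qed
qed

text \<open>Composing \<open>\<Phi>\<close> with the nearest-point map onto a ball gives a globally
  Lipschitz field. Its solution stays in the ball for a short time, and there the nearest-point map
  is the identity.\<close>

lemma ode_smooth_local_solution:
  fixes \<Phi> :: "'z::euclidean_space \<Rightarrow> 'z"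
  assumes "open \<Omega>" "smooth_on \<Omega> \<Phi>" "z0 \<in> \<Omega>"
  obtains e z where "e > 0" "z 0 = z0" "z ` {-e<..<e} \<subseteq> \<Omega>"
    "\<And>t. t \<in> {-e<..<e} \<Longrightarrow> (z has_vector_derivative \<Phi> (z t)) (at t)" "smooth_on {-e<..<e} z"
proof -
  obtain \<rho> where \<rho>: "\<rho> > 0" "cball z0 \<rho> \<subseteq> \<Omega>" using assms open_contains_cball by blast
  obtain M where M: "\<And>x y. x \<in> cball z0 \<rho> \<Longrightarrow> y \<in> cball z0 \<rho> \<Longrightarrow> norm (\<Phi> x - \<Phi> y) \<le> M * norm (x - y)"
    using smooth_on_imp_locally_lipschitz[OF assms(1,2) \<rho>(2)] by blast
  let ?p = "closest_point (cball z0 \<rho>)"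
  have p: "?p x \<in> cball z0 \<rho>" for x using \<rho>(1) by (intro closest_point_in_set) auto
  have M0: "M \<ge> 0"
  proof -
    obtain b :: 'z where "b \<in> Basis" using nonempty_Basis by blast
    then have "0 \<le> M * norm (z0 - (z0 + \<rho> *\<^sub>R b))" "norm (z0 - (z0 + \<rho> *\<^sub>R b)) = \<rho>"
      using M[of z0 "z0 + \<rho> *\<^sub>R b"] \<rho>(1)
      by (auto simp: dist_norm intro: order_trans[OF norm_ge_zero])
    then show ?thesis using \<rho>(1) by (simp add: zero_le_mult_iff)
  qed
  have "norm (\<Phi> (?p x) - \<Phi> (?p y)) \<le> M * norm (x - y)" for x y
  proof -
    have "norm (\<Phi> (?p x) - \<Phi> (?p y)) \<le> M * dist (?p x) (?p y)" unfolding dist_norm by (rule M[OF p p])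
    also have "\<dots> \<le> M * dist x y"
      using M0 \<rho>(1) by (intro mult_left_mono closest_point_lipschitz) auto
    finally show ?thesis by (simp add: dist_norm)
  qed
  then obtain a z where a: "a > 0" "z 0 = z0"
    "\<And>t. t \<in> {-a<..<a} \<Longrightarrow> (z has_vector_derivative \<Phi> (?p (z t))) (at t)"
    using ode_lipschitz_local_solution[of "\<lambda>x. \<Phi> (?p x)" M z0] by metis
  have "isCont z 0" using a(3)[of 0] a(1) has_vector_derivative_continuous by auto
  then obtain d where d: "d > 0" "\<And>t. dist t 0 < d \<Longrightarrow> dist (z t) (z 0) < \<rho>"
    unfolding continuous_at_eps_delta using \<rho>(1) by (metis dist_commute)
  define e where "e = min a d"
  have zin: "z t \<in> cball z0 \<rho>" if "t \<in> {-e<..<e}" for t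
    using d(2)[of t] that a(2) by (auto simp: e_def dist_commute less_imp_le)
  have deriv: "(z has_vector_derivative \<Phi> (z t)) (at t)" if "t \<in> {-e<..<e}" for t
    using a(3)[of t] that closest_point_self[OF zin[OF that]] by (auto simp: e_def)
  have sub: "z ` {-e<..<e} \<subseteq> \<Omega>" using zin \<rho>(2) by blast
  show thesis
    by (rule that[of e z])
       (use a d sub deriv ode_solution_smooth[OF _ assms(1,2) sub deriv] in \<open>auto simp: e_def\<close>)
qed

section \<open>Smooth solutions of linear systems\<close>

lemma bilinear_basis_sum_right:
  fixes G :: "'a::real_vector \<Rightarrow> 'e::euclidean_space \<Rightarrow> real"
  assumes "bilinear G" shows "G u w = (\<Sum>i\<in>Basis. (w \<bullet> i) * G u i)"
  using linear_eq_basis_sum[of "G u" w] assms by (simp add: bilinear_def)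

lemma bilinear_basis_sum_left:
  fixes G :: "'e::euclidean_space \<Rightarrow> 'a::real_vector \<Rightarrow> real"
  assumes "bilinear G" shows "G w u = (\<Sum>i\<in>Basis. (w \<bullet> i) * G i u)"
  using linear_eq_basis_sum[of "\<lambda>w. G w u" w] assms by (simp add: bilinear_def)

text \<open>The map \<open>J\<close> that represents \<open>G\<close> by the standard inner product
  is injective by positivity, hence surjective by dimension.\<close>

lemma positive_definite_riesz:
  fixes G :: "'e::euclidean_space \<Rightarrow> 'e \<Rightarrow> real"
  assumes G: "bilinear G" "\<And>u. u \<noteq> 0 \<Longrightarrow> G u u > 0" and "linear \<beta>"
  shows "\<exists>z. \<forall>w. G z w = \<beta> w"
proof -
  define J where "J z = (\<Sum>i\<in>Basis. G z i *\<^sub>R i)" for z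
  have dot: "(\<Sum>i\<in>Basis. h i *\<^sub>R i) \<bullet> w = (\<Sum>i\<in>Basis. (w \<bullet> i) * h i)" for h and w :: 'e
    by (simp add: inner_sum_left inner_commute[of w] mult.commute)
  have J_dot: "J z \<bullet> w = G z w" for z w
    unfolding J_def dot by (rule bilinear_basis_sum_right[OF G(1), symmetric])
  have lin: "linear J"
    unfolding J_def by (rule linearI)
      (simp_all add: bilinear_ladd[OF G(1)] bilinear_lmul[OF G(1)] scaleR_add_left sum.distrib scaleR_sum_right)
  have "inj J"
    unfolding linear_injective_0[OF lin]
    by (metis G(2) J_dot inner_zero_left less_irrefl)
  then have "surj J" using lin linear_injective_imp_surjective by blast
  then obtain z where "J z = (\<Sum>i\<in>Basis. \<beta> i *\<^sub>R i)" by (metis surjD)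
  then have "G z w = \<beta> w" for w
    unfolding J_dot[symmetric] using linear_eq_basis_sum[OF assms(3), of w] by (simp add: dot)
  then show ?thesis by blast
qed

text \<open>\<open>f\<close> is of order \<open>norm (y - x)\<close> and \<open>g\<close> tends to
  0, so the product is of smaller order. Mere continuity of \<open>g\<close> matters for the
  application, where \<open>g\<close> is a component of a solution not yet known to be
  differentiable.\<close>

lemma has_derivative_zero_times_zero:
  fixes f g :: "'a::real_normed_vector \<Rightarrow> real"
  assumes f: "(f has_derivative f') (at x)" "f x = 0" and g: "isCont g x" "g x = 0"
  shows "((\<lambda>y. g y * f y) has_derivative (\<lambda>_. 0)) (at x)"
  unfolding has_derivative_at_alt
proof (intro conjI allI impI)
  fix e :: real assume e: "e > 0"
  have "bounded_linear f'" using f(1) by (rule has_derivative_bounded_linear)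
  then obtain K where K: "K > 0" "\<And>v. norm (f' v) \<le> norm v * K" using bounded_linear.pos_bounded by blast
  obtain d1 where d1: "d1 > 0" "\<And>y. norm (y - x) < d1 \<Longrightarrow> norm (f y - f x - f' (y - x)) \<le> 1 * norm (y - x)"
    using f(1) unfolding has_derivative_at_alt by (meson zero_less_one)
  have "e / (K + 1) > 0" using e K by simp
  then obtain d2 where d2: "d2 > 0" "\<And>y. dist y x < d2 \<Longrightarrow> dist (g y) (g x) < e / (K + 1)"
    using g(1) unfolding continuous_at_eps_delta by metis
  show "\<exists>d>0. \<forall>y. norm (y - x) < d \<longrightarrow> norm (g y * f y - g x * f x - 0) \<le> e * norm (y - x)"
  proof (intro exI[of _ "min d1 d2"] conjI allI impI)
    fix y assume y: "norm (y - x) < min d1 d2"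
    have "\<bar>f y\<bar> \<le> (K + 1) * norm (y - x)"
      using d1(2)[of y] K(2)[of "y - x"] y f(2) by (simp add: algebra_simps)
    moreover have "\<bar>g y\<bar> \<le> e / (K + 1)" using d2(2)[of y] y g(2) by (simp add: dist_norm)
    ultimately have "\<bar>g y\<bar> * \<bar>f y\<bar> \<le> e / (K + 1) * ((K + 1) * norm (y - x))"
      using e K by (intro mult_mono) auto
    then show "norm (g y * f y - g x * f x - 0) \<le> e * norm (y - x)"
      using K f(2) by (simp add: abs_mult)
  qed (use d1 d2 in auto)
qed (rule bounded_linear_zero)

text \<open>Positivity is left to an extension, because the horizontal part of a metric, degenerate
  along the fibers, must be an instance as well.\<close>

locale form_field =
  fixes S :: "'a::euclidean_space set" and G :: "'a \<Rightarrow> 'e::euclidean_space \<Rightarrow> 'e \<Rightarrow> real"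
  assumes open_S: "open S"
    and bil: "\<And>x. x \<in> S \<Longrightarrow> bilinear (G x)"
    and sm: "\<And>u v. smooth_on S (\<lambda>x. G x u v)"
begin

lemma form_expand: "x \<in> S \<Longrightarrow> G x u v = (\<Sum>i\<in>Basis. (u \<bullet> i) * (\<Sum>j\<in>Basis. (v \<bullet> j) * G x i j))"
  by (subst bilinear_basis_sum_left[OF bil], assumption) (simp only: bilinear_basis_sum_right[OF bil, of x _ v])

definition dform :: "'a \<Rightarrow> 'a \<Rightarrow> 'e \<Rightarrow> 'e \<Rightarrow> real" where
  "dform x h u v = frechet_derivative (\<lambda>y. G y u v) (at x) h"

lemma has_derivative_form:
  "x \<in> S \<Longrightarrow> ((\<lambda>y. G y u v) has_derivative (\<lambda>h. dform x h u v)) (at x)"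
  unfolding dform_def by (rule smooth_on_has_derivative[OF sm])

lemma dform_linear: "x \<in> S \<Longrightarrow> linear (\<lambda>h. dform x h u v)"
  by (rule has_derivative_linear[OF has_derivative_form])

lemma dform_eqI:
  assumes "x \<in> S" "((\<lambda>y. G y u v) has_derivative D) (at x)"
  shows "dform x h u v = D h"
  using frechet_derivative_at[OF assms(2)] by (simp add: dform_def)

lemma dform_bilinear:
  assumes x: "x \<in> S" shows "bilinear (dform x h)"
proof -
  have "dform x h (u + u') v = dform x h u v + dform x h u' v"
    and "dform x h u (v + v') = dform x h u v + dform x h u v'" for u u' v v'
    by (rule dform_eqI[OF x has_derivative_transform_within_open[OF has_derivative_add
          [OF has_derivative_form[OF x] has_derivative_form[OF x]] open_S x]],
        simp add: bilinear_ladd[OF bil] bilinear_radd[OF bil])+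
  moreover have "dform x h (k *\<^sub>R u) v = k * dform x h u v"
    and "dform x h u (k *\<^sub>R v) = k * dform x h u v" for k u v
    by (rule dform_eqI[OF x has_derivative_transform_within_open[OF has_derivative_mult_right
          [OF has_derivative_form[OF x]] open_S x]],
        simp add: bilinear_lmul[OF bil] bilinear_rmul[OF bil])+
  ultimately show ?thesis by (auto simp: bilinear_def intro!: linearI)
qed

text \<open>The basis expansion turns the form into sums of products of real functions, which
  separates the motion of the base point from that of the two arguments.\<close>

lemma has_derivative_form_along:
  fixes x :: "'t::real_normed_vector \<Rightarrow> 'a"
  assumes xt: "x t \<in> S" and x: "(x has_derivative x') (at t)"
    and u: "(u has_derivative u') (at t)" and v: "(v has_derivative v') (at t)"
  shows "((\<lambda>s. G (x s) (u s) (v s)) has_derivative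
      (\<lambda>h. dform (x t) (x' h) (u t) (v t) + G (x t) (u' h) (v t) + G (x t) (u t) (v' h))) (at t)"
proof -
  have d_expand: "dform (x t) h u v = (\<Sum>i\<in>Basis. (u \<bullet> i) * (\<Sum>j\<in>Basis. (v \<bullet> j) * dform (x t) h i j))" for h u v
    by (subst bilinear_basis_sum_left[OF dform_bilinear[OF xt]])
       (simp only: bilinear_basis_sum_right[OF dform_bilinear[OF xt], of _ _ v])
  have Gij: "((\<lambda>s. G (x s) i j) has_derivative (\<lambda>h. dform (x t) (x' h) i j)) (at t)" for i j
    by (rule has_derivative_compose[OF x has_derivative_form[OF xt]])
  have "((\<lambda>s. \<Sum>i\<in>Basis. (u s \<bullet> i) * (\<Sum>j\<in>Basis. (v s \<bullet> j) * G (x s) i j)) has_derivative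
     (\<lambda>h. \<Sum>i\<in>Basis. (u t \<bullet> i) * (\<Sum>j\<in>Basis. (v t \<bullet> j) * dform (x t) (x' h) i j + (v' h \<bullet> j) * G (x t) i j)
         + (u' h \<bullet> i) * (\<Sum>j\<in>Basis. (v t \<bullet> j) * G (x t) i j))) (at t)"
    by (intro has_derivative_sum has_derivative_mult has_derivative_inner_left u v Gij)
  then have D: "((\<lambda>s. \<Sum>i\<in>Basis. (u s \<bullet> i) * (\<Sum>j\<in>Basis. (v s \<bullet> j) * G (x s) i j)) has_derivative
      (\<lambda>h. dform (x t) (x' h) (u t) (v t) + G (x t) (u' h) (v t) + G (x t) (u t) (v' h))) (at t)"
  proof (rule has_derivative_eq_rhs, intro ext)
    fix h
    show "(\<Sum>i\<in>Basis. (u t \<bullet> i) * (\<Sum>j\<in>Basis. (v t \<bullet> j) * dform (x t) (x' h) i j + (v' h \<bullet> j) * G (x t) i j)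
         + (u' h \<bullet> i) * (\<Sum>j\<in>Basis. (v t \<bullet> j) * G (x t) i j))
      = dform (x t) (x' h) (u t) (v t) + G (x t) (u' h) (v t) + G (x t) (u t) (v' h)"
      unfolding d_expand[of "x' h" "u t" "v t"] form_expand[OF xt, of "u' h" "v t"]
        form_expand[OF xt, of "u t" "v' h"]
      by (simp add: sum.distrib distrib_left)
  qed
  \<comment> \<open>The expansion holds only over \<open>S\<close>; it is undone on a neighbourhood
    of \<open>t\<close> that \<open>x\<close> maps into \<open>S\<close>.\<close>
  have "\<forall>V. open V \<and> x t \<in> V \<longrightarrow> (\<exists>T. open T \<and> t \<in> T \<and> (\<forall>s\<in>T. x s \<in> V))"
    using has_derivative_continuous[OF x] unfolding continuous_at_open .
  then obtain T where T: "open T" "t \<in> T" "\<And>s. s \<in> T \<Longrightarrow> x s \<in> S"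
    using open_S xt by metis
  show ?thesis
    by (rule has_derivative_transform_within_open[OF D T(1,2)]) (simp only: form_expand[OF T(3), symmetric])
qed

end

locale metric_field = form_field S G for S :: "'a::euclidean_space set" and
    G :: "'a \<Rightarrow> 'e::euclidean_space \<Rightarrow> 'e \<Rightarrow> real" +
  assumes pos: "\<And>x u. x \<in> S \<Longrightarrow> u \<noteq> 0 \<Longrightarrow> G x u u > 0"
begin

text \<open>The quadratic form attains its minimum on the compact product of a ball and the unit
  sphere, where it is positive; homogeneity extends the bound to all vectors.\<close>

lemma coercive:
  assumes "x \<in> S"
  obtains \<rho> c where "\<rho> > 0" "c > 0" "ball x \<rho> \<subseteq> S" "\<And>y w. y \<in> ball x \<rho> \<Longrightarrow> c * (norm w)\<^sup>2 \<le> G y w w"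
proof -
  obtain \<rho> where \<rho>: "\<rho> > 0" "cball x \<rho> \<subseteq> S" using assms open_S open_contains_cball by blast
  let ?K = "cball x \<rho> \<times> sphere (0::'e) 1"
  define q where "q p = (\<Sum>i\<in>Basis. (snd p \<bullet> i) * (\<Sum>j\<in>Basis. (snd p \<bullet> j) * G (fst p) i j))" for p
  have "continuous_on (cball x \<rho>) (\<lambda>y. G y i j)" for i j
    using smooth_on_imp_continuous_on[OF sm] \<rho>(2) continuous_on_subset by blast
  then have contG: "continuous_on ?K (\<lambda>p. G (fst p) i j)" for i j
    by (rule continuous_on_compose2) (auto intro: continuous_intros)
  have "continuous_on ?K q"
    unfolding q_def by (intro continuous_intros contG)
  moreover have "compact ?K" by (intro compact_Times compact_cball compact_sphere)
  moreover have "?K \<noteq> {}"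
  proof -
    obtain b :: 'e where "b \<in> Basis" using nonempty_Basis by blast
    then have "(x, b) \<in> ?K" using \<rho> by auto
    then show ?thesis by blast
  qed
  ultimately obtain m where m: "m \<in> ?K" "\<And>p. p \<in> ?K \<Longrightarrow> q m \<le> q p"
    using continuous_attains_inf[of ?K q] by blast
  obtain y0 w0 where m_eq: "m = (y0, w0)" by force
  have q: "q (y, w) = G y w w" if "y \<in> cball x \<rho>" for y w
    using form_expand[of y w w] that \<rho>(2) unfolding q_def by auto
  define c where "c = G y0 w0 w0"
  have c: "c > 0" using m(1) \<rho>(2) pos[of y0 w0] unfolding c_def m_eq by fastforce
  have main: "c * (norm w)\<^sup>2 \<le> G y w w" if y: "y \<in> ball x \<rho>" for y w
  proof (cases "w = 0")
    case True
    then show ?thesis using y \<rho>(2) bilinear_lzero[OF bil] by (simp add: subset_iff)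
  next
    case False
    have yS: "y \<in> S" "y \<in> cball x \<rho>" using y \<rho>(2) by auto
    have "c \<le> G y (w /\<^sub>R norm w) (w /\<^sub>R norm w)"
      using m(2)[of "(y, w /\<^sub>R norm w)"] m(1) False yS q unfolding c_def m_eq by auto
    also have "\<dots> = G y w w / (norm w)\<^sup>2"
      by (simp add: bilinear_lmul[OF bil] bilinear_rmul[OF bil] yS power2_eq_square field_simps)
    finally show ?thesis using False by (simp add: field_simps)
  qed
  show thesis by (rule that[OF \<rho>(1) c _ main]) (use \<rho>(2) in auto)
qed

lemma solution_isCont:
  assumes "x \<in> S" and b: "\<And>w. continuous_on S (\<lambda>y. b y w)"
    and eq: "\<And>y w. y \<in> S \<Longrightarrow> G y (z y) w = b y w"
  shows "isCont z x"
proof -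
  obtain \<rho> c where c: "\<rho> > 0" "c > 0" "ball x \<rho> \<subseteq> S" "\<And>y w. y \<in> ball x \<rho> \<Longrightarrow> c * (norm w)\<^sup>2 \<le> G y w w"
    using coercive[OF assms(1)] by blast
  let ?r = "\<lambda>y. \<Sum>i\<in>Basis. \<bar>b y i - G y (z x) i\<bar>"
  have bound: "norm (z y - z x) \<le> ?r y / c" if y: "y \<in> ball x \<rho>" for y
  proof (cases "z y = z x")
    case False
    let ?w = "z y - z x"
    have yS: "y \<in> S" using y c by auto
    have "c * (norm ?w)\<^sup>2 \<le> G y ?w ?w" by (rule c(4)[OF y])
    also have "\<dots> = (\<Sum>i\<in>Basis. (?w \<bullet> i) * (b y i - G y (z x) i))"
      by (subst bilinear_basis_sum_right[OF bil[OF yS]])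
         (simp add: bilinear_lsub[OF bil[OF yS]] eq[OF yS])
    also have "\<dots> \<le> (\<Sum>i\<in>Basis. norm ?w * \<bar>b y i - G y (z x) i\<bar>)"
    proof (rule sum_mono)
      fix i :: 'e assume i: "i \<in> Basis"
      have "(?w \<bullet> i) * (b y i - G y (z x) i) \<le> \<bar>?w \<bullet> i\<bar> * \<bar>b y i - G y (z x) i\<bar>"
        by (metis abs_ge_self abs_mult)
      also have "\<dots> \<le> norm ?w * \<bar>b y i - G y (z x) i\<bar>"
        by (intro mult_right_mono Basis_le_norm i) auto
      finally show "(?w \<bullet> i) * (b y i - G y (z x) i) \<le> norm ?w * \<bar>b y i - G y (z x) i\<bar>" .
    qed
    finally have "norm ?w * (c * norm ?w) \<le> norm ?w * ?r y"
      by (simp add: sum_distrib_left power2_eq_square mult_ac)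
    then have "c * norm ?w \<le> ?r y" using False by simp
    then show ?thesis using c(2) by (simp add: field_simps)
  qed (use c(2) in \<open>auto intro!: divide_nonneg_pos sum_nonneg\<close>)
  have "isCont (\<lambda>y. b y w) x" "isCont (\<lambda>y. G y u w) x" for u w
    using b smooth_on_imp_continuous_on[OF sm] open_S assms(1) by (simp_all add: continuous_on_eq_continuous_at)
  then have "isCont (\<lambda>y. ?r y / c) x" using c(2) by (intro continuous_intros) auto
  then have "((\<lambda>y. ?r y / c) \<longlongrightarrow> ?r x / c) (at x)" by (simp add: isCont_def)
  then have lim: "((\<lambda>y. ?r y / c) \<longlongrightarrow> 0) (at x)" using eq[OF assms(1)] by simp
  have "eventually (\<lambda>y. y \<in> ball x \<rho>) (at x)"
    using c(1) by (intro eventually_at_in_open') auto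
  then have "((\<lambda>y. z y - z x) \<longlongrightarrow> 0) (at x)"
    by (intro Lim_null_comparison[OF _ lim]) (auto elim!: eventually_mono intro: bound)
  then show ?thesis by (simp add: isCont_def LIM_zero_iff)
qed

lemma solution_has_derivative:
  assumes x: "x \<in> S" and b: "\<And>w y. y \<in> S \<Longrightarrow> (\<lambda>y. b y w) differentiable (at y)"
    and eq: "\<And>y w. y \<in> S \<Longrightarrow> G y (z y) w = b y w"
  obtains \<zeta> where "(z has_derivative \<zeta>) (at x)"
    "\<And>v w. G x (\<zeta> v) w = frechet_derivative (\<lambda>y. b y w) (at x) v
              - frechet_derivative (\<lambda>y. G y (z x) w) (at x) v"
proof -
  have cont: "isCont z x"
    by (rule solution_isCont[OF x _ eq])
       (use b in \<open>auto intro!: differentiable_imp_continuous_on simp: differentiable_on_def differentiable_at_withinI\<close>)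
  have Gd: "(\<lambda>y. G y u w) differentiable (at x)" for u w
    using smooth_on_differentiable[OF sm x] .
  let ?b' = "\<lambda>v w. frechet_derivative (\<lambda>y. b y w) (at x) v - frechet_derivative (\<lambda>y. G y (z x) w) (at x) v"
  define a where "a y w = b y w - G y (z x) w" for y w
  have a_deriv: "((\<lambda>y. a y w) has_derivative (\<lambda>v. ?b' v w)) (at x)" for w
    unfolding a_def using b[OF x] Gd
    by (intro has_derivative_diff) (simp_all add: frechet_derivative_works[symmetric])
  have prod_deriv: "((\<lambda>y. ((z y - z x) \<bullet> j) * (G y j i - G x j i)) has_derivative (\<lambda>_. 0)) (at x)" for i j
  proof (rule has_derivative_zero_times_zero)
    show "((\<lambda>y. G y j i - G x j i) has_derivative (\<lambda>v. frechet_derivative (\<lambda>y. G y j i) (at x) v - 0)) (at x)"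
      by (intro has_derivative_diff has_derivative_const) (simp add: Gd frechet_derivative_works[symmetric])
    show "isCont (\<lambda>y. (z y - z x) \<bullet> j) x" by (intro continuous_intros cont)
  qed auto
  have key: "G x (z y - z x) i = a y i - (\<Sum>j\<in>Basis. ((z y - z x) \<bullet> j) * (G y j i - G x j i))"
    if y: "y \<in> S" for y i
  proof -
    have "(\<Sum>j\<in>Basis. ((z y - z x) \<bullet> j) * (G y j i - G x j i)) = G y (z y - z x) i - G x (z y - z x) i"
      unfolding bilinear_basis_sum_left[OF bil[OF x], of "z y - z x"]
        bilinear_basis_sum_left[OF bil[OF y], of "z y - z x"]
      by (simp only: right_diff_distrib sum_subtractf)
    moreover have "G y (z y - z x) i = a y i"
      by (simp add: a_def bilinear_lsub[OF bil[OF y]] eq[OF y])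
    ultimately show ?thesis by simp
  qed
  \<comment> \<open>The \<open>E i\<close> represent the coordinate functionals with respect to
    \<open>G x\<close>; linear combinations of them invert \<open>G x\<close>.\<close>
  have "\<exists>e. \<forall>w. G x e w = w \<bullet> i" for i
    using bil[OF x] pos[OF x] by (intro positive_definite_riesz) (auto intro: bounded_linear.linear bounded_linear_inner_left)
  then obtain E where E: "\<And>i w. G x (E i) w = w \<bullet> i" by metis
  have eqI: "p = q" if "\<And>w. w \<in> Basis \<Longrightarrow> G x p w = G x q w" for p q
  proof -
    have "G x p w = G x q w" for w
      by (subst (1 2) bilinear_basis_sum_right[OF bil[OF x]]) (simp add: that)
    then have "G x (p - q) (p - q) = 0" by (simp add: bilinear_lsub[OF bil[OF x]])
    then show ?thesis using pos[OF x, of "p - q"] by fastforce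
  qed
  have G_sum: "G x (\<Sum>i\<in>Basis. h i *\<^sub>R E i) w = (\<Sum>i\<in>Basis. h i * (w \<bullet> i))" for h w
  proof -
    have lin: "linear (\<lambda>u. G x u w)" using bil[OF x] by (simp add: bilinear_def)
    show ?thesis by (simp add: linear_sum[OF lin] linear_scale[OF lin] E)
  qed
  have G_sum_basis: "G x (\<Sum>i\<in>Basis. h i *\<^sub>R E i) i = h i" if "i \<in> Basis" for h i
    using that by (simp add: G_sum inner_Basis if_distrib cong: if_cong)
  define \<zeta> where "\<zeta> v = (\<Sum>i\<in>Basis. ?b' v i *\<^sub>R E i)" for v
  have "((\<lambda>y. a y i - (\<Sum>j\<in>Basis. ((z y - z x) \<bullet> j) * (G y j i - G x j i))) has_derivative
      (\<lambda>v. ?b' v i - (\<Sum>j\<in>(Basis::'e set). 0))) (at x)" for i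
    by (intro has_derivative_diff has_derivative_sum prod_deriv a_deriv)
  then have "((\<lambda>y. z x + (\<Sum>i\<in>Basis. (a y i - (\<Sum>j\<in>Basis. ((z y - z x) \<bullet> j) * (G y j i - G x j i))) *\<^sub>R E i))
      has_derivative (\<lambda>v. 0 + (\<Sum>i\<in>Basis. (?b' v i - (\<Sum>j\<in>(Basis::'e set). 0)) *\<^sub>R E i))) (at x)"
    by (intro has_derivative_add has_derivative_const has_derivative_sum has_derivative_scaleR_left)
  then have deriv: "(z has_derivative \<zeta>) (at x)"
  proof (rule has_derivative_transform_within_open[OF has_derivative_eq_rhs _ x])
    fix y assume y: "y \<in> S"
    have "(\<Sum>i\<in>Basis. (a y i - (\<Sum>j\<in>Basis. ((z y - z x) \<bullet> j) * (G y j i - G x j i))) *\<^sub>R E i) = z y - z x"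
      by (rule eqI) (simp add: G_sum_basis key[OF y])
    then show "z x + (\<Sum>i\<in>Basis. (a y i - (\<Sum>j\<in>Basis. ((z y - z x) \<bullet> j) * (G y j i - G x j i))) *\<^sub>R E i) = z y"
      by simp
  qed (auto simp: \<zeta>_def open_S)
  \<comment> \<open>\<open>\<zeta>\<close> is assembled from basis values of \<open>w\<close> only;
    linearity of the right-hand side in \<open>w\<close> extends the formula to every
    \<open>w\<close>.\<close>
  have b'_lin: "linear (?b' v)" for v
  proof -
    have a_lin: "a y (p + q) = a y p + a y q" "a y (k *\<^sub>R p) = k * a y p" if "y \<in> S" for y p q k
      using that by (simp_all add: a_def eq[symmetric] bilinear_radd[OF bil] bilinear_rmul[OF bil] algebra_simps)
    show ?thesis
    proof (rule linearI)
      fix p q k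
      have "((\<lambda>y. a y p + a y q) has_derivative (\<lambda>v. ?b' v p + ?b' v q)) (at x)"
        by (intro has_derivative_add a_deriv)
      then have "((\<lambda>y. a y (p + q)) has_derivative (\<lambda>v. ?b' v p + ?b' v q)) (at x)"
        by (rule has_derivative_transform_within_open[OF _ open_S x]) (simp add: a_lin)
      from has_derivative_unique[OF this a_deriv] show "?b' v (p + q) = ?b' v p + ?b' v q"
        by (simp add: fun_eq_iff)
      have "((\<lambda>y. k * a y p) has_derivative (\<lambda>v. k * ?b' v p)) (at x)"
        by (intro has_derivative_mult_right a_deriv)
      then have "((\<lambda>y. a y (k *\<^sub>R p)) has_derivative (\<lambda>v. k * ?b' v p)) (at x)"
        by (rule has_derivative_transform_within_open[OF _ open_S x]) (simp add: a_lin)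
      from has_derivative_unique[OF this a_deriv] show "?b' v (k *\<^sub>R p) = k *\<^sub>R ?b' v p"
        by (simp add: fun_eq_iff)
    qed
  qed
  have "G x (\<zeta> v) w = ?b' v w" for v w
    unfolding \<zeta>_def G_sum using linear_eq_basis_sum[OF b'_lin[of v], of w] by (simp add: mult.commute)
  with deriv show thesis using that by blast
qed

text \<open>Directional derivatives of \<open>z\<close> solve the same system with another
  right-hand side. If \<open>b\<close> is of class \<open>Suc k\<close> and \<open>z\<close> is
  already of class \<open>k\<close>, this new right-hand side is of class \<open>k\<close>; hence
  the induction runs over all right-hand sides at once.\<close>

lemma solution_smooth:
  assumes b: "\<And>w. smooth_on S (\<lambda>y. b y w)"
    and eq: "\<And>y w. y \<in> S \<Longrightarrow> G y (z y) w = b y w"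
  shows "smooth_on S z"
proof -
  have "C_k_on k z S" if "\<And>w. C_k_on k (\<lambda>y. b y w) S" "\<And>y w. y \<in> S \<Longrightarrow> G y (z y) w = b y w" for k b z
    using that
  proof (induction k arbitrary: b z)
    case 0
    have "isCont z x" if "x \<in> S" for x
      by (rule solution_isCont[OF that _ 0(2)]) (use 0(1) in auto)
    then show ?case by (simp add: continuous_at_imp_continuous_on)
  next
    case (Suc k)
    have "\<exists>\<zeta>. (z has_derivative \<zeta>) (at x) \<and> (\<forall>v w. G x (\<zeta> v) w = frechet_derivative (\<lambda>y. b y w) (at x) v
              - frechet_derivative (\<lambda>y. G y (z x) w) (at x) v)" if x: "x \<in> S" for x
      by (rule solution_has_derivative[OF x _ Suc.prems(2)]) (use Suc.prems(1) in auto)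
    then obtain \<zeta> where \<zeta>: "\<And>x. x \<in> S \<Longrightarrow> (z has_derivative \<zeta> x) (at x)"
      "\<And>x v w. x \<in> S \<Longrightarrow> G x (\<zeta> x v) w = frechet_derivative (\<lambda>y. b y w) (at x) v
              - frechet_derivative (\<lambda>y. G y (z x) w) (at x) v" by metis
    have zk: "C_k_on k z S"
      by (rule Suc.IH[OF C_k_on_SucD[OF Suc.prems(1)] Suc.prems(2)])
    \<comment> \<open>Applied with \<open>u = z x\<close>, which is frozen under the derivative but
      varies with its base point; the expansion displays this dependence as products with the
      components of \<open>z\<close>.\<close>
    have D_expand: "frechet_derivative (\<lambda>y. G y u w) (at x) v =
        (\<Sum>i\<in>Basis. (u \<bullet> i) * frechet_derivative (\<lambda>y. G y i w) (at x) v)" if x: "x \<in> S" for x u v w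
    proof -
      have "((\<lambda>y. \<Sum>i\<in>Basis. (u \<bullet> i) * G y i w) has_derivative
         (\<lambda>v. \<Sum>i\<in>Basis. (u \<bullet> i) * frechet_derivative (\<lambda>y. G y i w) (at x) v)) (at x)"
        by (intro has_derivative_sum has_derivative_mult_right smooth_on_has_derivative[OF sm x])
      then have "((\<lambda>y. G y u w) has_derivative
         (\<lambda>v. \<Sum>i\<in>Basis. (u \<bullet> i) * frechet_derivative (\<lambda>y. G y i w) (at x) v)) (at x)"
        by (rule has_derivative_transform_within_open[OF _ open_S x])
           (rule bilinear_basis_sum_left[OF bil, symmetric])
      from frechet_derivative_at[OF this] show ?thesis by (simp add: fun_eq_iff)
    qed
    have "C_k_on k (\<lambda>x. frechet_derivative (\<lambda>y. b y w) (at x) v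
              - frechet_derivative (\<lambda>y. G y (z x) w) (at x) v) S" for v w
    proof -
      have "C_k_on k (\<lambda>x. frechet_derivative (\<lambda>y. b y w) (at x) v + (- 1) *\<^sub>R 
          (\<Sum>i\<in>Basis. (z x \<bullet> i) * frechet_derivative (\<lambda>y. G y i w) (at x) v)) S"
        using Suc.prems(1)[of w]
        by (intro C_k_on_add C_k_on_sum C_k_on_bilinear[OF bounded_bilinear_mult] open_S zk C_k_on_const
              C_k_on_bilinear[OF bounded_bilinear_scaleR] C_k_on_bilinear[OF bounded_bilinear_inner]
              smooth_on_imp_C_k[OF smooth_on_frechet_derivative[OF sm]]) auto
      then show ?thesis
        by (rule C_k_on_cong[OF open_S, rotated]) (simp add: D_expand[symmetric])
    qed
    then have "C_k_on k (\<lambda>x. \<zeta> x v) S" for v by (rule Suc.IH[OF _ \<zeta>(2)])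
    from C_k_on_SucI[OF open_S \<zeta>(1) this] show ?case .
  qed
  with assms show ?thesis unfolding smooth_on_def by blast
qed

end

section \<open>Manifolds in charts\<close>

locale manifold =
  fixes A :: "('a::{t2_space, second_countable_topology}, 'e::euclidean_space) atlas"
  assumes mfd: "smooth_manifold A"
begin

lemma chart_open: "c \<in> A \<Longrightarrow> open (fst c)"
  and chart_image_open: "c \<in> A \<Longrightarrow> open (snd c ` fst c)"
  and chart_homeo: "c \<in> A \<Longrightarrow> homeomorphism (fst c) (snd c ` fst c) (snd c) (chart_inv c)"
  using mfd by (auto simp: smooth_manifold_def)

lemma chart_exists: obtains c where "c \<in> A" "p \<in> fst c"
proof -
  have "p \<in> (\<Union>c\<in>A. fst c)" using mfd unfolding smooth_manifold_def by blast
  then show thesis using that by blast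
qed

lemma chart_inv_chart: "c \<in> A \<Longrightarrow> p \<in> fst c \<Longrightarrow> chart_inv c (snd c p) = p"
  by (rule homeomorphism_apply1[OF chart_homeo])

lemma continuous_on_chart: "c \<in> A \<Longrightarrow> continuous_on (fst c) (snd c)"
  and continuous_on_chart_inv: "c \<in> A \<Longrightarrow> continuous_on (snd c ` fst c) (chart_inv c)"
  using chart_homeo[unfolded homeomorphism_def] by simp_all

lemma chart_image_iff:
  "c \<in> A \<Longrightarrow> x \<in> snd c ` (fst c \<inter> W) \<longleftrightarrow> x \<in> snd c ` fst c \<and> chart_inv c x \<in> W"
  using chart_inv_chart by fastforce

lemma open_chart_image:
  assumes "c \<in> A" "open W" shows "open (snd c ` (fst c \<inter> W))"
proof -
  have "snd c ` (fst c \<inter> W) = snd c ` fst c \<inter> chart_inv c -` W"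
    using chart_image_iff[OF assms(1)] by auto
  then show ?thesis
    using continuous_open_preimage[OF continuous_on_chart_inv chart_image_open assms(2)] assms(1) by simp
qed

lemma transition_smooth:
  "c \<in> A \<Longrightarrow> d \<in> A \<Longrightarrow> smooth_on (snd c ` (fst c \<inter> fst d)) (\<lambda>x. snd d (chart_inv c x))"
  using mfd unfolding smooth_manifold_def o_def by blast

end

lemma chart_chart_inv: "x \<in> snd c ` fst c \<Longrightarrow> snd c (chart_inv c x) = x"
  by (rule f_inv_into_f)

lemma chart_inv_in: "x \<in> snd c ` fst c \<Longrightarrow> chart_inv c x \<in> fst c"
  by (rule inv_into_into)

lemma inv_into_ident: "inv_into UNIV (\<lambda>x. x) = (\<lambda>x. x)"
  using inv_id by (simp add: id_def)

lemma smooth_map_to_euclidean_iff: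
  "smooth_map A (euclidean_atlas :: ('e::euclidean_space, 'e) atlas) W h \<longleftrightarrow>
     open W \<and> continuous_on W h \<and> (\<forall>c\<in>A. smooth_on (snd c ` (fst c \<inter> W)) (\<lambda>x. h (chart_inv c x)))"
  by (simp add: smooth_map_def euclidean_atlas_def o_def)

lemma smooth_map_from_euclidean_iff:
  "smooth_map (euclidean_atlas :: ('e::euclidean_space, 'e) atlas) B I \<alpha> \<longleftrightarrow>
     open I \<and> continuous_on I \<alpha> \<and> (\<forall>d\<in>B. smooth_on (I \<inter> \<alpha> -` fst d) (\<lambda>t. snd d (\<alpha> t)))"
  by (simp add: smooth_map_def euclidean_atlas_def o_def inv_into_ident)

text \<open>No single chart of \<open>B\<close> need cover the image. Smoothness is checked near
  each point, where a chart \<open>d\<close> around the image point is inserted between the two maps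
  and cancels.\<close>

lemma smooth_map_compose:
  fixes A :: "('a::{t2_space, second_countable_topology}, 'd::euclidean_space) atlas"
    and B :: "('b::{t2_space, second_countable_topology}, 'e::euclidean_space) atlas"
    and C :: "('c::topological_space, 'f::euclidean_space) atlas"
  assumes "manifold A" "manifold B" and C: "\<forall>e\<in>C. open (fst e)"
    and F: "smooth_map A B W F" and G: "smooth_map B C V G"
  shows "smooth_map A C (W \<inter> F -` V) (\<lambda>x. G (F x))"
proof -
  interpret A: manifold A by fact
  interpret B: manifold B by fact
  have contF: "continuous_on W F" and W: "open W" and contG: "continuous_on V G" and V: "open V"
    using F G by (auto simp: smooth_map_def)
  have preF: "open (W \<inter> F -` U)" if "open U" for U
    using continuous_open_preimage[OF contF W that] .
  have preG: "open (V \<inter> G -` U)" if "open U" for U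
    using continuous_open_preimage[OF contG V that] .
  show ?thesis
    unfolding smooth_map_def o_def
  proof (intro conjI ballI)
    show "open (W \<inter> F -` V)" using preF[OF V] .
    show "continuous_on (W \<inter> F -` V) (\<lambda>x. G (F x))"
      by (rule continuous_on_compose2[OF contG continuous_on_subset[OF contF]]) auto
    fix c e assume c: "c \<in> A" and e: "e \<in> C"
    let ?S = "snd c ` (fst c \<inter> (W \<inter> F -` V) \<inter> (\<lambda>x. G (F x)) -` fst e)"
    show "smooth_on ?S (\<lambda>x. snd e (G (F (chart_inv c x))))"
    proof (rule smooth_on_local)
      fix x assume "x \<in> ?S"
      then have x: "x \<in> snd c ` fst c" "chart_inv c x \<in> W" "F (chart_inv c x) \<in> V" "G (F (chart_inv c x)) \<in> fst e"
        using A.chart_image_iff[OF c, of x] by (auto simp: Int_assoc A.chart_inv_chart[OF c])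
      obtain d where d: "d \<in> B" "F (chart_inv c x) \<in> fst d" using B.chart_exists .
      let ?V = "V \<inter> G -` fst e"
      let ?T = "snd c ` (fst c \<inter> (W \<inter> F -` (fst d \<inter> ?V)))"
      let ?U = "snd d ` (fst d \<inter> V \<inter> G -` fst e)"
      have V': "open ?V" using preG C e by blast
      have U: "open ?U" using B.open_chart_image[OF d(1) V'] by (simp add: Int_assoc)
      have T: "open ?T"
        by (intro A.open_chart_image c preF open_Int B.chart_open d(1) V')
      have Tin: "y \<in> snd c ` fst c" "chart_inv c y \<in> W" "F (chart_inv c y) \<in> fst d"
        "F (chart_inv c y) \<in> V" "G (F (chart_inv c y)) \<in> fst e" if "y \<in> ?T" for y
        using that A.chart_image_iff[OF c, of y] by auto
      have "smooth_on ?T (\<lambda>y. snd d (F (chart_inv c y)))"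
      proof -
        have "smooth_on (snd c ` (fst c \<inter> W \<inter> F -` fst d)) (\<lambda>y. snd d (F (chart_inv c y)))"
          using F c d(1) by (simp add: smooth_map_def o_def)
        then show ?thesis by (rule smooth_on_subset) auto
      qed
      moreover have "smooth_on ?U (\<lambda>y. snd e (G (chart_inv d y)))"
        using G d(1) e by (simp add: smooth_map_def o_def)
      moreover have "(\<lambda>y. snd d (F (chart_inv c y))) ` ?T \<subseteq> ?U"
        using Tin by blast
      ultimately have "smooth_on ?T (\<lambda>y. snd e (G (chart_inv d (snd d (F (chart_inv c y))))))"
        using smooth_on_compose[OF T U] by blast
      then have "smooth_on ?T (\<lambda>y. snd e (G (F (chart_inv c y))))"
        by (rule smooth_on_cong[OF T, rotated]) (simp add: B.chart_inv_chart[OF d(1)] Tin)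
      moreover have "x \<in> ?T" using A.chart_image_iff[OF c] x d(2) by simp
      ultimately show "\<exists>T. open T \<and> x \<in> T \<and> smooth_on T (\<lambda>x. snd e (G (F (chart_inv c x))))"
        using T by blast
    qed
  qed
qed

lemma smooth_near_compose:
  fixes A :: "('a::{t2_space, second_countable_topology}, 'd::euclidean_space) atlas"
    and B :: "('b::{t2_space, second_countable_topology}, 'e::euclidean_space) atlas"
  assumes "manifold A" "manifold B" "smooth_map A B W F" "p \<in> W" "smooth_near B (F p) h"
  shows "smooth_near A p (\<lambda>x. h (F x))"
proof -
  obtain V where V: "F p \<in> V" "smooth_map B (euclidean_atlas :: (real, real) atlas) V h"
    using assms(5) by (auto simp: smooth_near_def)
  have "smooth_map A (euclidean_atlas :: (real, real) atlas) (W \<inter> F -` V) (\<lambda>x. h (F x))"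
    by (rule smooth_map_compose[OF assms(1,2) _ assms(3) V(2)]) (simp add: euclidean_atlas_def)
  then show ?thesis using V(1) assms(4) unfolding smooth_near_def by (intro exI[of _ "W \<inter> F -` V"]) simp
qed

section \<open>Tangent vectors in charts\<close>

context manifold
begin

lemma coord_vec_has_derivative:
  assumes "smooth_near A p h" "c \<in> A" "p \<in> fst c"
  shows "((\<lambda>x. h (chart_inv c x)) has_derivative (\<lambda>e. coord_vec A p c e h)) (at (snd c p))"
proof -
  obtain W where W: "p \<in> W" "smooth_map A (euclidean_atlas :: (real, real) atlas) W h"
    using assms(1) by (auto simp: smooth_near_def)
  have "smooth_on (snd c ` (fst c \<inter> W)) (\<lambda>x. h (chart_inv c x))"
    using W(2) assms(2) by (simp add: smooth_map_to_euclidean_iff)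
  from smooth_on_has_derivative[OF this] show ?thesis
    using assms W(1) by (simp add: coord_vec_def o_def)
qed

lemma coord_vec_not_smooth: "\<not> smooth_near A p h \<Longrightarrow> coord_vec A p c e h = 0"
  by (simp add: coord_vec_def)

text \<open>Makes the coordinate functions admissible test functions at \<open>p\<close>, so that
  \<open>components\<close> really evaluates a tangent vector; their arbitrary values outside of the
  chart domain do no harm.\<close>

lemma smooth_near_coordinate:
  assumes "c \<in> A" "p \<in> fst c"
  shows "smooth_near A p (\<lambda>q. snd c q \<bullet> b)"
  unfolding smooth_near_def smooth_map_to_euclidean_iff
proof (intro exI[of _ "fst c"] conjI ballI)
  show "continuous_on (fst c) (\<lambda>q. snd c q \<bullet> b)"
    by (intro continuous_intros continuous_on_chart assms)
  fix d assume d: "d \<in> A"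
  show "smooth_on (snd d ` (fst d \<inter> fst c)) (\<lambda>x. snd c (chart_inv d x) \<bullet> b)"
    by (intro smooth_on_inner smooth_on_const transition_smooth open_chart_image chart_open d assms)
qed (use assms chart_open in auto)

lemma coord_vec_coordinate:
  assumes "c \<in> A" "p \<in> fst c"
  shows "coord_vec A p c e (\<lambda>q. snd c q \<bullet> b) = e \<bullet> b"
proof -
  have "((\<lambda>x. x \<bullet> b) has_derivative (\<lambda>e. coord_vec A p c e (\<lambda>q. snd c q \<bullet> b))) (at (snd c p))"
    by (rule has_derivative_transform_within_open[OF coord_vec_has_derivative[OF smooth_near_coordinate[OF assms] assms]
         chart_image_open[OF assms(1)]])
       (use assms(2) in \<open>auto simp: chart_inv_chart[OF assms(1)]\<close>)
  moreover have "((\<lambda>x. x \<bullet> b) has_derivative (\<lambda>e. e \<bullet> b)) (at (snd c p))"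
    by (auto intro!: derivative_eq_intros)
  ultimately have "(\<lambda>e. coord_vec A p c e (\<lambda>q. snd c q \<bullet> b)) = (\<lambda>e. e \<bullet> b)"
    by (rule has_derivative_unique)
  then show ?thesis by (rule fun_cong)
qed

lemma components_coord_vec:
  "c \<in> A \<Longrightarrow> p \<in> fst c \<Longrightarrow> components c (coord_vec A p c e) = e"
  by (simp add: components_def coord_vec_coordinate euclidean_representation)

lemma coord_vec_linear:
  assumes "c \<in> A" "p \<in> fst c"
  shows "coord_vec A p c (a *\<^sub>R e + b *\<^sub>R e') = (\<lambda>h. a * coord_vec A p c e h + b * coord_vec A p c e' h)"
proof
  fix h
  show "coord_vec A p c (a *\<^sub>R e + b *\<^sub>R e') h = a * coord_vec A p c e h + b * coord_vec A p c e' h"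
  proof (cases "smooth_near A p h")
    case True
    have lin: "linear (\<lambda>e. coord_vec A p c e h)"
      by (rule has_derivative_linear[OF coord_vec_has_derivative[OF True assms]])
    show ?thesis by (simp add: linear_add[OF lin] linear_scale[OF lin])
  qed (simp add: coord_vec_not_smooth)
qed

lemma coord_vec_zero:
  assumes "c \<in> A" "p \<in> fst c" shows "coord_vec A p c 0 = (\<lambda>_. 0)"
  using coord_vec_linear[OF assms, of 0 0 0 0] by (simp only: scaleR_zero_left add_0 mult_zero_left)

lemma coord_vec_eq_iff:
  assumes "c \<in> A" "p \<in> fst c" shows "coord_vec A p c e = coord_vec A p c e' \<longleftrightarrow> e = e'"
proof
  assume "coord_vec A p c e = coord_vec A p c e'"
  then have "components c (coord_vec A p c e) = components c (coord_vec A p c e')" by (rule arg_cong)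
  then show "e = e'" by (simp only: components_coord_vec[OF assms])
qed simp

text \<open>The chain rule for the transition map. It allows \<open>tangent_space\<close>, which
  collects the vectors of all charts around \<open>p\<close>, to be described by any one of
  them.\<close>

lemma coord_vec_change:
  assumes c: "c \<in> A" "p \<in> fst c" and d: "d \<in> A" "p \<in> fst d"
  shows "coord_vec A p c e =
    coord_vec A p d (frechet_derivative (\<lambda>x. snd d (chart_inv c x)) (at (snd c p)) e)"
    (is "_ = coord_vec A p d (?D e)")
proof
  fix h
  show "coord_vec A p c e h = coord_vec A p d (?D e) h"
  proof (cases "smooth_near A p h")
    case True
    let ?T = "snd c ` (fst c \<inter> fst d)"
    have T: "open ?T" "snd c p \<in> ?T" using c d chart_open open_chart_image by auto
    have D: "((\<lambda>x. snd d (chart_inv c x)) has_derivative ?D) (at (snd c p))"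
      using smooth_on_has_derivative[OF transition_smooth[OF c(1) d(1)] T(2)] .
    have "((\<lambda>x. h (chart_inv d (snd d (chart_inv c x)))) has_derivative (\<lambda>e. coord_vec A p d (?D e) h)) (at (snd c p))"
      by (rule has_derivative_compose[OF D])
         (use coord_vec_has_derivative[OF True d] chart_inv_chart[OF c] in simp)
    then have "((\<lambda>x. h (chart_inv c x)) has_derivative (\<lambda>e. coord_vec A p d (?D e) h)) (at (snd c p))"
    proof (rule has_derivative_transform_within_open[OF _ T])
      fix x assume "x \<in> ?T"
      then have "chart_inv c x \<in> fst d" using chart_image_iff[OF c(1)] by blast
      then show "h (chart_inv d (snd d (chart_inv c x))) = h (chart_inv c x)"
        by (simp add: chart_inv_chart[OF d(1)])
    qed
    with coord_vec_has_derivative[OF True c]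
    have "(\<lambda>e. coord_vec A p c e h) = (\<lambda>e. coord_vec A p d (?D e) h)" by (rule has_derivative_unique)
    then show ?thesis by (rule fun_cong)
  qed (simp add: coord_vec_not_smooth)
qed

lemma tangent_space_eq:
  assumes c: "c \<in> A" "p \<in> fst c" shows "tangent_space A p = range (coord_vec A p c)"
proof
  show "tangent_space A p \<subseteq> range (coord_vec A p c)"
    unfolding tangent_space_def using coord_vec_change[OF _ _ c] by blast
  show "range (coord_vec A p c) \<subseteq> tangent_space A p"
    unfolding tangent_space_def using c by blast
qed

lemma coord_vec_in_tangent_space: "c \<in> A \<Longrightarrow> p \<in> fst c \<Longrightarrow> coord_vec A p c e \<in> tangent_space A p"
  unfolding tangent_space_def by blast

lemma coord_vec_components:
  assumes "c \<in> A" "p \<in> fst c" "v \<in> tangent_space A p"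
  shows "coord_vec A p c (components c v) = v"
proof -
  obtain e where "v = coord_vec A p c e" using assms(3) unfolding tangent_space_eq[OF assms(1,2)] by blast
  then show ?thesis by (simp add: components_coord_vec assms)
qed

lemma curve_has_vector_derivative:
  assumes "smooth_map (euclidean_atlas :: (real, real) atlas) A I \<alpha>" "t \<in> I" "c \<in> A" "\<alpha> t \<in> fst c"
  shows "((\<lambda>s. snd c (\<alpha> s)) has_vector_derivative vector_derivative (\<lambda>s. snd c (\<alpha> s)) (at t)) (at t)"
proof -
  have "smooth_on (I \<inter> \<alpha> -` fst c) (\<lambda>s. snd c (\<alpha> s))"
    using assms by (simp add: smooth_map_from_euclidean_iff)
  then have "(\<lambda>s. snd c (\<alpha> s)) differentiable (at t)"
    using assms smooth_on_differentiable by blast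
  then show ?thesis using vector_derivative_works by blast
qed

lemma velocity_eq:
  assumes \<alpha>: "smooth_map (euclidean_atlas :: (real, real) atlas) A I \<alpha>" "t \<in> I" "c \<in> A" "\<alpha> t \<in> fst c"
  shows "velocity A \<alpha> t = coord_vec A (\<alpha> t) c (vector_derivative (\<lambda>s. snd c (\<alpha> s)) (at t))"
    (is "_ = coord_vec _ _ _ ?x'")
proof
  fix h
  show "velocity A \<alpha> t h = coord_vec A (\<alpha> t) c ?x' h"
  proof (cases "smooth_near A (\<alpha> t) h")
    case True
    let ?T = "I \<inter> \<alpha> -` fst c"
    have T: "open ?T"
      using \<alpha> chart_open continuous_open_preimage unfolding smooth_map_def by blast
    note D = coord_vec_has_derivative[OF True \<alpha>(3,4)]
    have "((\<lambda>s. h (chart_inv c (snd c (\<alpha> s)))) has_derivative (\<lambda>r. coord_vec A (\<alpha> t) c (r *\<^sub>R ?x') h)) (at t)"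
      by (rule has_derivative_compose[OF curve_has_vector_derivative[OF \<alpha>, unfolded has_vector_derivative_def] D])
    then have "((\<lambda>s. h (\<alpha> s)) has_derivative (\<lambda>r. coord_vec A (\<alpha> t) c (r *\<^sub>R ?x') h)) (at t)"
      by (rule has_derivative_transform_within_open[OF _ T]) (use \<alpha> in \<open>auto simp: chart_inv_chart\<close>)
    then have "((\<lambda>s. h (\<alpha> s)) has_field_derivative coord_vec A (\<alpha> t) c ?x' h) (at t)"
      unfolding has_field_derivative_def
      by (rule has_derivative_eq_rhs) (simp add: linear_scale[OF has_derivative_linear[OF D]] mult.commute fun_eq_iff)
    then show ?thesis using True by (simp add: velocity_def o_def DERIV_imp_deriv)
  qed (simp add: coord_vec_not_smooth velocity_def)
qed

end

lemma map_in_charts_smooth: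
  assumes "smooth_map A B UNIV F" "c \<in> A" "d \<in> B"
  shows "smooth_on (snd c ` (fst c \<inter> F -` fst d)) (\<lambda>x. snd d (F (chart_inv c x)))"
  using assms by (simp add: smooth_map_def o_def)

lemma differential_coord_vec:
  fixes A :: "('a::{t2_space, second_countable_topology}, 'd::euclidean_space) atlas"
    and B :: "('b::{t2_space, second_countable_topology}, 'e::euclidean_space) atlas"
  assumes "manifold A" "manifold B" and F: "smooth_map A B UNIV F"
    and c: "c \<in> A" "p \<in> fst c" and d: "d \<in> B" "F p \<in> fst d"
  shows "differential B F p (coord_vec A p c e) = coord_vec B (F p) d
    (frechet_derivative (\<lambda>x. snd d (F (chart_inv c x))) (at (snd c p)) e)" (is "_ = coord_vec _ _ _ (?D e)")
proof
  interpret A: manifold A by fact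
  interpret B: manifold B by fact
  fix h
  show "differential B F p (coord_vec A p c e) h = coord_vec B (F p) d (?D e) h"
  proof (cases "smooth_near B (F p) h")
    case True
    \<comment> \<open>Otherwise \<open>coord_vec\<close> would return its default value 0 on the
      pulled-back test function.\<close>
    have hF: "smooth_near A p (\<lambda>x. h (F x))"
      by (rule smooth_near_compose[OF assms(1,2) F _ True]) simp
    let ?T = "snd c ` (fst c \<inter> F -` fst d)"
    have "open (F -` fst d)"
      using F B.chart_open[OF d(1)] continuous_open_preimage[of UNIV F] by (simp add: smooth_map_def)
    then have T: "open ?T" "snd c p \<in> ?T" using c d A.open_chart_image by auto
    have D: "((\<lambda>x. snd d (F (chart_inv c x))) has_derivative ?D) (at (snd c p))"
      using smooth_on_has_derivative[OF map_in_charts_smooth[OF F c(1) d(1)] T(2)] .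
    have "((\<lambda>x. h (chart_inv d (snd d (F (chart_inv c x))))) has_derivative (\<lambda>e. coord_vec B (F p) d (?D e) h)) (at (snd c p))"
      by (rule has_derivative_compose[OF D])
         (use B.coord_vec_has_derivative[OF True d] A.chart_inv_chart[OF c] in simp)
    then have "((\<lambda>x. h (F (chart_inv c x))) has_derivative (\<lambda>e. coord_vec B (F p) d (?D e) h)) (at (snd c p))"
    proof (rule has_derivative_transform_within_open[OF _ T])
      fix x assume "x \<in> ?T"
      then have "F (chart_inv c x) \<in> fst d" using A.chart_image_iff[OF c(1), of x "F -` fst d"] by simp
      then show "h (chart_inv d (snd d (F (chart_inv c x)))) = h (F (chart_inv c x))"
        by (simp add: B.chart_inv_chart[OF d(1)])
    qed
    with A.coord_vec_has_derivative[OF hF c]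
    have "(\<lambda>e. coord_vec A p c e (\<lambda>x. h (F x))) = (\<lambda>e. coord_vec B (F p) d (?D e) h)" by (rule has_derivative_unique)
    from fun_cong[OF this, of e] show ?thesis using True by (simp add: differential_def o_def)
  qed (simp add: B.coord_vec_not_smooth differential_def)
qed

section \<open>Riemannian metrics on open subsets of Euclidean space\<close>

locale riemannian_field = metric_field S G
  for S :: "'e::euclidean_space set" and G :: "'e \<Rightarrow> 'e \<Rightarrow> 'e \<Rightarrow> real" +
  assumes sym: "\<And>x u v. x \<in> S \<Longrightarrow> G x u v = G x v u"
begin

text \<open>Kept parallel to \<open>christoffel\<close>, so that the two agree by unfolding.\<close>

definition chr :: "'e \<Rightarrow> 'e \<Rightarrow> 'e \<Rightarrow> 'e" where
  "chr x u v = (THE z. \<forall>w. 2 * G x z w = dform x u v w + dform x v u w - dform x w u v)"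

lemma form_eqD:
  assumes "x \<in> S" "\<And>w. G x z w = G x z' w" shows "z = z'"
proof -
  have "G x (z - z') (z - z') = 0" using assms by (simp add: bilinear_lsub[OF bil])
  then show ?thesis using pos[OF assms(1), of "z - z'"] by fastforce
qed

lemma dform_sym:
  assumes "x \<in> S" shows "dform x h u v = dform x h v u"
  by (rule dform_eqI[OF assms has_derivative_transform_within_open[OF has_derivative_form[OF assms] open_S assms]])
     (rule sym)

text \<open>The description is proper: the Koszul right-hand side is linear in \<open>w\<close>, so
  Riesz representation gives existence, and positivity gives uniqueness.\<close>

lemma chr_eq:
  assumes x: "x \<in> S"
  shows "2 * G x (chr x u v) w = dform x u v w + dform x v u w - dform x w u v"
proof -
  have "linear (\<lambda>w. (dform x u v w + dform x v u w - dform x w u v) / 2)"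
    using dform_bilinear[OF x] dform_linear[OF x]
    by (intro linearI)
       (simp_all add: bilinear_radd[OF dform_bilinear[OF x]] bilinear_rmul[OF dform_bilinear[OF x]]
         linear_add[OF dform_linear[OF x]] linear_scale[OF dform_linear[OF x]] field_simps)
  then have "\<exists>z. \<forall>w. G x z w = (dform x u v w + dform x v u w - dform x w u v) / 2"
    by (intro positive_definite_riesz bil[OF x] pos[OF x])
  then obtain z where z: "\<And>w. G x z w = (dform x u v w + dform x v u w - dform x w u v) / 2" by blast
  have "\<forall>w. 2 * G x (chr x u v) w = dform x u v w + dform x v u w - dform x w u v"
    unfolding chr_def
  proof (rule theI[of _ z])
    show "\<forall>w. 2 * G x z w = dform x u v w + dform x v u w - dform x w u v" by (simp add: z)
    fix z' assume z': "\<forall>w. 2 * G x z' w = dform x u v w + dform x v u w - dform x w u v"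
    show "z' = z" by (rule form_eqD[OF x]) (use z' in \<open>simp add: z field_simps\<close>)
  qed
  then show ?thesis by blast
qed

text \<open>Torsion-freeness: exchanging \<open>u\<close> and \<open>v\<close> swaps the first two
  Koszul terms and preserves the third.\<close>

lemma chr_sym:
  assumes x: "x \<in> S" shows "chr x u v = chr x v u"
proof (rule form_eqD[OF x])
  fix w
  have "2 * G x (chr x u v) w = 2 * G x (chr x v u) w"
    unfolding chr_eq[OF x] by (simp add: dform_sym[OF x, of w u v])
  then show "G x (chr x u v) w = G x (chr x v u) w" by simp
qed

lemma chr_bilinear:
  assumes x: "x \<in> S" shows "bilinear (chr x)"
proof -
  have right: "chr x u (v + v') = chr x u v + chr x u v'" and scale: "chr x u (k *\<^sub>R v) = k *\<^sub>R chr x u v" for u v v' k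
  proof -
    note d = bilinear_ladd[OF dform_bilinear[OF x]] bilinear_lmul[OF dform_bilinear[OF x]]
      bilinear_radd[OF dform_bilinear[OF x]] bilinear_rmul[OF dform_bilinear[OF x]]
      linear_add[OF dform_linear[OF x]] linear_scale[OF dform_linear[OF x]]
      bilinear_ladd[OF bil[OF x]] bilinear_lmul[OF bil[OF x]]
    have "2 * G x (chr x u (v + v')) w = 2 * G x (chr x u v + chr x u v') w"
      and "2 * G x (chr x u (k *\<^sub>R v)) w = 2 * G x (k *\<^sub>R chr x u v) w" for w
    proof -
      show "2 * G x (chr x u (v + v')) w = 2 * G x (chr x u v + chr x u v') w"
        using chr_eq[OF x, of u v w] chr_eq[OF x, of u v' w] chr_eq[OF x, of u "v + v'" w]
        by (simp add: d)
      have "2 * G x (chr x u (k *\<^sub>R v)) w = k * (dform x u v w + dform x v u w - dform x w u v)"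
        unfolding chr_eq[OF x] by (simp add: d algebra_simps)
      also have "\<dots> = k * (2 * G x (chr x u v) w)" by (simp only: chr_eq[OF x])
      finally show "2 * G x (chr x u (k *\<^sub>R v)) w = 2 * G x (k *\<^sub>R chr x u v) w"
        by (simp add: d)
    qed
    then show "chr x u (v + v') = chr x u v + chr x u v'" "chr x u (k *\<^sub>R v) = k *\<^sub>R chr x u v"
      by (auto intro!: form_eqD[OF x])
  qed
  moreover have "chr x (v + v') u = chr x v u + chr x v' u" and "chr x (k *\<^sub>R v) u = k *\<^sub>R chr x v u" for u v v' k
    using right[of u v v'] scale[of u k v] by (simp_all only: chr_sym[OF x, of u])
  ultimately show ?thesis by (simp add: bilinear_def linear_iff)
qed

lemma dform_smooth: "smooth_on S (\<lambda>x. dform x h u v)"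
  unfolding dform_def by (rule smooth_on_frechet_derivative[OF sm])

text \<open>The Koszul formula is a linear system with smooth coefficients and smooth right-hand
  side, so its implicit solution is smooth.\<close>

lemma chr_smooth: "smooth_on S (\<lambda>x. chr x u v)"
proof (rule solution_smooth)
  have "smooth_on S (\<lambda>x. (1/2) *\<^sub>R (dform x u v w + dform x v u w + (- 1) *\<^sub>R dform x w u v))" for w
    by (intro smooth_on_scaleR smooth_on_add open_S smooth_on_const dform_smooth)
  then show "smooth_on S (\<lambda>x. (1/2) * (dform x u v w + dform x v u w - dform x w u v))" for w
    by simp
  show "G y (chr y u v) w = (1/2) * (dform y u v w + dform y v u w - dform y w u v)" if "y \<in> S" for y w
    using chr_eq[OF that, of u v w] by simp
qed

lemma chr_quadratic: "x \<in> S \<Longrightarrow> 2 * G x (chr x v v) w = 2 * dform x v v w - dform x w v v"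
  by (simp add: chr_eq)

lemma geodesic_exists:
  assumes x0: "x0 \<in> S" and v0: "v0 \<noteq> 0"
  obtains e x v where "e > 0" "x 0 = x0" "v 0 = v0" "smooth_on {-e<..<e} x"
    "\<And>t. t \<in> {-e<..<e} \<Longrightarrow> x t \<in> S" "\<And>t. t \<in> {-e<..<e} \<Longrightarrow> v t \<noteq> 0"
    "\<And>t. t \<in> {-e<..<e} \<Longrightarrow> (x has_vector_derivative v t) (at t)"
    "\<And>t. t \<in> {-e<..<e} \<Longrightarrow> (v has_vector_derivative - chr (x t) (v t) (v t)) (at t)"
proof -
  \<comment> \<open>Phase space without the zero velocities: it is open, so the local solution of
    the first-order system keeps a nonzero velocity with no further argument.\<close>
  let ?\<Omega> = "S \<times> (- {0::'e})"
  define \<Phi> where "\<Phi> z = (snd z, - chr (fst z) (snd z) (snd z))" for z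
  have \<Omega>: "open ?\<Omega>" by (intro open_Times open_S open_Compl closed_singleton)
  have fst_sm: "smooth_on ?\<Omega> fst" and snd_sm: "smooth_on ?\<Omega> snd"
    by (intro smooth_on_bounded_linear bounded_linear_fst bounded_linear_snd \<Omega>)+
  have chr_z: "smooth_on ?\<Omega> (\<lambda>z. chr (fst z) i j)" for i j
    by (rule smooth_on_compose[OF \<Omega> open_S _ chr_smooth fst_sm]) auto
  \<comment> \<open>Smoothness of \<open>chr\<close> is known for constant arguments only, while the
    velocity is now a variable.\<close>
  have expand: "chr x u v = (\<Sum>i\<in>Basis. (u \<bullet> i) *\<^sub>R (\<Sum>j\<in>Basis. (v \<bullet> j) *\<^sub>R chr x i j))" if x: "x \<in> S" for x u v
  proof -
    have 1: "linear (\<lambda>u. chr x u v)" for v using chr_bilinear[OF x] by (simp add: bilinear_def)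
    have 2: "linear (\<lambda>v. chr x u v)" for u using chr_bilinear[OF x] by (simp add: bilinear_def)
    show ?thesis
      by (subst linear_eq_basis_sum[OF 1]) (simp only: linear_eq_basis_sum[OF 2, of _ v])
  qed
  have "smooth_on ?\<Omega> (\<lambda>z. (snd z, (- 1) *\<^sub>R (\<Sum>i\<in>Basis. (snd z \<bullet> i) *\<^sub>R (\<Sum>j\<in>Basis. (snd z \<bullet> j) *\<^sub>R chr (fst z) i j))))"
    by (intro smooth_on_Pair smooth_on_scaleR smooth_on_sum smooth_on_inner smooth_on_const \<Omega> snd_sm chr_z)
  then have \<Phi>_sm: "smooth_on ?\<Omega> \<Phi>"
    by (rule smooth_on_cong[OF \<Omega>, rotated]) (auto simp: \<Phi>_def expand[symmetric])
  obtain e z where z: "e > 0" "z 0 = (x0, v0)" "z ` {-e<..<e} \<subseteq> ?\<Omega>"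
    "\<And>t. t \<in> {-e<..<e} \<Longrightarrow> (z has_vector_derivative \<Phi> (z t)) (at t)" "smooth_on {-e<..<e} z"
    using ode_smooth_local_solution[OF \<Omega> \<Phi>_sm, of "(x0, v0)"] x0 v0 by auto
  have z_in: "fst (z t) \<in> S" "snd (z t) \<noteq> 0" if "t \<in> {-e<..<e}" for t
    using z(3) that by (auto simp: image_subset_iff mem_Times_iff)
  show thesis
  proof (rule that[of e "\<lambda>t. fst (z t)" "\<lambda>t. snd (z t)"])
    show "smooth_on {-e<..<e} (\<lambda>t. fst (z t))"
      by (rule smooth_on_linear_compose[OF bounded_linear_fst _ z(5)]) auto
    fix t assume t: "t \<in> {-e<..<e}"
    have D: "(z has_derivative (\<lambda>s. s *\<^sub>R \<Phi> (z t))) (at t)"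
      using z(4)[OF t] by (simp add: has_vector_derivative_def)
    show "((\<lambda>t. fst (z t)) has_vector_derivative snd (z t)) (at t)"
      using has_derivative_fst[OF D] by (simp add: has_vector_derivative_def \<Phi>_def)
    show "((\<lambda>t. snd (z t)) has_vector_derivative - chr (fst (z t)) (snd (z t)) (snd (z t))) (at t)"
      using has_derivative_snd[OF D] by (simp add: has_vector_derivative_def \<Phi>_def)
  qed (use z z_in in auto)
qed

end

lemma has_real_derivative_quadratic_form:
  fixes G :: "'e::euclidean_space \<Rightarrow> 'e \<Rightarrow> 'e \<Rightarrow> real"
  assumes "form_field S G" "x t \<in> S" "(x has_vector_derivative v t) (at t)" "(v has_vector_derivative a) (at t)"
  shows "((\<lambda>s. G (x s) (v s) (v s)) has_real_derivative
      form_field.dform G (x t) (v t) (v t) (v t) + G (x t) a (v t) + G (x t) (v t) a) (at t)"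
proof -
  interpret form_field S G by fact
  note D = has_derivative_form_along[OF assms(2) assms(3,4,4)[unfolded has_vector_derivative_def]]
  show ?thesis
    unfolding has_field_derivative_def
    by (rule has_derivative_eq_rhs[OF D])
       (simp add: fun_eq_iff linear_scale[OF dform_linear[OF assms(2)]] bilinear_lmul[OF bil[OF assms(2)]]
         bilinear_rmul[OF bil[OF assms(2)]] algebra_simps)
qed

text \<open>On the line \<open>w + k n\<close> the form is affine in \<open>k\<close>, with slope
  \<open>2 Q n w\<close>; the chosen \<open>k\<close> makes its value -1.\<close>

lemma semidefinite_null:
  fixes Q :: "'e::real_vector \<Rightarrow> 'e \<Rightarrow> real"
  assumes Q: "bilinear Q" "\<And>u v. Q u v = Q v u" "\<And>u. Q u u \<ge> 0" and n: "Q n n = 0"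
  shows "Q n w = 0"
proof (rule ccontr)
  assume neq: "Q n w \<noteq> 0"
  define k where "k = - (Q w w + 1) / (2 * Q n w)"
  have "Q (w + k *\<^sub>R n) (w + k *\<^sub>R n) = Q w w + 2 * k * Q n w + k * k * Q n n"
    by (simp add: bilinear_ladd[OF Q(1)] bilinear_radd[OF Q(1)] bilinear_lmul[OF Q(1)] bilinear_rmul[OF Q(1)]
        Q(2)[of w n] algebra_simps)
  also have "2 * k * Q n w = - (Q w w + 1)" using neq by (simp add: k_def)
  also have "Q w w + - (Q w w + 1) + k * k * Q n n = - 1" using n by simp
  finally show False using Q(3)[of "w + k *\<^sub>R n"] by simp
qed

section \<open>A metric together with its degenerate horizontal part\<close>

text \<open>
  \<open>Q\<close> is the horizontal part of \<open>G\<close>, so its null vectors are the vertical ones. \<open>integrable\<close> is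
  the trace left in this picture by the integrability of the vertical distribution.
\<close>

locale submersion_field = riemannian_field S G + Q: form_field S Q
  for S :: "'e::euclidean_space set" and G Q :: "'e \<Rightarrow> 'e \<Rightarrow> 'e \<Rightarrow> real" +
  assumes Q_sym: "\<And>x u v. x \<in> S \<Longrightarrow> Q x u v = Q x v u"
    and Q_nonneg: "\<And>x u. x \<in> S \<Longrightarrow> Q x u u \<ge> 0"
    and projection: "\<And>x v. x \<in> S \<Longrightarrow> \<exists>h. (\<forall>z. G x z h = Q x z v) \<and> Q x (v - h) (v - h) = 0"
    and integrable: "\<And>x u v w. x \<in> S \<Longrightarrow> Q x u u = 0 \<Longrightarrow> Q x v v = 0 \<Longrightarrow>
          Q.dform x u v w = Q.dform x v u w"
begin

lemma Q_null: "x \<in> S \<Longrightarrow> Q x n n = 0 \<Longrightarrow> Q x n w = 0"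
  by (rule semidefinite_null) (auto intro: Q.bil Q_sym Q_nonneg)

text \<open>The difference of the two sides is the squared \<open>G\<close>-length of the vertical
  part \<open>v - h\<close>.\<close>

lemma Q_le: 
  assumes x: "x \<in> S" shows "Q x v v \<le> G x v v"
proof -
  obtain h where h: "\<And>z. G x z h = Q x z v" "Q x (v - h) (v - h) = 0" using projection[OF x] by blast
  have "Q x (v - h) v = 0" using Q_null[OF x h(2)] .
  then have Qhv: "Q x h v = Q x v v" by (simp add: bilinear_lsub[OF Q.bil[OF x]])
  have "G x (v - h) (v - h) = G x v v - G x v h - (G x v h - G x h h)"
    by (simp add: bilinear_lsub[OF bil[OF x]] bilinear_rsub[OF bil[OF x]] sym[OF x, of h v])
  then have "G x v v - Q x v v = G x (v - h) (v - h)" using h(1) Qhv by simp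
  moreover have "G x (v - h) (v - h) \<ge> 0"
    using pos[OF x, of "v - h"] bilinear_lzero[OF bil[OF x]] by (cases "v = h") auto
  ultimately show ?thesis by simp
qed

lemma Q_dform_sym: "x \<in> S \<Longrightarrow> Q.dform x h u v = Q.dform x h v u"
  by (rule Q.dform_eqI[OF _ has_derivative_transform_within_open[OF Q.has_derivative_form Q.open_S]])
     (auto simp: Q_sym)

text \<open>\<open>y \<mapsto> Q y n n\<close> is minimal at \<open>x\<close>.\<close>

lemma Q_dform_null:
  assumes x: "x \<in> S" and n: "Q x n n = 0"
  shows "Q.dform x w n n = 0"
proof -
  have "(\<lambda>w. Q.dform x w n n) = (\<lambda>_. 0)"
  proof (rule has_derivative_local_min[OF Q.has_derivative_form[OF x]])
    show "eventually (\<lambda>y. Q x n n \<le> Q y n n) (at x)"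
      using eventually_at_topological[of "\<lambda>y. Q x n n \<le> Q y n n" x UNIV] Q.open_S x n Q_nonneg by auto
  qed
  then show ?thesis by (rule fun_cong)
qed

text \<open>Polarization, as \<open>n + m\<close> is again a null vector.\<close>

lemma Q_dform_null2:
  assumes x: "x \<in> S" and n: "Q x n n = 0" "Q x m m = 0"
  shows "Q.dform x w n m = 0"
proof -
  note b = Q.dform_bilinear[OF x]
  have "Q x (n + m) (n + m) = 0"
    using Q_null[OF x n(1)] Q_null[OF x n(2)] by (simp add: bilinear_ladd[OF Q.bil[OF x]])
  from Q_dform_null[OF x this, of w] show ?thesis
    using Q_dform_null[OF x n(1), of w] Q_dform_null[OF x n(2), of w] Q_dform_sym[OF x, of w n m]
    by (simp add: bilinear_ladd[OF b] bilinear_radd[OF b])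
qed

text \<open>
  \<open>T\<close> is the covariant derivative of \<open>Q\<close>. Its symmetrization vanishes because its cubic form
  does; on two vertical arguments the three terms of the symmetrization are equal or zero.
\<close>

lemma vertical_second_fundamental_form_zero:
  assumes x: "x \<in> S" and Killing: "\<And>v. Q.dform x v v v = 2 * Q x (chr x v v) v"
    and n: "Q x n n = 0" "Q x m m = 0"
  shows "Q.dform x n m w = Q x (chr x n m) w"
proof -
  define T where "T u v w = Q.dform x u v w - Q x (chr x u v) w - Q x v (chr x u w)" for u v w
  note lin = linear_add[OF Q.dform_linear[OF x]] bilinear_ladd[OF Q.dform_bilinear[OF x]]
    bilinear_radd[OF Q.dform_bilinear[OF x]] bilinear_ladd[OF Q.bil[OF x]] bilinear_radd[OF Q.bil[OF x]]
    bilinear_ladd[OF chr_bilinear[OF x]] bilinear_radd[OF chr_bilinear[OF x]]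
  have T0: "T v v v = 0" for v
    unfolding T_def using Killing[of v] Q_sym[OF x, of v "chr x v v"] by simp
  have add: "T (u + u') v w = T u v w + T u' v w" "T u (v + v') w = T u v w + T u v' w"
    "T u v (w + w') = T u v w + T u v w'" for u u' v v' w w'
    unfolding T_def by (simp_all add: lin)
  have T_sym: "T u v w = T u w v" for u v w
    unfolding T_def using Q_dform_sym[OF x, of u v w] Q_sym[OF x, of "chr x u v" w] Q_sym[OF x, of "chr x u w" v]
    by simp
  have neg: "T (- u) v w = - T u v w" "T u (- v) w = - T u v w" "T u v (- w) = - T u v w" for u v w
    using add(1)[of u "- u" v w] add(2)[of u v "- v" w] add(3)[of u v w "- w"]
      add(1)[of 0 0 v w] add(2)[of u 0 0 w] add(3)[of u v 0 0] by simp_all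
  \<comment> \<open>Inclusion-exclusion over \<open>n\<close>, \<open>m\<close> and \<open>w\<close>
    isolates the mixed terms of the cubic form.\<close>
  have 1: "T (n + m + w) (n + m + w) (n + m + w) = 0" "T (n + m) (n + m) (n + m) = 0"
    "T (n + w) (n + w) (n + w) = 0" "T (m + w) (m + w) (m + w) = 0" "T n n n = 0" "T m m m = 0" "T w w w = 0"
    by (rule T0)+
  have "T n m w + T n w m + T m n w + T m w n + T w n m + T w m n = 0"
    using 1 unfolding add by linarith
  then have cyc: "T n m w + T m n w + T w n m = 0"
    using T_sym[of n m w] T_sym[of m n w] T_sym[of w n m] by simp
  note null = Q_null[OF x n(1)] Q_null[OF x n(2)]
  have null': "Q x u n = 0" "Q x u m = 0" for u
    using null[of u] Q_sym[OF x, of u n] Q_sym[OF x, of u m] by simp_all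
  have Tw: "T w n m = 0" unfolding T_def by (simp add: null null' Q_dform_null2[OF x n])
  \<comment> \<open>Integrability exchanges \<open>n\<close> and \<open>m\<close> in the derivative
    term and torsion-freeness in the Christoffel term; the third term pairs with a null
    vector.\<close>
  have "T n m w = T m n w"
    unfolding T_def using integrable[OF x n, of w] chr_sym[OF x, of n m] by (simp add: null)
  with cyc Tw have "T n m w = 0" by simp
  then show ?thesis unfolding T_def by (simp add: null)
qed

text \<open>Differentiating \<open>Q (V, w) = 0\<close> in the direction \<open>u\<close> turns
  \<open>Q (V' u) w\<close> into \<open>- Q.dform x u (V x) w\<close>, and the preceding lemma
  identifies the latter with \<open>- Q (chr x u (V x)) w\<close>.\<close>

lemma covariant_derivative_vertical:
  assumes x: "x \<in> S" and Killing: "\<And>v. Q.dform x v v v = 2 * Q x (chr x v v) v"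
    and W: "open W" "x \<in> W" "W \<subseteq> S" and V: "(V has_derivative V') (at x)"
    and null: "\<And>y. y \<in> W \<Longrightarrow> Q y (V y) (V y) = 0" and u: "Q x u u = 0"
  shows "Q x (V' u + chr x u (V x)) w = 0"
proof -
  have "((\<lambda>y. Q y (V y) w) has_derivative
     (\<lambda>h. Q.dform x h (V x) w + Q x (V' h) w + Q x (V x) 0)) (at x)"
    by (rule Q.has_derivative_form_along[OF x has_derivative_ident V has_derivative_const])
  then have "((\<lambda>y. 0) has_derivative
     (\<lambda>h. Q.dform x h (V x) w + Q x (V' h) w + Q x (V x) 0)) (at x)"
    by (rule has_derivative_transform_within_open[OF _ W(1,2)]) (use null W(3) Q_null in blast)
  from has_derivative_unique[OF this has_derivative_const]
  have "Q.dform x u (V x) w + Q x (V' u) w + Q x (V x) 0 = 0" by (rule fun_cong)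
  then have "Q.dform x u (V x) w + Q x (V' u) w = 0" by (simp add: bilinear_rzero[OF Q.bil[OF x]])
  then show ?thesis
    using vertical_second_fundamental_form_zero[OF x Killing u null[OF W(2)], of w]
    by (simp add: bilinear_ladd[OF Q.bil[OF x]])
qed

end

text \<open>
  \<open>Clairaut\<close> says that \<open>e\<^sup>2\<^sup>\<psi> (G - Q)(x', x')\<close> has derivative 0 along the geodesics of \<open>G\<close>,
  and the conclusion that \<open>Q'(x', x')\<close> has derivative 0 along the geodesics of \<open>G'\<close>.
\<close>

lemma clairaut_conformal_change:
  fixes G Q G' Q' :: "'e::euclidean_space \<Rightarrow> 'e \<Rightarrow> 'e \<Rightarrow> real"
  assumes GQ: "submersion_field S G Q" and GQ': "submersion_field S G' Q'"
    and \<psi>: "(\<psi> has_derivative \<psi>') (at x)" and x: "x \<in> S"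
    and G': "\<And>y u v. y \<in> S \<Longrightarrow> G' y u v = exp (- 2 * \<psi> y) * G y u v"
    and Q': "\<And>y u v. y \<in> S \<Longrightarrow> Q' y u v = exp (- 2 * \<psi> y) * Q y u v"
    and Clairaut: "\<And>v. 2 * \<psi>' v * (G x v v - Q x v v) + form_field.dform G x v v v - form_field.dform Q x v v v
       = 2 * (G x (riemannian_field.chr G x v v) v - Q x (riemannian_field.chr G x v v) v)"
  shows "form_field.dform Q' x v v v = 2 * Q' x (riemannian_field.chr G' x v v) v"
proof -
  interpret P: submersion_field S G Q by fact
  interpret P': submersion_field S G' Q' by fact
  let ?E = "exp (- 2 * \<psi> x)"
  have lin\<psi>: "linear \<psi>'" using has_derivative_linear[OF \<psi>] .
  have D_exp: "((\<lambda>y. exp (- 2 * \<psi> y)) has_derivative (\<lambda>h. - 2 * \<psi>' h * ?E)) (at x)"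
    using \<psi> by (auto intro!: derivative_eq_intros simp: fun_eq_iff)
  have dG': "P'.dform x h u v = ?E * (P.dform x h u v - 2 * \<psi>' h * G x u v)" for h u v
  proof -
    have "P'.dform x h u v = ?E * P.dform x h u v + (- 2 * \<psi>' h * ?E) * G x u v"
      by (rule P'.dform_eqI[OF x has_derivative_transform_within_open[OF
            has_derivative_mult[OF D_exp P.has_derivative_form[OF x]] P.open_S x]]) (simp add: G')
    then show ?thesis by (simp add: algebra_simps)
  qed
  have dQ': "P'.Q.dform x h u v = ?E * (P.Q.dform x h u v - 2 * \<psi>' h * Q x u v)" for h u v
  proof -
    have "P'.Q.dform x h u v = ?E * P.Q.dform x h u v + (- 2 * \<psi>' h * ?E) * Q x u v"
      by (rule P'.Q.dform_eqI[OF x has_derivative_transform_within_open[OF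
            has_derivative_mult[OF D_exp P.Q.has_derivative_form[OF x]] P.open_S x]]) (simp add: Q')
    then show ?thesis by (simp add: algebra_simps)
  qed
  \<comment> \<open>The terms in \<open>G\<close> alone cancel, because the Koszul formula at
    \<open>w = v\<close> is conservation of energy.\<close>
  have dQ: "P.Q.dform x v v v = 2 * \<psi>' v * (G x v v - Q x v v) + 2 * Q x (P.chr x v v) v" for v
    using Clairaut[of v] P.chr_quadratic[OF x, of v v] by (simp add: algebra_simps)
  \<comment> \<open>On a null vector both \<open>Q\<close>-terms vanish, which leaves
    \<open>\<psi>' n\<close> times a positive number.\<close>
  have \<psi>_vertical: "\<psi>' n = 0" if n: "Q x n n = 0" for n
  proof (cases "n = 0")
    case False
    have "0 = 2 * \<psi>' n * G x n n"
      using dQ[of n] P.Q_dform_null[OF x n, of n] P.Q_null[OF x n, of "P.chr x n n"] n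
        P.Q_sym[OF x, of n "P.chr x n n"] by simp
    then show ?thesis using P.pos[OF x False] by simp
  qed (simp add: linear_0[OF lin\<psi>])
  obtain h where h: "\<And>z. G x z h = Q x z v" "Q x (v - h) (v - h) = 0" using P.projection[OF x] by blast
  have \<psi>h: "\<psi>' h = \<psi>' v" using \<psi>_vertical[OF h(2)] by (simp add: linear_diff[OF lin\<psi>])
  \<comment> \<open>The Koszul formula computes only pairings under \<open>G'\<close>; pairing with
    \<open>h\<close> turns the \<open>Q'\<close>-term into such a pairing. The derivative of the
    conformal factor along \<open>h\<close> then appears, which is why \<open>\<psi>h\<close> is
    needed.\<close>
  have "2 * Q' x (P'.chr x v v) v = 2 * G' x (P'.chr x v v) h"
    by (simp add: G'[OF x] Q'[OF x] h(1))
  also have "\<dots> = ?E * (2 * (P.dform x v v h - 2 * \<psi>' v * G x v h) - (P.dform x h v v - 2 * \<psi>' h * G x v v))"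
    unfolding P'.chr_quadratic[OF x] dG' by (simp add: algebra_simps)
  also have "\<dots> = ?E * (2 * G x (P.chr x v v) h - 4 * \<psi>' v * G x v h + 2 * \<psi>' v * G x v v)"
    unfolding P.chr_quadratic[OF x] \<psi>h by (simp add: algebra_simps)
  also have "\<dots> = ?E * (2 * Q x (P.chr x v v) v - 4 * \<psi>' v * Q x v v + 2 * \<psi>' v * G x v v)"
    by (simp add: h(1))
  also have "\<dots> = P'.Q.dform x v v v" unfolding dQ' dQ by (simp add: algebra_simps)
  finally show ?thesis by simp
qed

section \<open>Orthogonal projections for a positive definite form\<close>

text \<open>Gram-Schmidt: \<open>b'\<close> is the part of the new generator orthogonal to the old
  span, and removing the component of \<open>v'\<close> along \<open>b'\<close> extends
  orthogonality to the larger span.\<close>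

lemma positive_definite_projection_span:
  fixes G :: "'e::real_vector \<Rightarrow> 'e \<Rightarrow> real"
  assumes G: "bilinear G" "\<And>u. u \<noteq> 0 \<Longrightarrow> G u u > 0" "\<And>u v. G u v = G v u" and "finite B"
  shows "\<exists>h. v - h \<in> span B \<and> (\<forall>u\<in>span B. G u h = 0)"
  using assms(4)
proof (induction B arbitrary: v rule: finite_induct)
  case empty
  then show ?case by (auto intro!: exI[of _ v] simp: bilinear_lzero[OF G(1)])
next
  case (insert b B)
  obtain b' where b': "b - b' \<in> span B" "\<And>u. u \<in> span B \<Longrightarrow> G u b' = 0" using insert.IH by blast
  obtain v' where v': "v - v' \<in> span B" "\<And>u. u \<in> span B \<Longrightarrow> G u v' = 0" using insert.IH by blast
  \<comment> \<open>If \<open>b\<close> already lies in the old span, then \<open>b' = 0\<close>;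
    the quotient is then 0 by convention and the correction vanishes.\<close>
  define k where "k = G b' v' / G b' b'"
  define h where "h = v' - k *\<^sub>R b'"
  have sub: "span B \<subseteq> span (insert b B)" by (rule span_mono) auto
  have "b \<in> span (insert b B)" by (rule span_base) auto
  then have "b - (b - b') \<in> span (insert b B)" using b'(1) sub by (blast intro: span_diff)
  then have b'_in: "b' \<in> span (insert b B)" by simp
  have "v - h = (v - v') + k *\<^sub>R b'" by (simp add: h_def)
  also have "\<dots> \<in> span (insert b B)" using v'(1) sub b'_in by (blast intro: span_add span_scale)
  finally have 1: "v - h \<in> span (insert b B)" .
  have hB: "G u h = 0" if "u \<in> span B" for u
    using b'(2)[OF that] v'(2)[OF that] by (simp add: h_def bilinear_rsub[OF G(1)] bilinear_rmul[OF G(1)])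
  have hb': "G b' h = 0"
    using G(2)[of b'] by (cases "b' = 0")
      (auto simp: h_def k_def bilinear_rsub[OF G(1)] bilinear_rmul[OF G(1)] bilinear_lzero[OF G(1)])
  have "G u h = 0" if u: "u \<in> span (insert b B)" for u
  proof -
    obtain a where a: "u - a *\<^sub>R b \<in> span B" using u span_breakdown_eq by blast
    have eq: "u = (u - a *\<^sub>R b) + a *\<^sub>R (b - b') + a *\<^sub>R b'" by (simp add: algebra_simps)
    have "G u h = G ((u - a *\<^sub>R b) + a *\<^sub>R (b - b') + a *\<^sub>R b') h" by (rule arg_cong[OF eq])
    also have "\<dots> = 0"
      unfolding bilinear_ladd[OF G(1)] bilinear_lmul[OF G(1)] hB[OF a] hB[OF b'(1)] hb' by simp
    finally show ?thesis .
  qed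
  with 1 show ?case by blast
qed

lemma positive_definite_projection:
  fixes G :: "'e::euclidean_space \<Rightarrow> 'e \<Rightarrow> real"
  assumes "bilinear G" "\<And>u. u \<noteq> 0 \<Longrightarrow> G u u > 0" "\<And>u v. G u v = G v u" and N: "subspace N"
  obtains h where "v - h \<in> N" "\<And>u. u \<in> N \<Longrightarrow> G u h = 0"
proof -
  obtain B where B: "B \<subseteq> N" "independent B" "N \<subseteq> span B"
    by (rule basis_exists[of N])
  have fin: "finite B" using B(2) by (rule independent_imp_finite)
  have span: "span B = N" using span_minimal[OF B(1) N] B(3) by (rule antisym)
  obtain h where "v - h \<in> span B" "\<forall>u\<in>span B. G u h = 0"
    using positive_definite_projection_span[OF assms(1-3) fin] by blast
  then show thesis using that[of h] unfolding span by blast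
qed

section \<open>Riemannian manifolds in charts\<close>

locale riemannian =
  fixes A :: "('a::{t2_space, second_countable_topology}, 'e::euclidean_space) atlas" and g :: "'a metric"
  assumes riem: "riemannian_manifold A g"

sublocale riemannian \<subseteq> manifold A
  using riem by unfold_locales (simp add: riemannian_manifold_def)

context riemannian
begin

lemma metric_sym:
  "u \<in> tangent_space A p \<Longrightarrow> v \<in> tangent_space A p \<Longrightarrow> g p u v = g p v u"
  and metric_pos: "u \<in> tangent_space A p \<Longrightarrow> u \<noteq> (\<lambda>_. 0) \<Longrightarrow> g p u u > 0"
  and metric_linear: "u \<in> tangent_space A p \<Longrightarrow> v \<in> tangent_space A p \<Longrightarrow> w \<in> tangent_space A p \<Longrightarrow>
    g p (\<lambda>h. a * u h + b * v h) w = a * g p u w + b * g p v w"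
proof -
  note r = riem[unfolded riemannian_manifold_def, THEN conjunct2, THEN conjunct1, THEN spec, THEN bspec, THEN bspec]
  show "u \<in> tangent_space A p \<Longrightarrow> v \<in> tangent_space A p \<Longrightarrow> g p u v = g p v u" using r by simp
  show "u \<in> tangent_space A p \<Longrightarrow> u \<noteq> (\<lambda>_. 0) \<Longrightarrow> g p u u > 0" using r[of u p u] by blast
  show "u \<in> tangent_space A p \<Longrightarrow> v \<in> tangent_space A p \<Longrightarrow> w \<in> tangent_space A p \<Longrightarrow>
    g p (\<lambda>h. a * u h + b * v h) w = a * g p u w + b * g p v w" using r[of u p v] by blast
qed

lemma metric_coeff_chart:
  "c \<in> A \<Longrightarrow> p \<in> fst c \<Longrightarrow> metric_coeff A g c (snd c p) u v = g p (coord_vec A p c u) (coord_vec A p c v)"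
  by (simp add: metric_coeff_def chart_inv_chart)

lemma metric_coeff_field:
  assumes c: "c \<in> A"
  shows "riemannian_field (snd c ` fst c) (metric_coeff A g c)"
proof
  show "open (snd c ` fst c)" by (rule chart_image_open[OF c])
  show "smooth_on (snd c ` fst c) (\<lambda>x. metric_coeff A g c x u v)" for u v
    using riem c unfolding riemannian_manifold_def by blast
  fix x assume "x \<in> snd c ` fst c"
  then obtain p where x: "x = snd c p" and p: "p \<in> fst c" by blast
  note T = coord_vec_in_tangent_space[OF c p]
  show sym: "metric_coeff A g c x u v = metric_coeff A g c x v u" for u v
    unfolding x metric_coeff_chart[OF c p] by (rule metric_sym[OF T T])
  have left: "metric_coeff A g c x (a *\<^sub>R u + b *\<^sub>R v) w = a * metric_coeff A g c x u w + b * metric_coeff A g c x v w"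
    for a b u v w
    unfolding x metric_coeff_chart[OF c p] coord_vec_linear[OF c p] by (rule metric_linear[OF T T T])
  have lin: "linear (\<lambda>u. metric_coeff A g c x u w)" for w
    using left[of 1 _ 1 _ w] left[of _ _ 0 0 w] by (intro linearI) simp_all
  moreover have "(\<lambda>w. metric_coeff A g c x u w) = (\<lambda>w. metric_coeff A g c x w u)" for u
    by (rule ext) (rule sym)
  ultimately show "bilinear (metric_coeff A g c x)" unfolding bilinear_def by metis
  fix u :: 'e assume "u \<noteq> 0"
  then have "coord_vec A p c u \<noteq> (\<lambda>_. 0)"
    using coord_vec_eq_iff[OF c p, of u 0] coord_vec_zero[OF c p] by simp
  then show "metric_coeff A g c x u u > 0"
    unfolding x metric_coeff_chart[OF c p] by (rule metric_pos[OF T])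
qed

lemma christoffel_eq_chr:
  assumes c: "c \<in> A"
  shows "christoffel A g c x u v = riemannian_field.chr (metric_coeff A g c) x u v"
proof -
  interpret riemannian_field "snd c ` fst c" "metric_coeff A g c" by (rule metric_coeff_field[OF c])
  show ?thesis unfolding christoffel_def chr_def dform_def ..
qed

end

lemma (in form_field) smooth_on_form_compose:
  fixes \<phi> :: "'t::euclidean_space \<Rightarrow> 'a"
  assumes "open T" "smooth_on T \<phi>" "\<phi> ` T \<subseteq> S" "smooth_on T u" "smooth_on T v"
  shows "smooth_on T (\<lambda>x. G (\<phi> x) (u x) (v x))"
proof -
  have "smooth_on T (\<lambda>x. \<Sum>i\<in>Basis. (u x \<bullet> i) * (\<Sum>j\<in>Basis. (v x \<bullet> j) * G (\<phi> x) i j))"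
    by (intro smooth_on_sum smooth_on_mult smooth_on_inner smooth_on_const
          smooth_on_compose[OF assms(1) open_S assms(3) sm assms(2)] assms)
  then show ?thesis
    by (rule smooth_on_cong[OF assms(1), rotated]) (use assms(3) in \<open>auto simp: form_expand\<close>)
qed

section \<open>Conformal submersions in charts\<close>

locale conformal = M: riemannian A g + N: riemannian B g'
  for A :: "('a::{t2_space, second_countable_topology}, 'm::euclidean_space) atlas" and g :: "'a metric"
    and B :: "('b::{t2_space, second_countable_topology}, 'n::euclidean_space) atlas" and g' :: "'b metric" +
  fixes F :: "'a \<Rightarrow> 'b" and l :: "'a \<Rightarrow> real"
  assumes conf: "conformal_submersion A g B g' F l"
begin

lemma F_smooth: "smooth_map A B UNIV F"
  and l_smooth: "smooth_map A (euclidean_atlas :: (real, real) atlas) UNIV l"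
  and l_pos: "l p > 0"
  and conformal: "X \<in> horizontal_space A g B F p \<Longrightarrow> Y \<in> horizontal_space A g B F p \<Longrightarrow>
    g' (F p) (differential B F p X) (differential B F p Y) = (l p)\<^sup>2 * g p X Y"
  using conf unfolding conformal_submersion_def submersion_def by blast+

text \<open>The pullback of \<open>g'\<close> divided by \<open>l^2\<close>. Unlike a formula
  through the orthogonal projection, it is visibly smooth, and it does not depend on a choice of
  chart of \<open>B\<close>.\<close>

definition horizontal_metric :: "('a, 'm) chart \<Rightarrow> 'm \<Rightarrow> 'm \<Rightarrow> 'm \<Rightarrow> real" where
  "horizontal_metric c x u v = (let p = chart_inv c x in
     inverse ((l p)\<^sup>2) * g' (F p) (differential B F p (coord_vec A p c u)) (differential B F p (coord_vec A p c v)))"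

context
  fixes c d assumes c: "c \<in> A" and d: "d \<in> B"
begin

abbreviation "chart_map \<equiv> (\<lambda>x. snd d (F (chart_inv c x)))"
abbreviation "chart_diff x \<equiv> frechet_derivative chart_map (at x)"
abbreviation "chart_dom \<equiv> snd c ` (fst c \<inter> F -` fst d)"

lemma chart_dom_open: "open chart_dom"
proof -
  have "open (F -` fst d)"
    using F_smooth N.chart_open[OF d] continuous_open_preimage[of UNIV F] by (simp add: smooth_map_def)
  then show ?thesis by (rule M.open_chart_image[OF c])
qed

lemma chart_dom_iff: "x \<in> chart_dom \<longleftrightarrow> x \<in> snd c ` fst c \<and> F (chart_inv c x) \<in> fst d"
  using M.chart_image_iff[OF c, of x "F -` fst d"] by simp

lemma chart_map_smooth: "smooth_on chart_dom chart_map"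
  by (rule map_in_charts_smooth[OF F_smooth c d])

lemma chart_map_image: "chart_map ` chart_dom \<subseteq> snd d ` fst d"
  using chart_dom_iff by auto

lemma chart_diff_linear: "x \<in> chart_dom \<Longrightarrow> linear (chart_diff x)"
  using smooth_on_has_derivative[OF chart_map_smooth] has_derivative_linear by blast

lemma differential_eq:
  assumes "x \<in> chart_dom"
  shows "differential B F (chart_inv c x) (coord_vec A (chart_inv c x) c u) = coord_vec B (F (chart_inv c x)) d (chart_diff x u)"
proof -
  have x: "x \<in> snd c ` fst c" "F (chart_inv c x) \<in> fst d" using assms chart_dom_iff by blast+
  show ?thesis
    using differential_coord_vec[OF M.manifold_axioms N.manifold_axioms F_smooth c chart_inv_in[OF x(1)] d x(2), of u]
    unfolding chart_chart_inv[OF x(1)] .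
qed

lemma horizontal_metric_eq:
  assumes "x \<in> chart_dom"
  shows "horizontal_metric c x u v =
    inverse ((l (chart_inv c x))\<^sup>2) * metric_coeff B g' d (chart_map x) (chart_diff x u) (chart_diff x v)"
proof -
  have "F (chart_inv c x) \<in> fst d" using assms chart_dom_iff by blast
  then show ?thesis
    unfolding horizontal_metric_def Let_def differential_eq[OF assms] by (simp add: N.metric_coeff_chart[OF d])
qed

lemma horizontal_metric_null_iff:
  assumes x: "x \<in> chart_dom"
  shows "horizontal_metric c x u u = 0 \<longleftrightarrow> chart_diff x u = 0"
proof -
  interpret H: riemannian_field "snd d ` fst d" "metric_coeff B g' d" by (rule N.metric_coeff_field[OF d])
  have "chart_map x \<in> snd d ` fst d" using chart_map_image x by blast
  then show ?thesis
    unfolding horizontal_metric_eq[OF x] using H.pos[of "chart_map x" "chart_diff x u"] l_pos[of "chart_inv c x"]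
      bilinear_lzero[OF H.bil[of "chart_map x"]] by fastforce
qed

text \<open>In the product rule, every term that keeps \<open>chart_diff x v\<close>
  undifferentiated vanishes. What remains contains the second derivative of the chart map in
  \<open>u\<close> and \<open>v\<close>, whose symmetry is the source of integrability.\<close>

lemma horizontal_metric_dform_vertical:
  assumes x: "x \<in> chart_dom" and v: "chart_diff x v = 0"
    and field: "form_field (snd c ` fst c) (horizontal_metric c)"
  shows "form_field.dform (horizontal_metric c) x u v w =
    inverse ((l (chart_inv c x))\<^sup>2) * metric_coeff B g' d (chart_map x) (frechet_derivative (\<lambda>y. chart_diff y v) (at x) u) (chart_diff x w)"
proof -
  interpret Q: form_field "snd c ` fst c" "horizontal_metric c" by fact
  interpret H: riemannian_field "snd d ` fst d" "metric_coeff B g' d" by (rule N.metric_coeff_field[OF d])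
  have xc: "x \<in> snd c ` fst c" using x chart_dom_iff by blast
  have chart_mapx: "chart_map x \<in> snd d ` fst d" using chart_map_image x by blast
  let ?\<mu> = "\<lambda>y. inverse ((l (chart_inv c y))\<^sup>2)"
  have l_sm: "smooth_on (snd c ` fst c) (\<lambda>y. l (chart_inv c y))"
    using l_smooth c by (simp add: smooth_map_to_euclidean_iff)
  have \<mu>_sm: "smooth_on (snd c ` fst c) ?\<mu>"
    unfolding power2_eq_square using l_pos
    by (intro smooth_on_inverse smooth_on_mult M.chart_image_open c l_sm) (auto simp: less_imp_neq[symmetric])
  note D\<mu> = smooth_on_has_derivative[OF \<mu>_sm xc]
  note DD = smooth_on_has_derivative[OF smooth_on_frechet_derivative[OF chart_map_smooth] x]
  note DH = H.has_derivative_form_along[of chart_map x, OF chart_mapx smooth_on_has_derivative[OF chart_map_smooth x] DD DD]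
  note D = has_derivative_transform_within_open[OF has_derivative_mult[OF D\<mu> DH] chart_dom_open x
      horizontal_metric_eq[symmetric]]
  show ?thesis
    by (rule trans[OF Q.dform_eqI[OF xc D]]) (simp_all add: v bilinear_lzero[OF H.bil[OF chart_mapx]] bilinear_lzero[OF H.dform_bilinear[OF chart_mapx]])
qed

end

lemma chart_cover:
  assumes "x \<in> snd c ` fst c" "c \<in> A"
  obtains d where "d \<in> B" "x \<in> snd c ` (fst c \<inter> F -` fst d)"
proof -
  obtain d where "d \<in> B" "F (chart_inv c x) \<in> fst d" by (rule N.chart_exists)
  then show thesis using that[of d] chart_dom_iff[OF assms(2)] assms(1) by blast
qed

text \<open>Both bilinearity and smoothness are local, so a different chart \<open>d\<close> of the
  base may be used near each point.\<close>

lemma horizontal_metric_form_field: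
  assumes c: "c \<in> A"
  shows "form_field (snd c ` fst c) (horizontal_metric c)"
proof
  show S: "open (snd c ` fst c)" by (rule M.chart_image_open[OF c])
  show "bilinear (horizontal_metric c x)" if x: "x \<in> snd c ` fst c" for x
  proof -
    obtain d where d: "d \<in> B" "x \<in> snd c ` (fst c \<inter> F -` fst d)" using chart_cover[OF x c] .
    interpret H: riemannian_field "snd d ` fst d" "metric_coeff B g' d" by (rule N.metric_coeff_field[OF d(1)])
    have y: "snd d (F (chart_inv c x)) \<in> snd d ` fst d" using chart_map_image[OF c d(1)] d(2) by blast
    note D = chart_diff_linear[OF c d(1) d(2)]
    show ?thesis
      unfolding bilinear_def horizontal_metric_eq[OF c d]
      by (auto intro!: linearI simp: linear_add[OF D] linear_scale[OF D] bilinear_ladd[OF H.bil[OF y]]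
          bilinear_radd[OF H.bil[OF y]] bilinear_lmul[OF H.bil[OF y]] bilinear_rmul[OF H.bil[OF y]] algebra_simps)
  qed
  show "smooth_on (snd c ` fst c) (\<lambda>x. horizontal_metric c x u v)" for u v
  proof (rule smooth_on_local)
    fix x assume x: "x \<in> snd c ` fst c"
    obtain d where d: "d \<in> B" "x \<in> snd c ` (fst c \<inter> F -` fst d)" using chart_cover[OF x c] .
    let ?T = "snd c ` (fst c \<inter> F -` fst d)"
    interpret H: riemannian_field "snd d ` fst d" "metric_coeff B g' d" by (rule N.metric_coeff_field[OF d(1)])
    have T: "open ?T" by (rule chart_dom_open[OF c d(1)])
    have "smooth_on (snd c ` fst c) (\<lambda>y. l (chart_inv c y))"
      using l_smooth c by (simp add: smooth_map_to_euclidean_iff)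
    then have "smooth_on ?T (\<lambda>y. l (chart_inv c y))" by (rule smooth_on_subset) auto
    then have "smooth_on ?T (\<lambda>x. inverse (l (chart_inv c x) * l (chart_inv c x)) *
      metric_coeff B g' d (snd d (F (chart_inv c x))) (frechet_derivative (\<lambda>x. snd d (F (chart_inv c x))) (at x) u)
        (frechet_derivative (\<lambda>x. snd d (F (chart_inv c x))) (at x) v))"
      using l_pos
      by (intro smooth_on_mult smooth_on_inverse T H.smooth_on_form_compose chart_map_smooth[OF c d(1)]
            chart_map_image[OF c d(1)] smooth_on_frechet_derivative) (auto simp: less_imp_neq[symmetric])
    then have "smooth_on ?T (\<lambda>x. horizontal_metric c x u v)"
      by (rule smooth_on_cong[OF T, rotated]) (simp add: horizontal_metric_eq[OF c d(1)] power2_eq_square)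
    with T d(2) show "\<exists>T. open T \<and> x \<in> T \<and> smooth_on T (\<lambda>x. horizontal_metric c x u v)" by blast
  qed
qed

lemma horizontal_metric_chart:
  "c \<in> A \<Longrightarrow> p \<in> fst c \<Longrightarrow> horizontal_metric c (snd c p) u v =
     inverse ((l p)\<^sup>2) * g' (F p) (differential B F p (coord_vec A p c u)) (differential B F p (coord_vec A p c v))"
  by (simp add: horizontal_metric_def M.chart_inv_chart)

lemma vertical_iff:
  assumes c: "c \<in> A" "p \<in> fst c"
  shows "coord_vec A p c u \<in> vertical_space A B F p \<longleftrightarrow> horizontal_metric c (snd c p) u u = 0"
proof -
  obtain d where d: "d \<in> B" "F p \<in> fst d" by (rule N.chart_exists)
  have x: "snd c p \<in> snd c ` (fst c \<inter> F -` fst d)" using c d by blast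
  have "differential B F p (coord_vec A p c u) = (\<lambda>_. 0) \<longleftrightarrow>
      frechet_derivative (\<lambda>x. snd d (F (chart_inv c x))) (at (snd c p)) u = 0"
    using differential_eq[OF c(1) d(1) x, of u] N.coord_vec_eq_iff[OF d, of _ 0]
    unfolding M.chart_inv_chart[OF c] N.coord_vec_zero[OF d] by simp
  then show ?thesis
    unfolding vertical_space_def horizontal_metric_null_iff[OF c(1) d(1) x]
    using M.coord_vec_in_tangent_space[OF c] by simp
qed

lemma horizontal_iff:
  assumes c: "c \<in> A" "p \<in> fst c"
  shows "coord_vec A p c h \<in> horizontal_space A g B F p \<longleftrightarrow>
    (\<forall>u. horizontal_metric c (snd c p) u u = 0 \<longrightarrow> metric_coeff A g c (snd c p) u h = 0)"
proof -
  have "vertical_space A B F p = coord_vec A p c ` {u. horizontal_metric c (snd c p) u u = 0}"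
  proof (intro set_eqI iffI)
    fix v assume v: "v \<in> vertical_space A B F p"
    then have "v \<in> tangent_space A p" by (simp add: vertical_space_def)
    then obtain u where "v = coord_vec A p c u" unfolding M.tangent_space_eq[OF c] by blast
    then show "v \<in> coord_vec A p c ` {u. horizontal_metric c (snd c p) u u = 0}"
      using v vertical_iff[OF c] by simp
  next
    fix v assume "v \<in> coord_vec A p c ` {u. horizontal_metric c (snd c p) u u = 0}"
    then show "v \<in> vertical_space A B F p" using vertical_iff[OF c] by force
  qed
  then show ?thesis
    unfolding horizontal_space_def M.metric_coeff_chart[OF c]
    using M.coord_vec_in_tangent_space[OF c, of h] by simp
qed

text \<open>The null vectors form the kernel of the Jacobian of \<open>F\<close>, a subspace, so the
  orthogonal projection for the metric is available.\<close>

lemma horizontal_decomposition: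
  assumes c: "c \<in> A" and x: "x \<in> snd c ` fst c"
  obtains h where "horizontal_metric c x (v - h) (v - h) = 0"
    "\<And>u. horizontal_metric c x u u = 0 \<Longrightarrow> metric_coeff A g c x u h = 0"
proof -
  interpret G: riemannian_field "snd c ` fst c" "metric_coeff A g c" by (rule M.metric_coeff_field[OF c])
  obtain d where d: "d \<in> B" "x \<in> snd c ` (fst c \<inter> F -` fst d)" using chart_cover[OF x c] .
  note D = chart_diff_linear[OF c d(1) d(2)]
  have "{u. horizontal_metric c x u u = 0} = {u. frechet_derivative (\<lambda>x. snd d (F (chart_inv c x))) (at x) u = 0}"
    unfolding horizontal_metric_null_iff[OF c d] ..
  then have sub: "subspace {u. horizontal_metric c x u u = 0}"
    using linear_subspace_kernel[OF D] by simp
  obtain h where "v - h \<in> {u. horizontal_metric c x u u = 0}"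
    "\<And>u. u \<in> {u. horizontal_metric c x u u = 0} \<Longrightarrow> metric_coeff A g c x u h = 0"
    by (rule positive_definite_projection[OF G.bil[OF x] G.pos[OF x] G.sym[OF x] sub, of v]) blast+
  then show thesis using that[of h] by simp
qed

lemma
  assumes c: "c \<in> A" and x: "x \<in> snd c ` fst c"
  shows horizontal_metric_nonneg: "horizontal_metric c x u u \<ge> 0"
    and horizontal_metric_sym: "horizontal_metric c x u v = horizontal_metric c x v u"
proof -
  obtain d where d: "d \<in> B" "x \<in> snd c ` (fst c \<inter> F -` fst d)" using chart_cover[OF x c] .
  interpret H: riemannian_field "snd d ` fst d" "metric_coeff B g' d" by (rule N.metric_coeff_field[OF d(1)])
  have y: "snd d (F (chart_inv c x)) \<in> snd d ` fst d" using chart_map_image[OF c d(1)] d(2) by blast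
  have "metric_coeff B g' d (snd d (F (chart_inv c x))) v v \<ge> 0" for v
    using H.pos[OF y, of v] bilinear_lzero[OF H.bil[OF y]] by (cases "v = 0") auto
  then show "horizontal_metric c x u u \<ge> 0" unfolding horizontal_metric_eq[OF c d] by simp
  show "horizontal_metric c x u v = horizontal_metric c x v u"
    unfolding horizontal_metric_eq[OF c d] using H.sym[OF y] by simp
qed

lemma submersion_field:
  assumes c: "c \<in> A"
  shows "submersion_field (snd c ` fst c) (metric_coeff A g c) (horizontal_metric c)"
proof -
  interpret G: riemannian_field "snd c ` fst c" "metric_coeff A g c" by (rule M.metric_coeff_field[OF c])
  interpret Q: form_field "snd c ` fst c" "horizontal_metric c" by (rule horizontal_metric_form_field[OF c])
  show ?thesis
  proof
    fix x assume x: "x \<in> snd c ` fst c"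
    show "horizontal_metric c x u v = horizontal_metric c x v u" for u v
      by (rule horizontal_metric_sym[OF c x])
    show "horizontal_metric c x u u \<ge> 0" for u by (rule horizontal_metric_nonneg[OF c x])
    have null: "horizontal_metric c x n w = 0" if "horizontal_metric c x n n = 0" for n w
      by (rule semidefinite_null[OF Q.bil[OF x] horizontal_metric_sym[OF c x] horizontal_metric_nonneg[OF c x] that])
    \<comment> \<open>Conformality enters here: dividing by \<open>l^2\<close> makes the pullback
      agree with the metric on horizontal vectors.\<close>
    have horizontal: "horizontal_metric c x u v = metric_coeff A g c x u v"
      if "\<And>n. horizontal_metric c x n n = 0 \<Longrightarrow> metric_coeff A g c x n u = 0"
        "\<And>n. horizontal_metric c x n n = 0 \<Longrightarrow> metric_coeff A g c x n v = 0" for u v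
    proof -
      obtain p where p: "p \<in> fst c" "x = snd c p" using x by blast
      have "coord_vec A p c u \<in> horizontal_space A g B F p" "coord_vec A p c v \<in> horizontal_space A g B F p"
        unfolding horizontal_iff[OF c p(1)] using that p(2) by blast+
      from conformal[OF this] show ?thesis
        unfolding p(2) horizontal_metric_chart[OF c p(1)] M.metric_coeff_chart[OF c p(1)]
        using l_pos[of p] by simp
    qed
    show "\<exists>h. (\<forall>z. metric_coeff A g c x z h = horizontal_metric c x z v) \<and> horizontal_metric c x (v - h) (v - h) = 0" for v
    proof -
      obtain h where h: "horizontal_metric c x (v - h) (v - h) = 0"
        "\<And>u. horizontal_metric c x u u = 0 \<Longrightarrow> metric_coeff A g c x u h = 0"
        using horizontal_decomposition[OF c x, of v] by blast
      have "metric_coeff A g c x z h = horizontal_metric c x z v" for z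
      proof -
        obtain k where k: "horizontal_metric c x (z - k) (z - k) = 0"
          "\<And>u. horizontal_metric c x u u = 0 \<Longrightarrow> metric_coeff A g c x u k = 0"
          using horizontal_decomposition[OF c x, of z] by blast
        have "metric_coeff A g c x z h = metric_coeff A g c x k h"
          using h(2)[OF k(1)] by (simp add: bilinear_lsub[OF G.bil[OF x]])
        also have "\<dots> = horizontal_metric c x k h" by (rule horizontal[OF k(2) h(2), symmetric])
        also have "\<dots> = horizontal_metric c x z h"
          using null[OF k(1), of h] by (simp add: bilinear_lsub[OF Q.bil[OF x]])
        also have "\<dots> = horizontal_metric c x z v"
          using null[OF h(1), of z] horizontal_metric_sym[OF c x, of z "v - h"] by (simp add: bilinear_rsub[OF Q.bil[OF x]])
        finally show ?thesis .
      qed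
      with h(1) show ?thesis by blast
    qed
    fix u v w assume uv: "horizontal_metric c x u u = 0" "horizontal_metric c x v v = 0"
    obtain d where d: "d \<in> B" "x \<in> snd c ` (fst c \<inter> F -` fst d)" using chart_cover[OF x c] .
    have D: "frechet_derivative (\<lambda>x. snd d (F (chart_inv c x))) (at x) u = 0"
      "frechet_derivative (\<lambda>x. snd d (F (chart_inv c x))) (at x) v = 0"
      using uv unfolding horizontal_metric_null_iff[OF c d] .
    show "Q.dform x u v w = Q.dform x v u w"
      unfolding horizontal_metric_dform_vertical[OF c d D(1) Q.form_field_axioms]
        horizontal_metric_dform_vertical[OF c d D(2) Q.form_field_axioms]
        frechet_derivative_symmetric[OF chart_dom_open[OF c d(1)] chart_map_smooth[OF c d(1)] d(2), of v u] ..
  qed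
qed

text \<open>The horizontal part of \<open>v\<close> has squared length \<open>Q v v\<close>, so the
  squared cosine of the angle is \<open>Q v v / G v v\<close>. This replaces the angle by the two
  quadratic forms.\<close>

lemma sin_horizontal_angle:
  assumes c: "c \<in> A" "p \<in> fst c" and v: "v \<noteq> 0"
  shows "sin (horizontal_angle A g B F p (coord_vec A p c v)) =
    sqrt (1 - horizontal_metric c (snd c p) v v / metric_coeff A g c (snd c p) v v)"
proof -
  interpret submersion_field "snd c ` fst c" "metric_coeff A g c" "horizontal_metric c"
    by (rule submersion_field[OF c(1)])
  let ?x = "snd c p" and ?Q = "horizontal_metric c (snd c p)" and ?G = "metric_coeff A g c (snd c p)"
  have x: "?x \<in> snd c ` fst c" using c by blast
  obtain h where h: "\<And>z. ?G z h = ?Q z v" "?Q (v - h) (v - h) = 0" using projection[OF x] by blast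
  have minus: "(\<lambda>k. coord_vec A p c a k - coord_vec A p c b k) = coord_vec A p c (a - b)" for a b
    using M.coord_vec_linear[OF c, of 1 a "-1" b] by simp
  have part: "horizontal_part A g B F p (coord_vec A p c v) = coord_vec A p c h"
    unfolding horizontal_part_def
  proof (rule the_equality)
    show "coord_vec A p c h \<in> horizontal_space A g B F p \<and>
      (\<lambda>k. coord_vec A p c v k - coord_vec A p c h k) \<in> vertical_space A B F p"
      unfolding minus vertical_iff[OF c] horizontal_iff[OF c] using h Q_null[OF x] by simp
    fix w assume w: "w \<in> horizontal_space A g B F p \<and> (\<lambda>k. coord_vec A p c v k - w k) \<in> vertical_space A B F p"
    then have "w \<in> tangent_space A p" by (simp add: horizontal_space_def)
    then obtain k where k: "w = coord_vec A p c k" unfolding M.tangent_space_eq[OF c] by blast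
    have 1: "?Q (v - k) (v - k) = 0" "\<And>u. ?Q u u = 0 \<Longrightarrow> ?G u k = 0"
      using w unfolding k minus vertical_iff[OF c] horizontal_iff[OF c] by blast+
    \<comment> \<open>The difference of two candidates for the horizontal part is vertical and
      horizontal at once, hence orthogonal to itself.\<close>
    have "?Q (h - k) (h - k) = 0"
    proof -
      have "h - k = (v - k) - (v - h)" by simp
      then have "?Q (h - k) (h - k) = ?Q (v - k) (h - k) - ?Q (v - h) (h - k)"
        by (simp only: bilinear_lsub[OF Q.bil[OF x]])
      then show ?thesis using Q_null[OF x 1(1)] Q_null[OF x h(2)] by simp
    qed
    then have "?G (h - k) k = 0" "?G (h - k) h = 0" using 1(2) h(1) Q_null[OF x] by auto
    then have "?G (h - k) (h - k) = 0" by (simp add: bilinear_rsub[OF bil[OF x]])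
    then have "h - k = 0" using pos[OF x, of "h - k"] by fastforce
    then show "w = coord_vec A p c h" using k by simp
  qed
  have "?G h h = ?Q v v"
    using h(1)[of h] Q_null[OF x h(2), of v] by (simp add: bilinear_lsub[OF Q.bil[OF x]])
  then have angle: "horizontal_angle A g B F p (coord_vec A p c v) = arccos (sqrt (?Q v v / ?G v v))"
    unfolding horizontal_angle_def Let_def part
    by (simp add: M.metric_coeff_chart[OF c, symmetric] real_sqrt_divide)
  have "0 \<le> ?Q v v / ?G v v" "?Q v v / ?G v v \<le> 1"
    using Q_nonneg[OF x, of v] Q_le[OF x, of v] pos[OF x v] by auto
  then show ?thesis
    unfolding angle by (subst sin_arccos) (auto intro: order_trans[of _ 0])
qed

end

section \<open>Geodesics\<close>

text \<open>The geodesic equation may be checked in the given chart at all times, but smoothness of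
  the curve has to be verified in every chart of the atlas through the transition maps.\<close>

lemma chart_curve_geodesic:
  fixes x v :: "real \<Rightarrow> 'm::euclidean_space"
  assumes "riemannian A g" and c: "c \<in> A" and I: "open I" "is_interval I" and x: "smooth_on I x"
    and S: "\<And>t. t \<in> I \<Longrightarrow> x t \<in> snd c ` fst c"
    and x': "\<And>t. t \<in> I \<Longrightarrow> (x has_vector_derivative v t) (at t)"
    and v': "\<And>t. t \<in> I \<Longrightarrow> (v has_vector_derivative
       - riemannian_field.chr (metric_coeff A g c) (x t) (v t) (v t)) (at t)"
  shows "geodesic_on A g I (\<lambda>t. chart_inv c (x t))"
    and "\<And>t. t \<in> I \<Longrightarrow> velocity A (\<lambda>t. chart_inv c (x t)) t = coord_vec A (chart_inv c (x t)) c (v t)"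
proof -
  interpret riemannian A g by fact
  let ?\<alpha> = "\<lambda>t. chart_inv c (x t)"
  have \<alpha>_cont: "continuous_on I ?\<alpha>"
    by (rule continuous_on_compose2[OF continuous_on_chart_inv[OF c] smooth_on_imp_continuous_on[OF x]])
       (use S in auto)
  have \<alpha>_in: "?\<alpha> t \<in> fst c" and \<alpha>_x: "snd c (?\<alpha> t) = x t" if "t \<in> I" for t
    using chart_inv_in[OF S[OF that]] chart_chart_inv[OF S[OF that]] by auto
  have \<alpha>_smooth: "smooth_map (euclidean_atlas :: (real, real) atlas) A I ?\<alpha>"
    unfolding smooth_map_from_euclidean_iff
  proof (intro conjI ballI I \<alpha>_cont)
    fix d assume d: "d \<in> A"
    have op: "open (I \<inter> ?\<alpha> -` fst d)"
      by (rule continuous_open_preimage[OF \<alpha>_cont I(1) chart_open[OF d]])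
    show "smooth_on (I \<inter> ?\<alpha> -` fst d) (\<lambda>t. snd d (?\<alpha> t))"
    proof (rule smooth_on_compose[OF op open_chart_image[OF c chart_open[OF d]] _ transition_smooth[OF c d]])
      show "x ` (I \<inter> ?\<alpha> -` fst d) \<subseteq> snd c ` (fst c \<inter> fst d)"
        using chart_image_iff[OF c, of _ "fst d"] S by auto
      show "smooth_on (I \<inter> ?\<alpha> -` fst d) x" by (rule smooth_on_subset[OF x]) auto
    qed
  qed
  have vd: "vector_derivative (\<lambda>s. snd c (?\<alpha> s)) (at t) = v t" if "t \<in> I" for t
    by (rule vector_derivative_at, rule has_vector_derivative_transform_within_open[OF x'[OF that] I(1) that])
       (simp add: \<alpha>_x)
  have vd2: "vector_derivative (\<lambda>s. vector_derivative (\<lambda>s. snd c (?\<alpha> s)) (at s)) (at t) =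
     - riemannian_field.chr (metric_coeff A g c) (x t) (v t) (v t)" if "t \<in> I" for t
    by (rule vector_derivative_at, rule has_vector_derivative_transform_within_open[OF v'[OF that] I(1) that])
       (simp add: vd)
  show "geodesic_on A g I ?\<alpha>"
    unfolding geodesic_on_def Let_def o_def
  proof (intro conjI ballI I \<alpha>_smooth bexI[OF _ c])
    fix t assume t: "t \<in> I"
    show "?\<alpha> t \<in> fst c" by (rule \<alpha>_in[OF t])
    show "vector_derivative (\<lambda>s. vector_derivative (\<lambda>s. snd c (?\<alpha> s)) (at s)) (at t) +
        christoffel A g c (snd c (?\<alpha> t)) (vector_derivative (\<lambda>s. snd c (?\<alpha> s)) (at t))
          (vector_derivative (\<lambda>s. snd c (?\<alpha> s)) (at t)) = 0"
      by (simp add: vd[OF t] vd2[OF t] christoffel_eq_chr[OF c] \<alpha>_x[OF t])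
  qed
  fix t assume t: "t \<in> I"
  show "velocity A ?\<alpha> t = coord_vec A (?\<alpha> t) c (v t)"
    using velocity_eq[OF \<alpha>_smooth t c \<alpha>_in[OF t]] vd[OF t] by simp
qed

text \<open>The definition ties the chart to the time \<open>t\<close> and may supply another one at
  nearby times. Hence the equations of motion are stated at \<open>t\<close> only, while the
  coordinate description holds on a neighbourhood.\<close>

lemma geodesic_in_chart:
  fixes A :: "('a::{t2_space, second_countable_topology}, 'm::euclidean_space) atlas"
  assumes "riemannian A g" and geo: "geodesic_on A g I \<alpha>" and t: "t \<in> I"
  obtains c J x v where "c \<in> A" "open J" "t \<in> J" "J \<subseteq> I"
    "\<And>s. s \<in> J \<Longrightarrow> \<alpha> s \<in> fst c" "\<And>s. s \<in> J \<Longrightarrow> snd c (\<alpha> s) = x s"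
    "\<And>s. s \<in> J \<Longrightarrow> velocity A \<alpha> s = coord_vec A (\<alpha> s) c (v s)"
    "(x has_vector_derivative v t) (at t)"
    "(v has_vector_derivative - riemannian_field.chr (metric_coeff A g c) (x t) (v t) (v t)) (at t)"
proof -
  interpret riemannian A g by fact
  have \<alpha>: "smooth_map (euclidean_atlas :: (real, real) atlas) A I \<alpha>" and I: "open I"
    using geo by (auto simp: geodesic_on_def)
  define x' where "x' c s = vector_derivative (\<lambda>s. snd c (\<alpha> s)) (at s)"
    for c :: "('a, 'm) chart" and s
  obtain c where c: "c \<in> A" "\<alpha> t \<in> fst c"
    "vector_derivative (x' c) (at t) + christoffel A g c (snd c (\<alpha> t)) (x' c t) (x' c t) = 0"
    using geo t unfolding geodesic_on_def Let_def o_def x'_def by meson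
  let ?J = "I \<inter> \<alpha> -` fst c"
  have J: "open ?J" using \<alpha> c(1) chart_open continuous_open_preimage unfolding smooth_map_def by blast
  have x_sm: "smooth_on ?J (\<lambda>s. snd c (\<alpha> s))" using \<alpha> c(1) by (simp add: smooth_map_from_euclidean_iff)
  have xd: "((\<lambda>s. snd c (\<alpha> s)) has_vector_derivative x' c s) (at s)" if "s \<in> ?J" for s
    unfolding x'_def using curve_has_vector_derivative[OF \<alpha> _ c(1)] that by blast
  \<comment> \<open>The equation in \<open>geodesic_on\<close> is about
    \<open>vector_derivative\<close>, which means something only once \<open>x'\<close> is known to
    be differentiable.\<close>
  have "smooth_on ?J (x' c)"
  proof (rule smooth_on_cong[OF J _ smooth_on_frechet_derivative[OF x_sm, of 1]])
    fix s assume "s \<in> ?J"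
    from fun_cong[OF frechet_derivative_at[OF xd[OF this, unfolded has_vector_derivative_def]], of 1]
    show "frechet_derivative (\<lambda>s. snd c (\<alpha> s)) (at s) 1 = x' c s" by simp
  qed
  then have "x' c differentiable (at t)" using smooth_on_differentiable t c(2) by blast
  then have "(x' c has_vector_derivative vector_derivative (x' c) (at t)) (at t)"
    using vector_derivative_works by blast
  moreover have "vector_derivative (x' c) (at t) =
      - riemannian_field.chr (metric_coeff A g c) (snd c (\<alpha> t)) (x' c t) (x' c t)"
    using c(3) by (simp add: christoffel_eq_chr[OF c(1)] eq_neg_iff_add_eq_0)
  ultimately have x'd: "(x' c has_vector_derivative
      - riemannian_field.chr (metric_coeff A g c) (snd c (\<alpha> t)) (x' c t) (x' c t)) (at t)" by simp
  show thesis
  proof (rule that[OF c(1) J, of "\<lambda>s. snd c (\<alpha> s)" "x' c"])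
    show "velocity A \<alpha> s = coord_vec A (\<alpha> s) c (x' c s)" if "s \<in> ?J" for s
      unfolding x'_def using velocity_eq[OF \<alpha> _ c(1)] that by blast
    show "((\<lambda>s. snd c (\<alpha> s)) has_vector_derivative x' c t) (at t)" using xd t c(2) by blast
  qed (use t c(2) x'd in auto)
qed

text \<open>Stated at a single time, since the chart may change along the curve.\<close>

lemma quadratic_form_constant_along_geodesic:
  fixes q :: "'m::euclidean_space \<Rightarrow> 'm \<Rightarrow> 'm \<Rightarrow> real"
  assumes "form_field S q" "x t \<in> S" "(x has_vector_derivative v t) (at t)" "(v has_vector_derivative - z) (at t)"
    and sym: "q (x t) (v t) z = q (x t) z (v t)"
    and first_integral: "form_field.dform q (x t) (v t) (v t) (v t) = 2 * q (x t) z (v t)"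
  shows "((\<lambda>s. q (x s) (v s) (v s)) has_real_derivative 0) (at t)"
proof -
  interpret form_field S q by fact
  show ?thesis
    by (rule DERIV_cong[OF has_real_derivative_quadratic_form[OF assms(1-4)]])
       (simp add: first_integral bilinear_lneg[OF bil[OF assms(2)]] bilinear_rneg[OF bil[OF assms(2)]] sym)
qed

context riemannian_field
begin

lemma energy_constant:
  assumes "x t \<in> S" "(x has_vector_derivative v t) (at t)"
    "(v has_vector_derivative - chr (x t) (v t) (v t)) (at t)"
  shows "((\<lambda>s. G (x s) (v s) (v s)) has_real_derivative 0) (at t)"
  by (rule quadratic_form_constant_along_geodesic[OF form_field_axioms assms sym[OF assms(1)]])
     (simp add: chr_quadratic[OF assms(1)])

end

section \<open>Clairaut conformal submersions\<close>

text \<open>The Clairaut relation, squared along the geodesic with initial data \<open>x0\<close>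
  and \<open>v0\<close>, says that \<open>e^(2f) (G - Q)\<close> equals a constant times the energy.
  The energy is conserved, so the derivative at time 0 vanishes, and \<open>v0\<close> was
  arbitrary.\<close>

lemma clairaut_infinitesimal:
  fixes A :: "('a::{t2_space, second_countable_topology}, 'm::euclidean_space) atlas"
    and B :: "('b::{t2_space, second_countable_topology}, 'n::euclidean_space) atlas"
  assumes "conformal A g B g' F l"
    and f: "smooth_map A (euclidean_atlas :: (real, real) atlas) UNIV f"
    and Cl: "clairaut_conformal_submersion A g B g' F l (\<lambda>p. exp (f p))"
    and c: "c \<in> A" and x0: "x0 \<in> snd c ` fst c"
  shows "2 * frechet_derivative (\<lambda>x. f (chart_inv c x)) (at x0) v0 *
      (metric_coeff A g c x0 v0 v0 - conformal.horizontal_metric A B g' F l c x0 v0 v0)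
    + form_field.dform (metric_coeff A g c) x0 v0 v0 v0
    - form_field.dform (conformal.horizontal_metric A B g' F l c) x0 v0 v0 v0
    = 2 * (metric_coeff A g c x0 (riemannian_field.chr (metric_coeff A g c) x0 v0 v0) v0 -
        conformal.horizontal_metric A B g' F l c x0 (riemannian_field.chr (metric_coeff A g c) x0 v0 v0) v0)"
proof -
  interpret conformal A g B g' F l by fact
  interpret submersion_field "snd c ` fst c" "metric_coeff A g c" "horizontal_metric c"
    by (rule submersion_field[OF c])
  let ?G = "metric_coeff A g c" and ?Q = "horizontal_metric c"
  let ?\<psi> = "\<lambda>x. f (chart_inv c x)"
  show ?thesis
  proof (cases "v0 = 0")
    case True
    then show ?thesis
      by (simp add: bilinear_rzero[OF bil[OF x0]] bilinear_rzero[OF Q.bil[OF x0]]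
          bilinear_rzero[OF dform_bilinear[OF x0]] bilinear_rzero[OF Q.dform_bilinear[OF x0]])
  next
    case False
    obtain e x v where x: "e > 0" "x 0 = x0" "v 0 = v0" "smooth_on {-e<..<e} x"
      "\<And>t. t \<in> {-e<..<e} \<Longrightarrow> x t \<in> snd c ` fst c" "\<And>t. t \<in> {-e<..<e} \<Longrightarrow> v t \<noteq> 0"
      "\<And>t. t \<in> {-e<..<e} \<Longrightarrow> (x has_vector_derivative v t) (at t)"
      "\<And>t. t \<in> {-e<..<e} \<Longrightarrow> (v has_vector_derivative - chr (x t) (v t) (v t)) (at t)"
      by (rule geodesic_exists[OF x0 False]) blast
    let ?I = "{-e<..<e}" and ?\<alpha> = "\<lambda>t. chart_inv c (x t)"
    have I: "open ?I" "is_interval ?I" "convex ?I" "0 \<in> ?I"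
      using x(1) by (auto simp: is_interval_convex_1)
    have geo: "geodesic_on A g ?I ?\<alpha>"
      by (rule chart_curve_geodesic(1)[where v = v, OF M.riemannian_axioms c I(1,2) x(4)])
         (erule x(5) x(7) x(8))+
    have vel: "velocity A ?\<alpha> t = coord_vec A (?\<alpha> t) c (v t)" if "t \<in> ?I" for t
      by (rule chart_curve_geodesic(2)[OF M.riemannian_axioms c I(1,2) x(4) _ _ _ that])
         (erule x(5) x(7) x(8))+
    have \<alpha>_in: "?\<alpha> t \<in> fst c" and \<alpha>_x: "snd c (?\<alpha> t) = x t" if "t \<in> ?I" for t
      using chart_inv_in[OF x(5)[OF that]] chart_chart_inv[OF x(5)[OF that]] by auto
    have "velocity A ?\<alpha> t \<noteq> (\<lambda>_. 0)" if "t \<in> ?I" for t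
      unfolding vel[OF that] using M.coord_vec_eq_iff[OF c \<alpha>_in[OF that], of "v t" 0]
        M.coord_vec_zero[OF c \<alpha>_in[OF that]] x(6)[OF that] by simp
    with Cl geo obtain k where k: "\<And>t. t \<in> ?I \<Longrightarrow>
      exp (f (?\<alpha> t)) * sin (horizontal_angle A g B F (?\<alpha> t) (velocity A ?\<alpha> t)) = k"
      unfolding clairaut_conformal_submersion_def by blast
    \<comment> \<open>Squaring removes the root in the sine; multiplying by the positive energy
      removes the quotient.\<close>
    have k_eq: "exp (2 * ?\<psi> (x t)) * (?G (x t) (v t) (v t) - ?Q (x t) (v t) (v t)) = k\<^sup>2 * ?G (x t) (v t) (v t)"
      if t: "t \<in> ?I" for t
    proof -
      have pos: "?G (x t) (v t) (v t) > 0" by (rule pos[OF x(5,6)[OF t]])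
      have le: "?Q (x t) (v t) (v t) \<le> ?G (x t) (v t) (v t)" by (rule Q_le[OF x(5)[OF t]])
      have "k = exp (f (?\<alpha> t)) * sqrt (1 - ?Q (x t) (v t) (v t) / ?G (x t) (v t) (v t))"
        using k[OF t] unfolding vel[OF t] sin_horizontal_angle[OF c \<alpha>_in[OF t] x(6)[OF t]] \<alpha>_x[OF t] by simp
      then have "k\<^sup>2 = (exp (f (?\<alpha> t)))\<^sup>2 * (1 - ?Q (x t) (v t) (v t) / ?G (x t) (v t) (v t))"
        using pos le by (simp add: power_mult_distrib)
      also have "(exp (f (?\<alpha> t)))\<^sup>2 = exp (2 * ?\<psi> (x t))" by (simp add: exp_double)
      finally show ?thesis using pos by (simp add: field_simps)
    qed
    have \<psi>_sm: "smooth_on (snd c ` fst c) ?\<psi>" using f c by (simp add: smooth_map_to_euclidean_iff)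
    let ?D = "frechet_derivative ?\<psi> (at x0)"
    have \<psi>_D: "(?\<psi> has_derivative ?D) (at (x 0))" unfolding x(2) by (rule smooth_on_has_derivative[OF \<psi>_sm x0])
    have "((\<lambda>t. ?\<psi> (x t)) has_derivative (\<lambda>h. ?D (h *\<^sub>R v0))) (at 0)"
      using has_derivative_compose[OF x(7)[OF I(4), unfolded has_vector_derivative_def] \<psi>_D] x(3) by simp
    then have \<psi>_x: "((\<lambda>t. ?\<psi> (x t)) has_real_derivative ?D v0) (at 0)"
      unfolding has_field_derivative_def
      by (rule has_derivative_eq_rhs) (simp add: linear_scale[OF has_derivative_linear[OF \<psi>_D]] mult.commute fun_eq_iff)
    have exp_x: "((\<lambda>t. exp (2 * ?\<psi> (x t))) has_real_derivative exp (2 * ?\<psi> x0) * (2 * ?D v0)) (at 0)"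
      using \<psi>_x x(2) by (auto intro!: derivative_eq_intros)
    let ?z = "chr x0 v0 v0"
    have x00: "x 0 \<in> snd c ` fst c" using x0 x(2) by simp
    note G_D = has_real_derivative_quadratic_form[OF form_field_axioms x00 x(7)[OF I(4)] x(8)[OF I(4)]]
    note Q_D = has_real_derivative_quadratic_form[OF Q.form_field_axioms x00 x(7)[OF I(4)] x(8)[OF I(4)]]
    note E_D = energy_constant[OF x00 x(7)[OF I(4)] x(8)[OF I(4)]]
    have lhs: "((\<lambda>t. exp (2 * ?\<psi> (x t)) * (?G (x t) (v t) (v t) - ?Q (x t) (v t) (v t))) has_real_derivative
       exp (2 * ?\<psi> x0) * (2 * ?D v0) * (?G x0 v0 v0 - ?Q x0 v0 v0) +
       (dform x0 v0 v0 v0 + ?G x0 (- ?z) v0 + ?G x0 v0 (- ?z) - (Q.dform x0 v0 v0 v0 + ?Q x0 (- ?z) v0 + ?Q x0 v0 (- ?z)))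
         * exp (2 * ?\<psi> x0)) (at 0)"
      using DERIV_mult[OF exp_x DERIV_diff[OF G_D Q_D]] unfolding x(2,3) .
    have "((\<lambda>t. k\<^sup>2 * ?G (x t) (v t) (v t)) has_real_derivative k\<^sup>2 * 0) (at 0)"
      by (rule DERIV_cmult[OF E_D])
    then have "((\<lambda>t. exp (2 * ?\<psi> (x t)) * (?G (x t) (v t) (v t) - ?Q (x t) (v t) (v t))) has_real_derivative k\<^sup>2 * 0) (at 0)"
      unfolding has_field_derivative_def
      by (rule has_derivative_transform_within_open[OF _ I(1,4)]) (simp only: k_eq)
    from DERIV_unique[OF lhs this]
    have "exp (2 * ?\<psi> x0) * (2 * ?D v0 * (?G x0 v0 v0 - ?Q x0 v0 v0) +
       dform x0 v0 v0 v0 - Q.dform x0 v0 v0 v0 - 2 * (?G x0 ?z v0 - ?Q x0 ?z v0)) = 0"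
      unfolding bilinear_lneg[OF bil[OF x0]] bilinear_rneg[OF bil[OF x0]]
        bilinear_lneg[OF Q.bil[OF x0]] bilinear_rneg[OF Q.bil[OF x0]] sym[OF x0, of v0 ?z] Q_sym[OF x0, of v0 ?z]
      by (simp add: algebra_simps)
    then show ?thesis by simp
  qed
qed

text \<open>With \<open>r = 1\<close> the Clairaut condition says that the horizontal part of the energy is a first integral.\<close>

lemma clairaut_constI:
  fixes A :: "('a::{t2_space, second_countable_topology}, 'm::euclidean_space) atlas"
    and B :: "('b::{t2_space, second_countable_topology}, 'n::euclidean_space) atlas"
  assumes "conformal A g B g' F l"
    and Killing: "\<And>c x v. c \<in> A \<Longrightarrow> x \<in> snd c ` fst c \<Longrightarrow>
      form_field.dform (conformal.horizontal_metric A B g' F l c) x v v v =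
      2 * conformal.horizontal_metric A B g' F l c x (riemannian_field.chr (metric_coeff A g c) x v v) v"
  shows "clairaut_conformal_submersion A g B g' F l (\<lambda>_. 1)"
proof -
  interpret conformal A g B g' F l by fact
  show ?thesis
    unfolding clairaut_conformal_submersion_def
  proof (intro conjI allI impI conf)
    show "smooth_map A (euclidean_atlas :: (real, real) atlas) UNIV (\<lambda>_. 1)"
      by (simp add: smooth_map_to_euclidean_iff smooth_on_const)
    fix I \<alpha>
    assume *: "geodesic_on A g I \<alpha> \<and> (\<forall>t\<in>I. velocity A \<alpha> t \<noteq> (\<lambda>_. 0))"
    then have geo: "geodesic_on A g I \<alpha>" and I: "is_interval I" and nz: "\<And>t. t \<in> I \<Longrightarrow> velocity A \<alpha> t \<noteq> (\<lambda>_. 0)"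
      by (auto simp: geodesic_on_def)
    \<comment> \<open>Energy and horizontal energy are written without charts, because the geodesic
      may leave any given chart; their derivatives are computed in a chart chosen for each time and
      are then integrated over the interval.\<close>
    define E where "E t = g (\<alpha> t) (velocity A \<alpha> t) (velocity A \<alpha> t)" for t
    define K where "K t = inverse ((l (\<alpha> t))\<^sup>2) * g' (F (\<alpha> t)) (differential B F (\<alpha> t) (velocity A \<alpha> t))
        (differential B F (\<alpha> t) (velocity A \<alpha> t))" for t
    have main: "(E has_real_derivative 0) (at t) \<and> (K has_real_derivative 0) (at t) \<and>
        sin (horizontal_angle A g B F (\<alpha> t) (velocity A \<alpha> t)) = sqrt (1 - K t / E t)" if t: "t \<in> I" for t
    proof -
      obtain c J x v where c: "c \<in> A" and J: "open J" "t \<in> J" "J \<subseteq> I"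
        and in_c: "\<And>s. s \<in> J \<Longrightarrow> \<alpha> s \<in> fst c" and x: "\<And>s. s \<in> J \<Longrightarrow> snd c (\<alpha> s) = x s"
        and vel: "\<And>s. s \<in> J \<Longrightarrow> velocity A \<alpha> s = coord_vec A (\<alpha> s) c (v s)"
        and x': "(x has_vector_derivative v t) (at t)"
        and v': "(v has_vector_derivative - riemannian_field.chr (metric_coeff A g c) (x t) (v t) (v t)) (at t)"
        by (rule geodesic_in_chart[OF M.riemannian_axioms geo t]) blast
      interpret submersion_field "snd c ` fst c" "metric_coeff A g c" "horizontal_metric c"
        by (rule submersion_field[OF c])
      have E: "metric_coeff A g c (x s) (v s) (v s) = E s" and K: "horizontal_metric c (x s) (v s) (v s) = K s"
        if "s \<in> J" for s
        unfolding E_def K_def vel[OF that] x[OF that, symmetric]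
        by (rule M.metric_coeff_chart[OF c in_c[OF that]] horizontal_metric_chart[OF c in_c[OF that]])+
      have xt: "x t \<in> snd c ` fst c" using in_c[OF J(2)] x[OF J(2)] by (metis imageI)
      have "(E has_real_derivative 0) (at t)"
        using energy_constant[OF xt x' v'] unfolding has_field_derivative_def
        by (rule has_derivative_transform_within_open[OF _ J(1,2)]) (rule E)
      moreover have "(K has_real_derivative 0) (at t)"
        using quadratic_form_constant_along_geodesic[OF Q.form_field_axioms xt x' v' Q_sym[OF xt] Killing[OF c xt]]
        unfolding has_field_derivative_def
        by (rule has_derivative_transform_within_open[OF _ J(1,2)]) (rule K)
      moreover have "v t \<noteq> 0"
        using nz[OF t] M.coord_vec_zero[OF c in_c[OF J(2)]] unfolding vel[OF J(2)] by auto
      then have "sin (horizontal_angle A g B F (\<alpha> t) (velocity A \<alpha> t)) = sqrt (1 - K t / E t)"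
        unfolding vel[OF J(2)] by (simp add: sin_horizontal_angle[OF c in_c[OF J(2)]] x[OF J(2)] E[OF J(2)] K[OF J(2)])
      ultimately show ?thesis by blast
    qed
    have convex: "convex I" using I is_interval_convex_1 by blast
    have "\<exists>k. \<forall>t\<in>I. E t = k"
      by (rule has_field_derivative_zero_constant[OF convex]) (use main has_field_derivative_at_within in blast)
    moreover have "\<exists>k. \<forall>t\<in>I. K t = k"
      by (rule has_field_derivative_zero_constant[OF convex]) (use main has_field_derivative_at_within in blast)
    ultimately obtain k k' where "\<forall>t\<in>I. E t = k" "\<forall>t\<in>I. K t = k'" by blast
    with main show "\<exists>k. \<forall>t\<in>I. 1 * sin (horizontal_angle A g B F (\<alpha> t) (velocity A \<alpha> t)) = k"
      by (intro exI[of _ "sqrt (1 - k' / k)"]) simp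
  qed simp
qed

text \<open>In coordinates a vertical field is a field of null vectors, and the covariant derivative
  of one along another is again null: it pairs to 0 with every vector, in particular with
  itself.\<close>

lemma totally_geodesic_fibersI:
  fixes A :: "('a::{t2_space, second_countable_topology}, 'm::euclidean_space) atlas"
    and B :: "('b::{t2_space, second_countable_topology}, 'n::euclidean_space) atlas"
  assumes "conformal A g B g' F l"
    and Killing: "\<And>c x v. c \<in> A \<Longrightarrow> x \<in> snd c ` fst c \<Longrightarrow>
      form_field.dform (conformal.horizontal_metric A B g' F l c) x v v v =
      2 * conformal.horizontal_metric A B g' F l c x (riemannian_field.chr (metric_coeff A g c) x v v) v"
  shows "totally_geodesic_fibers A g B F"
  unfolding totally_geodesic_fibers_def
proof (intro allI impI ballI)
  interpret conformal A g B g' F l by fact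
  fix W U V p c
  assume *: "smooth_vector_field A W U \<and> (\<forall>p\<in>W. U p \<in> vertical_space A B F p) \<and>
      smooth_vector_field A W V \<and> (\<forall>p\<in>W. V p \<in> vertical_space A B F p)"
    and p: "p \<in> W" and c: "c \<in> A" "p \<in> fst c"
  interpret submersion_field "snd c ` fst c" "metric_coeff A g c" "horizontal_metric c"
    by (rule submersion_field[OF c(1)])
  let ?V = "\<lambda>x. components c (V (chart_inv c x))"
  let ?T = "snd c ` (fst c \<inter> W)"
  have W: "open W" and V_sm: "smooth_on ?T ?V" using * c(1) by (auto simp: smooth_vector_field_def)
  have T: "open ?T" "snd c p \<in> ?T" "?T \<subseteq> snd c ` fst c" using M.open_chart_image[OF c(1) W] p c(2) by auto
  have null: "horizontal_metric c (snd c q) (components c (X q)) (components c (X q)) = 0"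
    if "q \<in> fst c" "X q \<in> vertical_space A B F q" for X q
  proof -
    have "X q \<in> tangent_space A q" using that(2) by (simp add: vertical_space_def)
    then show ?thesis
      using vertical_iff[OF c(1) that(1), of "components c (X q)"] that(2)
        M.coord_vec_components[OF c(1) that(1)] by simp
  qed
  have V_null: "horizontal_metric c y (?V y) (?V y) = 0" if y: "y \<in> ?T" for y
  proof -
    obtain q where "q \<in> fst c" "q \<in> W" "y = snd c q" using y by blast
    then show ?thesis using null[of q V] * by (simp add: M.chart_inv_chart[OF c(1)])
  qed
  have U_null: "horizontal_metric c (snd c p) (components c (U p)) (components c (U p)) = 0"
    using null[OF c(2)] * p by blast
  have x: "snd c p \<in> snd c ` fst c" using c(2) by blast
  let ?z = "frechet_derivative ?V (at (snd c p)) (components c (U p)) +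
      chr (snd c p) (components c (U p)) (?V (snd c p))"
  have "horizontal_metric c (snd c p) ?z ?z = 0"
    by (rule covariant_derivative_vertical[OF x Killing[OF c(1) x] T
          smooth_on_has_derivative[OF V_sm T(2)] V_null U_null])
  then have "coord_vec A p c ?z \<in> vertical_space A B F p" using vertical_iff[OF c] by blast
  then show "cov_deriv A g c U V p \<in> vertical_space A B F p"
    unfolding cov_deriv_def M.christoffel_eq_chr[OF c(1)] M.chart_inv_chart[OF c] .
qed

section \<open>Conformal change of the metric\<close>

lemma conformal_change_riemannian:
  fixes A :: "('a::{t2_space, second_countable_topology}, 'm::euclidean_space) atlas"
  assumes riem: "riemannian_manifold A g" and f: "smooth_map A (euclidean_atlas :: (real, real) atlas) UNIV f"
  shows "riemannian_manifold A (\<lambda>p u v. exp (- 2 * f p) * g p u v)"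
proof -
  interpret riemannian A g by unfold_locales fact
  show ?thesis
    unfolding riemannian_manifold_def
  proof (intro conjI allI ballI impI)
    fix p u v w and a b :: real
    assume u: "u \<in> tangent_space A p" and v: "v \<in> tangent_space A p"
    show "exp (- 2 * f p) * g p u v = exp (- 2 * f p) * g p v u" using metric_sym[OF u v] by simp
    show "exp (- 2 * f p) * g p u u > 0" if "u \<noteq> (\<lambda>_. 0)" using metric_pos[OF u that] by simp
    show "exp (- 2 * f p) * g p (\<lambda>h. a * u h + b * v h) w =
      a * (exp (- 2 * f p) * g p u w) + b * (exp (- 2 * f p) * g p v w)" if "w \<in> tangent_space A p"
      using metric_linear[OF u v that, of a b] by (simp add: algebra_simps)
  next
    fix c u v assume c: "c \<in> A"
    have "smooth_on (snd c ` fst c) (\<lambda>x. exp (- 2 * f (chart_inv c x)) * metric_coeff A g c x u v)"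
      using f c riem unfolding smooth_map_to_euclidean_iff riemannian_manifold_def
      by (intro smooth_on_mult smooth_on_exp smooth_on_const chart_image_open) auto
    then show "smooth_on (snd c ` fst c) (\<lambda>x. metric_coeff A (\<lambda>p u v. exp (- 2 * f p) * g p u v) c x u v)"
      by (simp add: metric_coeff_def)
  qed (rule mfd)
qed

text \<open>Rescaling the metric preserves orthogonality and hence the horizontal spaces, and the
  factor \<open>exp (f p)\<close> in the dilation, once squared, cancels
  \<open>exp (- 2 * f p)\<close>.\<close>

lemma conformal_change_submersion:
  fixes A :: "('a::{t2_space, second_countable_topology}, 'm::euclidean_space) atlas"
  assumes conf: "conformal_submersion A g B g' F l"
    and f: "smooth_map A (euclidean_atlas :: (real, real) atlas) UNIV f"
  shows "conformal_submersion A (\<lambda>p u v. exp (- 2 * f p) * g p u v) B g' F (\<lambda>p. exp (f p) * l p)"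
proof -
  have riem: "riemannian_manifold A g" using conf by (simp add: conformal_submersion_def)
  interpret riemannian A g by unfold_locales fact
  have horizontal: "horizontal_space A (\<lambda>p u v. exp (- 2 * f p) * g p u v) B F p = horizontal_space A g B F p" for p
    by (simp add: horizontal_space_def)
  have l: "smooth_map A (euclidean_atlas :: (real, real) atlas) UNIV l"
    using conf by (simp add: conformal_submersion_def)
  have "smooth_map A (euclidean_atlas :: (real, real) atlas) UNIV (\<lambda>p. exp (f p) * l p)"
    unfolding smooth_map_to_euclidean_iff
  proof (intro conjI ballI)
    show "continuous_on UNIV (\<lambda>p. exp (f p) * l p)"
      using f l by (intro continuous_intros) (auto simp: smooth_map_to_euclidean_iff)
    show "smooth_on (snd c ` (fst c \<inter> UNIV)) (\<lambda>x. exp (f (chart_inv c x)) * l (chart_inv c x))" if "c \<in> A" for c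
      using f l that chart_image_open unfolding smooth_map_to_euclidean_iff
      by (intro smooth_on_mult smooth_on_exp) auto
  qed simp
  moreover have scale: "(exp (f p) * l p)\<^sup>2 * (exp (- 2 * f p) * r) = (l p)\<^sup>2 * r" for p r
  proof -
    have "(exp (f p))\<^sup>2 * exp (- 2 * f p) = 1" by (simp add: exp_double[symmetric] exp_minus)
    then have "((exp (f p))\<^sup>2 * exp (- 2 * f p)) * ((l p)\<^sup>2 * r) = (l p)\<^sup>2 * r" by simp
    then show ?thesis by (simp only: power_mult_distrib mult_ac)
  qed
  ultimately show ?thesis
    using conf conformal_change_riemannian[OF riem f]
    unfolding conformal_submersion_def horizontal scale by simp
qed

theorem corollary10:
  fixes A :: "('a::{t2_space, second_countable_topology}, 'm::euclidean_space) atlas"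
    and B :: "('b::{t2_space, second_countable_topology}, 'n::euclidean_space) atlas"
    and g :: "'a metric" and g' :: "'b metric"
    and F :: "'a \<Rightarrow> 'b" and l f :: "'a \<Rightarrow> real"
  assumes "riemannian_manifold A g" and "riemannian_manifold B g'"
    and "smooth_map A (euclidean_atlas :: (real, real) atlas) UNIV f"
    and "clairaut_conformal_submersion A g B g' F l (\<lambda>p. exp (f p))"
    and "\<And>b. connected (F -` {b})"
  shows "(\<exists>l'. clairaut_conformal_submersion A (\<lambda>p u v. exp (- 2 * f p) * g p u v) B g' F l' (\<lambda>_. 1)) \<and>
    totally_geodesic_fibers A (\<lambda>p u v. exp (- 2 * f p) * g p u v) B F"
proof -
  let ?g = "\<lambda>p u v. exp (- 2 * f p) * g p u v" and ?l = "\<lambda>p. exp (f p) * l p"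
  have conf: "conformal_submersion A g B g' F l"
    using assms(4) by (simp add: clairaut_conformal_submersion_def)
  note conf' = conformal_change_submersion[OF conf assms(3)]
  have C: "conformal A g B g' F l"
    using assms conf by (intro conformal.intro riemannian.intro conformal_axioms.intro)
  have C': "conformal A ?g B g' F ?l"
    using assms conf' conformal_change_riemannian
    by (intro conformal.intro riemannian.intro conformal_axioms.intro)
  interpret C: conformal A g B g' F l by (rule C)
  interpret C': conformal A ?g B g' F ?l by (rule C')
  \<comment> \<open>This single identity of the new metric yields both conclusions.\<close>
  have Killing: "form_field.dform (C'.horizontal_metric c) x v v v =
      2 * C'.horizontal_metric c x (riemannian_field.chr (metric_coeff A ?g c) x v v) v"
    if c: "c \<in> A" and x: "x \<in> snd c ` fst c" for c x v
  proof (rule clairaut_conformal_change[OF C.submersion_field[OF c] C'.submersion_field[OF c] _ x _ _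
        clairaut_infinitesimal[OF C assms(3,4) c x]])
    show "((\<lambda>x. f (chart_inv c x)) has_derivative frechet_derivative (\<lambda>x. f (chart_inv c x)) (at x)) (at x)"
      using assms(3) c x by (intro smooth_on_has_derivative[of "snd c ` fst c"]) (auto simp: smooth_map_to_euclidean_iff)
    show "metric_coeff A ?g c y u v = exp (- 2 * f (chart_inv c y)) * metric_coeff A g c y u v" for y u v
      by (simp add: metric_coeff_def)
    \<comment> \<open>The pullback of \<open>g'\<close> is unchanged, so the new dilation alone
      makes the horizontal part scale by the same factor as the metric.\<close>
    have "inverse ((exp s * t)\<^sup>2) = exp (- 2 * s) * inverse (t\<^sup>2)" for s t :: real
      by (simp add: power_mult_distrib exp_double[symmetric] exp_minus)
    then show "C'.horizontal_metric c y u v = exp (- 2 * f (chart_inv c y)) * C.horizontal_metric c y u v" for y u v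
      by (simp add: C.horizontal_metric_def C'.horizontal_metric_def Let_def)
  qed
  show ?thesis
    using clairaut_constI[OF C' Killing] totally_geodesic_fibersI[OF C' Killing] by blast
qed

end
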